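(* Let $\Omega$ be a doubly periodic domain (flat $2$-torus) of area $|\Omega|$, let $p_1,\dots,p_m\in\Omega$ be distinct points with positive integer multiplicities $n_1,\dots,n_m$, and $N=\sum_j n_j$. For $\lambda>0$ consider $$(1-e^u)\Delta u-e^u|\nabla u|^2=-\lambda e^u(e^u-1)^2+4\pi\sum_{j=1}^m n_j\delta_{p_j}\quad\text{in }\Omega.$$ There is a critical value $\lambda_c$, satisfying $\lambda_c\ge \frac{27\pi N}{|\Omega|}$, such that this equation has a negative solution if and only if $\lambda\ge\lambda_c$. Moreover, every such solution satisfies $$\lambda\int_\Omega e^u(e^u-1)^2\,dx=4\pi N.$$ Finally, writing the data as $S=\{p_1,\dots,p_m;n_1,\dots,n_m\}$ (where now some $n_i$ may be zero), $\lambda_c(S)$ for the critical value, and $S\le S'$ for $S'=\{p_1,\dots,p_m;n_1',\dots,n_m'\}$ if $n_i\le n_i'$ for all $i$, one has $\lambda_c(S)\le\lambda_c(S')$ whenever $S\le S'$.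
   Context: All functions are doubly periodic on $\Omega$. $\delta_p$ is the Dirac distribution at $p$. A solution of the equation means a function $u\in C^\infty(\Omega\setminus\{p_1,\dots,p_m\})$ satisfying $(1-e^u)\Delta u-e^u|\nabla u|^2=-\lambda e^u(e^u-1)^2$ pointwise on $\Omega\setminus\{p_1,\dots,p_m\}$ and such that near each $p_j$, $u(x)=n_j\ln|x-p_j|^2+f_j(x)$ with $f_j$ smooth near $p_j$. *)

theory Defs
  imports "HOL-Analysis.Analysis"
begin

text \<open>The plane R^2 is identified with the complex numbers. A flat torus is
given by two R-linearly independent periods w1 w2; doubly periodic functions
are functions on the plane invariant under translation by w1 and w2.\<close>

definition period_lattice :: "complex \<Rightarrow> complex \<Rightarrow> complex set" where
  "period_lattice w1 w2 = {of_int a * w1 + of_int b * w2 | a b. True}"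

definition fund_dom :: "complex \<Rightarrow> complex \<Rightarrow> complex set" where
  "fund_dom w1 w2 = {of_real s * w1 + of_real t * w2 | s t. 0 \<le> s \<and> s < 1 \<and> 0 \<le> t \<and> t < 1}"

definition doubly_periodic :: "complex \<Rightarrow> complex \<Rightarrow> (complex \<Rightarrow> real) \<Rightarrow> bool" where
  "doubly_periodic w1 w2 u \<longleftrightarrow> (\<forall>x. u (x + w1) = u x \<and> u (x + w2) = u x)"

fun Ck_on :: "nat \<Rightarrow> complex set \<Rightarrow> (complex \<Rightarrow> real) \<Rightarrow> bool" where
  "Ck_on 0 S f \<longleftrightarrow> continuous_on S f"
| "Ck_on (Suc k) S f \<longleftrightarrow> (\<exists>f1 f2.
      (\<forall>x\<in>S. (f has_derivative (\<lambda>h. Re h * f1 x + Im h * f2 x)) (at x))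
      \<and> Ck_on k S f1 \<and> Ck_on k S f2)"

definition smooth_on :: "complex set \<Rightarrow> (complex \<Rightarrow> real) \<Rightarrow> bool" where
  "smooth_on S f \<longleftrightarrow> (\<forall>k. Ck_on k S f)"

definition dx :: "(complex \<Rightarrow> real) \<Rightarrow> complex \<Rightarrow> real" where
  "dx f x = frechet_derivative f (at x) 1"

definition dy :: "(complex \<Rightarrow> real) \<Rightarrow> complex \<Rightarrow> real" where
  "dy f x = frechet_derivative f (at x) \<i>"

definition laplacian :: "(complex \<Rightarrow> real) \<Rightarrow> complex \<Rightarrow> real" where
  "laplacian f x = dx (dx f) x + dy (dy f) x"

definition grad_sq :: "(complex \<Rightarrow> real) \<Rightarrow> complex \<Rightarrow> real" where
  "grad_sq f x = (dx f x)\<^sup>2 + (dy f x)\<^sup>2"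

definition sing_set :: "complex \<Rightarrow> complex \<Rightarrow> nat \<Rightarrow> (nat \<Rightarrow> complex) \<Rightarrow> complex set" where
  "sing_set w1 w2 m p = {p j + l | j l. j < m \<and> l \<in> period_lattice w1 w2}"

definition is_solution ::
  "complex \<Rightarrow> complex \<Rightarrow> real \<Rightarrow> nat \<Rightarrow> (nat \<Rightarrow> complex) \<Rightarrow> (nat \<Rightarrow> nat) \<Rightarrow> (complex \<Rightarrow> real) \<Rightarrow> bool" where
  "is_solution w1 w2 lam m p n u \<longleftrightarrow>
     doubly_periodic w1 w2 u
   \<and> smooth_on (- sing_set w1 w2 m p) u
   \<and> (\<forall>x. x \<notin> sing_set w1 w2 m p \<longrightarrow>
         (1 - exp (u x)) * laplacian u x - exp (u x) * grad_sq u x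
           = - lam * exp (u x) * (exp (u x) - 1)\<^sup>2)
   \<and> (\<forall>j<m. \<exists>r>0. \<exists>f. smooth_on (ball (p j) r) f \<and>
         (\<forall>x\<in>ball (p j) r - {p j}. u x = real (n j) * ln ((cmod (x - p j))\<^sup>2) + f x))"

definition is_negative_solution ::
  "complex \<Rightarrow> complex \<Rightarrow> real \<Rightarrow> nat \<Rightarrow> (nat \<Rightarrow> complex) \<Rightarrow> (nat \<Rightarrow> nat) \<Rightarrow> (complex \<Rightarrow> real) \<Rightarrow> bool" where
  "is_negative_solution w1 w2 lam m p n u \<longleftrightarrow>
     is_solution w1 w2 lam m p n u \<and> (\<forall>x. x \<notin> sing_set w1 w2 m p \<longrightarrow> u x < 0)"

definition admissible_data :: "complex \<Rightarrow> complex \<Rightarrow> nat \<Rightarrow> (nat \<Rightarrow> complex) \<Rightarrow> bool" where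
  "admissible_data w1 w2 m p \<longleftrightarrow> inj_on p {..<m} \<and> (\<forall>j<m. p j \<in> fund_dom w1 w2)"

end

(* Put v = u - e^u; since u < 0 this is a smooth change of unknown, and the equation becomes
   Laplace v = - lam h(v) + 4 pi sum n_j delta_{p_j} with h = e^u (1 - e^u)^2. Subtracting v_0 = ln W,
   where W is a product of squared moduli of theta functions (times Gaussian factors), leaves the
   regular equation Laplace g = c - lam h(v_0 + g) with c = 4 pi N / |Omega| for a periodic g.
   The Laplacian is handled through averages A_d f(x) = E f(x + d s Z), Z a standard Gaussian in the
   plane and s Rayleigh distributed. Gaussian integration by parts gives A_d f = f + d^2 A_d (Laplace f),
   so A_d = (1 - d^2 Laplace)^(-1): it is positive and gains one derivative, and solving the equation
   means solving g = A_d (g + d^2 (lam h(v_0 + g) - c)), which is monotone in g when 2 lam d^2 = 1.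
   Monotone iteration produces a solution above every subsolution. A solution for lam and larger
   multiplicities is almost a subsolution for smaller ones, and becomes one (after regularizing
   the logarithm) as soon as lam is increased, so the set of admissible lam is an up-set, monotone in
   the data. It is closed because A_d bounds the oscillation of g. Since h <= 4/27 and
   lam h >= c somewhere, lam >= 27 c / 4; the integral identity is the vanishing of the integral of
   Laplace g over a period cell. *)

theory Submission
  imports Defs "HOL-Complex_Analysis.Complex_Analysis" "HOL-Probability.Probability"
    "HOL-Real_Asymp.Real_Asymp"
begin

section \<open>Functions of class C^k in the plane\<close>

text \<open>Origin of the averages: for s Rayleigh, s^2/2 is exponential with mean 1, so A_d is the
  integral over t > 0 of exp (-t) times the heat semigroup at time d^2 t, which is the resolvent. As
  a Gaussian expectation it yields the maximum principle, regularity and a priori bounds alike. The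
  2 in 2 lam d^2 = 1 is the steepest descent of h in v: with y = e^u the slope is y (1 - 3 y), which
  falls to -2 at y = 1. There v = u - e^u has its critical point and h is continued linearly; the
  maximum principle shows afterwards that no solution enters the continued range. The obstacle in
  the iteration is the upper bound. The barrier u = 0 corresponds to g = -1 - v_0, which is infinite
  at the singular points. Averages see neighbourhoods of these points with small weight only, and
  this closes the estimate. In the comparison of two data the correction v_0' - v_0 is singular
  where the multiplicities differ. Regularizing it costs a small error, so lam must increase
  strictly, and the critical value itself is reached by compactness.\<close>

abbreviation pd :: "(complex \<Rightarrow> real) \<Rightarrow> real \<Rightarrow> real \<Rightarrow> complex \<Rightarrow> bool" where
  "pd f a b x \<equiv> (f has_derivative (\<lambda>h. Re h * a + Im h * b)) (at x)"

lemma pd_dx: "pd f a b x \<Longrightarrow> dx f x = a"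
  unfolding dx_def by (simp add: frechet_derivative_at[symmetric])

lemma pd_dy: "pd f a b x \<Longrightarrow> dy f x = b"
  unfolding dy_def by (simp add: frechet_derivative_at[symmetric])

lemma pd_cong_open:
  assumes "open S" "x \<in> S" "\<And>y. y \<in> S \<Longrightarrow> f y = g y" "pd f a b x"
  shows "pd g a b x"
  using has_derivative_transform_within_open[OF assms(4) assms(1) assms(2)] assms(3) by simp

lemma pd_const: "pd (\<lambda>x. c) 0 0 x"
  by simp

lemma pd_add: "pd f a b x \<Longrightarrow> pd g c d x \<Longrightarrow> pd (\<lambda>x. f x + g x) (a + c) (b + d) x"
  by (drule (1) has_derivative_add) (simp add: algebra_simps)

lemma pd_mult: "pd f a b x \<Longrightarrow> pd g c d x \<Longrightarrow>
    pd (\<lambda>x. f x * g x) (a * g x + f x * c) (b * g x + f x * d) x"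
  by (drule (1) has_derivative_mult) (simp add: algebra_simps)

lemma pd_compose:
  assumes "pd f a b x" "(\<psi> has_real_derivative d) (at (f x))"
  shows "pd (\<lambda>x. \<psi> (f x)) (d * a) (d * b) x"
proof -
  have "((\<lambda>x. \<psi> (f x)) has_derivative (\<lambda>h. (Re h * a + Im h * b) * d)) (at x)"
    using has_derivative_compose[OF assms(1) has_field_derivative_imp_has_derivative[OF assms(2)]]
    by (simp add: mult.commute)
  thus ?thesis by (simp add: algebra_simps)
qed

lemma pd_frechet: "f differentiable (at x) \<Longrightarrow> pd f (dx f x) (dy f x) x"
proof -
  assume d: "f differentiable (at x)"
  then interpret l: linear "frechet_derivative f (at x)" by (rule linear_frechet_derivative)
  have "frechet_derivative f (at x) h = Re h * dx f x + Im h * dy f x" for h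
  proof -
    have "h = Re h *\<^sub>R 1 + Im h *\<^sub>R \<i>" by (simp add: complex_eq_iff)
    hence "frechet_derivative f (at x) h = frechet_derivative f (at x) (Re h *\<^sub>R 1 + Im h *\<^sub>R \<i>)"
      by simp
    also have "\<dots> = Re h * dx f x + Im h * dy f x"
      by (simp only: l.add l.scaleR dx_def dy_def real_scaleR_def)
    finally show ?thesis .
  qed
  thus ?thesis using d frechet_derivative_works[of f "at x"] by (metis (no_types, lifting) ext)
qed

lemma has_derivative_shift_iff:
  fixes f :: "complex \<Rightarrow> real"
  shows "((\<lambda>y. f (y + l)) has_derivative D) (at x) \<longleftrightarrow> (f has_derivative D) (at (x + l))"
proof
  have a: "((\<lambda>y. y + c) has_derivative (\<lambda>h. h)) (at z)" for c z :: complex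
    by (auto intro!: derivative_eq_intros)
  show "((\<lambda>y. f (y + l)) has_derivative D) (at x)" if "(f has_derivative D) (at (x + l))"
    using has_derivative_compose[OF a that] .
  assume "((\<lambda>y. f (y + l)) has_derivative D) (at x)"
  hence "((\<lambda>y. f (y + l)) has_derivative D) (at ((x + l) + - l))" by simp
  from has_derivative_compose[OF a this] show "(f has_derivative D) (at (x + l))" by simp
qed

text \<open>No differentiability is assumed: the choice operator in
  \<open>frechet_derivative\<close> faces the same predicate on both sides.\<close>

lemma dx_shift: "dx (\<lambda>y. f (y + l)) x = dx f (x + l)"
  and dy_shift: "dy (\<lambda>y. f (y + l)) x = dy f (x + l)"
  unfolding dx_def dy_def frechet_derivative_def has_derivative_shift_iff by simp_all

lemma laplacian_shift: "laplacian (\<lambda>y. f (y + l)) x = laplacian f (x + l)"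
proof -
  have "dx (\<lambda>y. f (y + l)) = (\<lambda>y. dx f (y + l))" "dy (\<lambda>y. f (y + l)) = (\<lambda>y. dy f (y + l))"
    by (auto simp: dx_shift dy_shift)
  thus ?thesis unfolding laplacian_def by (simp add: dx_shift dy_shift)
qed

lemma dx_cong_open: "open S \<Longrightarrow> x \<in> S \<Longrightarrow> (\<And>y. y \<in> S \<Longrightarrow> f y = g y) \<Longrightarrow> dx f x = dx g x"
  and dy_cong_open: "open S \<Longrightarrow> x \<in> S \<Longrightarrow> (\<And>y. y \<in> S \<Longrightarrow> f y = g y) \<Longrightarrow> dy f x = dy g x"
proof -
  assume *: "open S" "x \<in> S" "\<And>y. y \<in> S \<Longrightarrow> f y = g y"
  have "(f has_derivative D) (at x) \<longleftrightarrow> (g has_derivative D) (at x)" for D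
    using * has_derivative_transform_within_open[of f D x UNIV S g]
      has_derivative_transform_within_open[of g D x UNIV S f] by auto
  thus "dx f x = dx g x" "dy f x = dy g x"
    unfolding dx_def dy_def frechet_derivative_def by simp_all
qed

lemma laplacian_cong_open:
  assumes "open S" "x \<in> S" "\<And>y. y \<in> S \<Longrightarrow> f y = g y"
  shows "laplacian f x = laplacian g x"
proof -
  have "dx f y = dx g y" "dy f y = dy g y" if "y \<in> S" for y
    using that assms(1,3) dx_cong_open[of S y f g] dy_cong_open[of S y f g] by auto
  thus ?thesis unfolding laplacian_def
    using dx_cong_open[of S x "dx f" "dx g"] dy_cong_open[of S x "dy f" "dy g"] assms by simp
qed

lemma Ck_on_SucI:
  assumes "\<And>x. x \<in> S \<Longrightarrow> pd f (f1 x) (f2 x) x" "Ck_on k S f1" "Ck_on k S f2"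
  shows "Ck_on (Suc k) S f"
  using assms by (simp only: Ck_on.simps) blast

lemma Ck_on_SucE:
  assumes "Ck_on (Suc k) S f"
  obtains f1 f2 where "\<And>x. x \<in> S \<Longrightarrow> pd f (f1 x) (f2 x) x" "Ck_on k S f1" "Ck_on k S f2"
  using assms by (simp only: Ck_on.simps) blast

text \<open>The witnesses \<open>f1\<close>, \<open>f2\<close> in \<open>Ck_on\<close> agree with
  \<open>dx f\<close>, \<open>dy f\<close> on S by uniqueness of derivatives; openness lets this
  agreement pass on to all higher derivatives.\<close>

lemma Ck_on_Suc_iff:
  assumes "open S"
  shows "Ck_on (Suc k) S f \<longleftrightarrow> (\<forall>x\<in>S. f differentiable (at x)) \<and> Ck_on k S (dx f) \<and> Ck_on k S (dy f)"
    (is "?L \<longleftrightarrow> ?R")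
proof -
  have cong: "Ck_on k S g" if "Ck_on k S f" "\<And>x. x \<in> S \<Longrightarrow> f x = g x" for k f g
    using that
  proof (induction k arbitrary: f g)
    case 0 thus ?case using continuous_on_eq[of S f g] by simp
  next
    case (Suc k)
    then obtain f1 f2 where "\<forall>x\<in>S. pd f (f1 x) (f2 x) x" "Ck_on k S f1" "Ck_on k S f2" by auto
    moreover have "\<forall>x\<in>S. pd g (f1 x) (f2 x) x"
      using pd_cong_open[OF assms(1)] Suc.prems calculation by blast
    ultimately show ?case by auto
  qed
  show ?thesis
  proof
    assume ?L
    then obtain f1 f2 where *: "\<forall>x\<in>S. pd f (f1 x) (f2 x) x" "Ck_on k S f1" "Ck_on k S f2" by auto
    hence "Ck_on k S (dx f)" "Ck_on k S (dy f)"
      using cong[OF *(2), of "dx f"] cong[OF *(3), of "dy f"] pd_dx pd_dy by metis+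
    thus ?R using *(1) unfolding differentiable_def by blast
  next
    assume ?R
    thus ?L by (intro Ck_on_SucI[of S f "dx f" "dy f"] pd_frechet) simp_all
  qed
qed

lemma Ck_on_cong:
  assumes "Ck_on k S f" "open S" "\<And>x. x \<in> S \<Longrightarrow> f x = g x"
  shows "Ck_on k S g"
  using assms(1,3)
proof (induction k arbitrary: f g)
  case 0 thus ?case using continuous_on_eq[of S f g] by simp
next
  case (Suc k)
  then obtain f1 f2 where "\<forall>x\<in>S. pd f (f1 x) (f2 x) x" "Ck_on k S f1" "Ck_on k S f2" by auto
  moreover have "\<forall>x\<in>S. pd g (f1 x) (f2 x) x"
    using pd_cong_open[OF assms(2)] Suc.prems calculation by blast
  ultimately show ?case by auto
qed

lemma Ck_on_subset: "Ck_on k S f \<Longrightarrow> T \<subseteq> S \<Longrightarrow> Ck_on k T f"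
proof (induction k arbitrary: f)
  case 0 thus ?case by (auto intro: continuous_on_subset)
next
  case (Suc k)
  then obtain f1 f2 where "\<forall>x\<in>S. pd f (f1 x) (f2 x) x" "Ck_on k S f1" "Ck_on k S f2" by auto
  thus ?case using Suc.IH Suc.prems(2) by (intro Ck_on_SucI[of _ _ f1 f2]) auto
qed

lemma Ck_on_imp_continuous: "Ck_on k S f \<Longrightarrow> continuous_on S f"
proof (cases k)
  case (Suc j)
  assume "Ck_on k S f"
  then obtain f1 f2 where "\<forall>x\<in>S. pd f (f1 x) (f2 x) x"
    unfolding Suc Ck_on.simps by blast
  thus ?thesis using has_derivative_continuous continuous_at_imp_continuous_on by blast
qed simp

lemma Ck_on_SucD: "Ck_on (Suc k) S f \<Longrightarrow> Ck_on k S f"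
proof (induction k arbitrary: f)
  case 0
  show ?case unfolding Ck_on.simps(1) by (rule Ck_on_imp_continuous[OF 0])
next
  case (Suc k)
  show ?case
  proof (rule Ck_on_SucE[OF Suc.prems])
    fix f1 f2
    assume *: "\<And>x. x \<in> S \<Longrightarrow> pd f (f1 x) (f2 x) x" "Ck_on (Suc k) S f1" "Ck_on (Suc k) S f2"
    show ?thesis by (rule Ck_on_SucI[OF *(1) Suc.IH[OF *(2)] Suc.IH[OF *(3)]])
  qed
qed

lemma Ck_on_le: "Ck_on k S f \<Longrightarrow> j \<le> k \<Longrightarrow> Ck_on j S f"
  by (induction k) (auto simp: le_Suc_eq dest: Ck_on_SucD simp del: Ck_on.simps)

text \<open>Used to glue smoothness off the singular set with smoothness in balls around the
  singular points.\<close>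

lemma Ck_on_local:
  assumes "open S" "\<And>x. x \<in> S \<Longrightarrow> \<exists>T. open T \<and> x \<in> T \<and> Ck_on k T f"
  shows "Ck_on k S f"
  using assms(2)
proof (induction k arbitrary: f)
  case 0
  thus ?case by (auto intro!: continuous_at_imp_continuous_on) (metis continuous_on_eq_continuous_at)
next
  case (Suc k)
  have "f differentiable (at x)" if "x \<in> S" for x
    using Suc.prems[OF that] Ck_on_Suc_iff by blast
  moreover have "\<exists>T. open T \<and> x \<in> T \<and> Ck_on k T (dx f)" "\<exists>T. open T \<and> x \<in> T \<and> Ck_on k T (dy f)"
    if "x \<in> S" for x
    using Suc.prems[OF that] Ck_on_Suc_iff by blast+
  ultimately show ?case unfolding Ck_on_Suc_iff[OF assms(1)] using Suc.IH by blast
qed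

lemma Ck_on_const: "Ck_on k S (\<lambda>x. c)"
proof (induction k arbitrary: c)
  case (Suc k)
  show ?case by (rule Ck_on_SucI[of _ _ "\<lambda>_. 0" "\<lambda>_. 0"]) (use Suc pd_const in auto)
qed simp

lemma Ck_on_add: "Ck_on k S f \<Longrightarrow> Ck_on k S g \<Longrightarrow> Ck_on k S (\<lambda>x. f x + g x)"
proof (induction k arbitrary: f g)
  case 0 thus ?case by (auto intro: continuous_intros)
next
  case (Suc k)
  from Suc.prems obtain f1 f2 g1 g2 where *: "\<forall>x\<in>S. pd f (f1 x) (f2 x) x" "Ck_on k S f1" "Ck_on k S f2"
    "\<forall>x\<in>S. pd g (g1 x) (g2 x) x" "Ck_on k S g1" "Ck_on k S g2" by auto
  show ?case
    by (rule Ck_on_SucI[OF pd_add[OF *(1)[rule_format] *(4)[rule_format]]])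
       (simp_all add: Suc.IH *(2,3,5,6))
qed

lemma Ck_on_mult: "Ck_on k S f \<Longrightarrow> Ck_on k S g \<Longrightarrow> Ck_on k S (\<lambda>x. f x * g x)"
proof (induction k arbitrary: f g)
  case 0 thus ?case by (auto intro: continuous_intros)
next
  case (Suc k)
  from Suc.prems obtain f1 f2 g1 g2 where *: "\<forall>x\<in>S. pd f (f1 x) (f2 x) x" "Ck_on k S f1" "Ck_on k S f2"
    "\<forall>x\<in>S. pd g (g1 x) (g2 x) x" "Ck_on k S g1" "Ck_on k S g2" by auto
  have "Ck_on k S f" "Ck_on k S g" using Suc.prems by (simp_all only: Ck_on_SucD)
  thus ?case
    by (intro Ck_on_SucI[OF pd_mult[OF *(1)[rule_format] *(4)[rule_format]]])
       (simp_all add: Suc.IH *(2,3,5,6) Ck_on_add)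
qed

lemma Ck_on_cmult: "Ck_on k S f \<Longrightarrow> Ck_on k S (\<lambda>x. c * f x)"
  by (intro Ck_on_mult Ck_on_const)

lemma Ck_on_minus: "Ck_on k S f \<Longrightarrow> Ck_on k S (\<lambda>x. - f x)"
  using Ck_on_cmult[of k S f "-1"] by simp

lemma Ck_on_diff: "Ck_on k S f \<Longrightarrow> Ck_on k S g \<Longrightarrow> Ck_on k S (\<lambda>x. f x - g x)"
  using Ck_on_add[OF _ Ck_on_minus, of k S f g] by simp

lemma Ck_on_power: "Ck_on k S f \<Longrightarrow> Ck_on k S (\<lambda>x. f x ^ n)"
  by (induction n) (auto intro: Ck_on_const Ck_on_mult)

lemma Ck_on_sum: "(\<And>i. i \<in> I \<Longrightarrow> Ck_on k S (f i)) \<Longrightarrow> Ck_on k S (\<lambda>x. \<Sum>i\<in>I. f i x)"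
  by (induction I rule: infinite_finite_induct) (auto intro: Ck_on_const Ck_on_add)

lemma Ck_on_prod: "(\<And>i. i \<in> I \<Longrightarrow> Ck_on k S (f i)) \<Longrightarrow> Ck_on k S (\<lambda>x. \<Prod>i\<in>I. f i x)"
  by (induction I rule: infinite_finite_induct) (auto intro: Ck_on_const Ck_on_mult)

lemma Ck_on_exp: "Ck_on k S f \<Longrightarrow> Ck_on k S (\<lambda>x. exp (f x))"
proof (induction k arbitrary: f)
  case 0 thus ?case by (auto intro: continuous_intros)
next
  case (Suc k)
  from Suc.prems obtain f1 f2 where *: "\<forall>x\<in>S. pd f (f1 x) (f2 x) x" "Ck_on k S f1" "Ck_on k S f2" by auto
  have "Ck_on k S (\<lambda>x. exp (f x))" by (rule Suc.IH[OF Ck_on_SucD[OF Suc.prems]])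
  thus ?case
    by (intro Ck_on_SucI[OF pd_compose[OF *(1)[rule_format] DERIV_exp]])
       (simp_all add: Ck_on_mult *(2,3))
qed

lemma Ck_on_inverse: "Ck_on k S f \<Longrightarrow> (\<And>x. x \<in> S \<Longrightarrow> f x \<noteq> 0) \<Longrightarrow> Ck_on k S (\<lambda>x. inverse (f x))"
proof (induction k arbitrary: f)
  case 0 thus ?case by (auto intro: continuous_intros)
next
  case (Suc k)
  from Suc.prems obtain f1 f2 where *: "\<forall>x\<in>S. pd f (f1 x) (f2 x) x" "Ck_on k S f1" "Ck_on k S f2" by auto
  have c: "Ck_on k S (\<lambda>x. inverse (f x))" by (rule Suc.IH[OF Ck_on_SucD[OF Suc.prems(1)] Suc.prems(2)])
  have "pd (\<lambda>x. inverse (f x)) (- (inverse (f x) * inverse (f x)) * f1 x) (- (inverse (f x) * inverse (f x)) * f2 x) x"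
    if "x \<in> S" for x
    using pd_compose[of f "f1 x" "f2 x" x inverse, OF _ DERIV_inverse] * that Suc.prems(2)[OF that]
    by (simp add: power2_eq_square)
  moreover have "Ck_on k S (\<lambda>x. - (inverse (f x) * inverse (f x)) * f1 x)"
      "Ck_on k S (\<lambda>x. - (inverse (f x) * inverse (f x)) * f2 x)"
    by (intro Ck_on_mult Ck_on_minus c *(2) *(3))+
  ultimately show ?case by (rule Ck_on_SucI)
qed

lemma Ck_on_ln: "Ck_on k S f \<Longrightarrow> (\<And>x. x \<in> S \<Longrightarrow> f x > 0) \<Longrightarrow> Ck_on k S (\<lambda>x. ln (f x))"
proof (cases k)
  case 0 assume "Ck_on k S f" "\<And>x. x \<in> S \<Longrightarrow> f x > 0"
  thus ?thesis using 0 by (auto intro!: continuous_intros simp: less_imp_neq[THEN not_sym])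
next
  case (Suc j) assume **: "Ck_on k S f" "\<And>x. x \<in> S \<Longrightarrow> f x > 0"
  then obtain f1 f2 where *: "\<forall>x\<in>S. pd f (f1 x) (f2 x) x" "Ck_on j S f1" "Ck_on j S f2" using Suc by auto
  have f0: "f x \<noteq> 0" if "x \<in> S" for x using **(2)[OF that] by simp
  have "Ck_on j S (\<lambda>x. inverse (f x))"
    by (rule Ck_on_inverse[OF Ck_on_SucD[OF **(1)[unfolded Suc]] f0])
  hence "Ck_on j S (\<lambda>x. inverse (f x) * f1 x)" "Ck_on j S (\<lambda>x. inverse (f x) * f2 x)"
    by (simp_all add: Ck_on_mult *(2,3))
  moreover have "pd (\<lambda>x. ln (f x)) (inverse (f x) * f1 x) (inverse (f x) * f2 x) x" if "x \<in> S" for x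
    by (rule pd_compose[OF *(1)[rule_format, OF that] DERIV_ln[OF **(2)[OF that]]])
  ultimately show ?thesis unfolding Suc by (intro Ck_on_SucI)
qed

lemma Ck_on_shift: "Ck_on k S f \<Longrightarrow> Ck_on k {x. x + l \<in> S} (\<lambda>x. f (x + l))"
proof (induction k arbitrary: f)
  case 0
  have "continuous_on {x. x + l \<in> S} (f \<circ> (\<lambda>x. x + l))"
    by (rule continuous_on_compose) (use 0 in \<open>auto intro!: continuous_intros elim!: continuous_on_subset\<close>)
  thus ?case by (simp add: o_def)
next
  case (Suc k)
  then obtain f1 f2 where *: "\<forall>x\<in>S. pd f (f1 x) (f2 x) x" "Ck_on k S f1" "Ck_on k S f2" by auto
  show ?case
    by (rule Ck_on_SucI[of _ _ "\<lambda>x. f1 (x + l)" "\<lambda>x. f2 (x + l)"])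
       (use * Suc.IH in \<open>simp_all add: has_derivative_shift_iff\<close>)
qed

section \<open>Second derivatives, the Laplacian and harmonic functions\<close>

lemma C2_D:
  assumes "Ck_on 2 S f" "open S"
  shows "\<And>x. x \<in> S \<Longrightarrow> pd f (dx f x) (dy f x) x"
    "\<And>x. x \<in> S \<Longrightarrow> pd (dx f) (dx (dx f) x) (dy (dx f) x) x"
    "\<And>x. x \<in> S \<Longrightarrow> pd (dy f) (dx (dy f) x) (dy (dy f) x) x"
    "continuous_on S (dx f)" "continuous_on S (dy f)"
    "continuous_on S (dx (dx f))" "continuous_on S (dy (dx f))"
    "continuous_on S (dx (dy f))" "continuous_on S (dy (dy f))"
proof -
  have "Ck_on (Suc (Suc 0)) S f" using assms(1) by (simp only: numeral_2_eq_2)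
  note 1 = this[unfolded Ck_on_Suc_iff[OF assms(2)]]
  note 2 = 1[unfolded Ck_on.simps(1)]
  show "pd f (dx f x) (dy f x) x" if "x \<in> S" for x using 2 that by (intro pd_frechet) blast
  show "pd (dx f) (dx (dx f) x) (dy (dx f) x) x" if "x \<in> S" for x using 2 that by (intro pd_frechet) blast
  show "pd (dy f) (dx (dy f) x) (dy (dy f) x) x" if "x \<in> S" for x using 2 that by (intro pd_frechet) blast
  have d: "dx f differentiable_on S" "dy f differentiable_on S"
    using 2 differentiable_at_imp_differentiable_on by blast+
  show "continuous_on S (dx f)" "continuous_on S (dy f)"
    using d differentiable_imp_continuous_on by blast+
  show "continuous_on S (dx (dx f))" "continuous_on S (dy (dx f))"
    "continuous_on S (dx (dy f))" "continuous_on S (dy (dy f))" using 2 by blast+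
qed

lemma laplacian_eqI:
  assumes "open S" "x \<in> S" "\<And>x. x \<in> S \<Longrightarrow> pd f (f1 x) (f2 x) x"
    "pd f1 a b x" "pd f2 c d x"
  shows "laplacian f x = a + d"
proof -
  have e: "dx f x = f1 x" "dy f x = f2 x" if "x \<in> S" for x using assms(3)[OF that] pd_dx pd_dy by auto
  show ?thesis
    unfolding laplacian_def using dx_cong_open[OF assms(1,2) e(1)] dy_cong_open[OF assms(1,2) e(2)]
      pd_dx[OF assms(4)] pd_dy[OF assms(5)] by auto
qed

lemma continuous_on_laplacian: "Ck_on 2 S f \<Longrightarrow> open S \<Longrightarrow> continuous_on S (laplacian f)"
  unfolding laplacian_def[abs_def] by (intro continuous_on_add C2_D(6,9))

lemma laplacian_add:
  assumes "Ck_on 2 S f" "Ck_on 2 S g" "open S" "x \<in> S"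
  shows "laplacian (\<lambda>x. f x + g x) x = laplacian f x + laplacian g x"
proof -
  note f = C2_D[OF assms(1,3)] and g = C2_D[OF assms(2,3)]
  have "laplacian (\<lambda>x. f x + g x) x = (dx (dx f) x + dx (dx g) x) + (dy (dy f) x + dy (dy g) x)"
    by (rule laplacian_eqI[OF assms(3,4) pd_add[OF f(1) g(1)]
        pd_add[OF f(2) g(2)] pd_add[OF f(3) g(3)]]) (use assms(4) in auto)
  thus ?thesis by (simp add: laplacian_def)
qed

lemma laplacian_const: "laplacian (\<lambda>x. c) x = 0"
  using laplacian_eqI[OF open_UNIV UNIV_I pd_const pd_const pd_const] by simp

text \<open>Source of both terms on the left of the equation: for
  \<open>\<psi> t = t - exp t\<close> the right-hand side is (1 - e^u) Laplace u - e^u |grad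
  u|^2.\<close>

lemma laplacian_compose:
  assumes "Ck_on 2 S f" "open S" "x \<in> S"
    "\<And>x. x \<in> S \<Longrightarrow> (\<psi> has_real_derivative \<psi>' (f x)) (at (f x))"
    "(\<psi>' has_real_derivative d) (at (f x))"
  shows "laplacian (\<lambda>x. \<psi> (f x)) x = \<psi>' (f x) * laplacian f x + d * grad_sq f x"
proof -
  note f = C2_D[OF assms(1,2)]
  note p = pd_compose[OF f(1)[OF assms(3)] assms(5)]
  have "laplacian (\<lambda>x. \<psi> (f x)) x =
      (d * dx f x * dx f x + \<psi>' (f x) * dx (dx f) x) + (d * dy f x * dy f x + \<psi>' (f x) * dy (dy f) x)"
    by (rule laplacian_eqI[OF assms(2,3) pd_compose[OF f(1) assms(4)]
        pd_mult[OF p f(2)[OF assms(3)]] pd_mult[OF p f(3)[OF assms(3)]]])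
  thus ?thesis by (simp add: laplacian_def grad_sq_def algebra_simps power2_eq_square)
qed

lemma laplacian_cmult:
  assumes "Ck_on 2 S f" "open S" "x \<in> S"
  shows "laplacian (\<lambda>x. c * f x) x = c * laplacian f x"
  using laplacian_compose[OF assms, of "\<lambda>t. c * t" "\<lambda>_. c" 0]
  by (auto intro!: derivative_eq_intros)

lemma laplacian_diff:
  assumes "Ck_on 2 S f" "Ck_on 2 S g" "open S" "x \<in> S"
  shows "laplacian (\<lambda>x. f x - g x) x = laplacian f x - laplacian g x"
  using laplacian_add[OF assms(1) Ck_on_cmult[OF assms(2), of "-1"] assms(3,4)]
    laplacian_cmult[OF assms(2-4), of "-1"] by simp

text \<open>Cauchy-Riemann, stated for Re g and - Im g because this pair is closed under
  differentiation; applied to g and its derivative it makes the Laplacian of Re g cancel.\<close>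

lemma pd_holomorphic:
  assumes "g holomorphic_on S" "open S" "x \<in> S"
  shows "pd (\<lambda>z. Re (g z)) (Re (deriv g x)) (- Im (deriv g x)) x"
    "pd (\<lambda>z. - Im (g z)) (- Im (deriv g x)) (- Re (deriv g x)) x"
proof -
  have *: "(g has_derivative (\<lambda>h. deriv g x * h)) (at x)"
    using holomorphic_derivI[OF assms] unfolding has_field_derivative_def .
  show "pd (\<lambda>z. Re (g z)) (Re (deriv g x)) (- Im (deriv g x)) x"
    using has_derivative_Re[OF *] by (simp add: algebra_simps)
  show "pd (\<lambda>z. - Im (g z)) (- Im (deriv g x)) (- Re (deriv g x)) x"
    using has_derivative_minus[OF has_derivative_Im[OF *]] by (simp add: algebra_simps)
qed

text \<open>The second partial - Im f' is the real part of i f', so the induction hypothesis for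
  arbitrary holomorphic functions covers both partials.\<close>

lemma Ck_on_Re_holomorphic:
  assumes "f holomorphic_on S" "open S"
  shows "Ck_on k S (\<lambda>z. Re (f z))"
  using assms(1)
proof (induction k arbitrary: f)
  case 0 thus ?case by (auto intro!: continuous_intros holomorphic_on_imp_continuous_on)
next
  case (Suc k)
  have d: "deriv f holomorphic_on S" using Suc.prems assms(2) by (rule holomorphic_deriv)
  have "(\<lambda>x. \<i> * deriv f x) holomorphic_on S" by (rule holomorphic_on_mult[OF holomorphic_on_const d])
  from Suc.IH[OF this] have "Ck_on k S (\<lambda>x. - Im (deriv f x))" by simp
  thus ?case by (intro Ck_on_SucI[OF pd_holomorphic(1)[OF Suc.prems assms(2)] Suc.IH[OF d]])
qed

lemma laplacian_Re_holomorphic: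
  assumes "f holomorphic_on S" "open S" "x \<in> S"
  shows "laplacian (\<lambda>z. Re (f z)) x = 0"
proof -
  have d: "deriv f holomorphic_on S" using assms(1,2) by (rule holomorphic_deriv)
  show ?thesis
    using laplacian_eqI[OF assms(2,3) pd_holomorphic(1)[OF assms(1,2)]
        pd_holomorphic(1)[OF d assms(2,3)] pd_holomorphic(2)[OF d assms(2,3)]] by simp
qed

text \<open>A strict reversal at one point would spread to a ball inside the exceptional set, but
  balls are uncountable. In this way relations between continuous functions are carried across the
  zeros of a weight.\<close>

lemma le_if_le_off_countable:
  fixes f g :: "complex \<Rightarrow> real"
  assumes "continuous_on UNIV f" "continuous_on UNIV g" "countable (- S)" "\<And>x. x \<in> S \<Longrightarrow> f x \<le> g x"
  shows "f x \<le> g x"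
proof (rule ccontr)
  assume "\<not> f x \<le> g x"
  hence "x \<in> {x. g x < f x}" by auto
  moreover have "open {x. g x < f x}" using assms(1,2) by (intro open_Collect_less) auto
  ultimately obtain e where "e > 0" "ball x e \<subseteq> {x. g x < f x}" using open_contains_ball by blast
  hence "ball x e \<subseteq> - S" using assms(4) by force
  hence "countable (ball x e)" using assms(3) countable_subset by blast
  thus False using \<open>e > 0\<close> uncountable_ball by blast
qed

section \<open>A Gaussian averaging operator\<close>

text \<open>Not a probability measure; only with the factor s does it become the Rayleigh law. That
  factor is kept in the integrand so that it can be integrated by parts.\<close>

definition halfgauss :: "real measure" where
  "halfgauss = density lborel (\<lambda>s. ennreal (indicator {0<..} s * exp (- s\<^sup>2 / 2)))"

definition gauss :: "real measure" where
  "gauss = density lborel (\<lambda>s. ennreal (std_normal_density s))"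

lemma sets_halfgauss[measurable_cong, simp]: "sets halfgauss = sets borel"
  and sets_gauss[measurable_cong, simp]: "sets gauss = sets borel"
  and space_halfgauss[simp]: "space halfgauss = UNIV"
  and space_gauss[simp]: "space gauss = UNIV"
  by (simp_all add: halfgauss_def gauss_def)

lemma integrable_gauss_exp: "integrable lborel (\<lambda>s::real. exp (- s\<^sup>2 / 2) * s ^ k)"
proof -
  have "(\<lambda>s::real. exp (- s\<^sup>2 / 2) * s ^ k) = (\<lambda>s. sqrt (2 * pi) * (std_normal_density s * s ^ k))"
    by (auto simp: std_normal_density_def)
  thus ?thesis using integrable_std_normal_moment[of k] by (simp only: integrable_mult_right)
qed

lemma integrable_halfgauss_iff:
  assumes [measurable]: "f \<in> borel_measurable borel"
  shows "integrable halfgauss (f :: real \<Rightarrow> real) \<longleftrightarrow>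
    integrable lborel (\<lambda>s. indicator {0<..} s * exp (- s\<^sup>2 / 2) * f s)"
  unfolding halfgauss_def by (subst integrable_density) auto

lemma integral_halfgauss:
  assumes [measurable]: "f \<in> borel_measurable borel"
  shows "integral\<^sup>L halfgauss (f :: real \<Rightarrow> real) = (\<integral>s. indicator {0<..} s * exp (- s\<^sup>2 / 2) * f s \<partial>lborel)"
  unfolding halfgauss_def by (subst integral_density) auto

lemma integrable_gauss_iff:
  assumes [measurable]: "f \<in> borel_measurable borel"
  shows "integrable gauss (f :: real \<Rightarrow> real) \<longleftrightarrow> integrable lborel (\<lambda>s. std_normal_density s * f s)"
  unfolding gauss_def by (subst integrable_density) auto

lemma integral_gauss:
  assumes [measurable]: "f \<in> borel_measurable borel"
  shows "integral\<^sup>L gauss (f :: real \<Rightarrow> real) = (\<integral>s. std_normal_density s * f s \<partial>lborel)"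
  unfolding gauss_def by (subst integral_density) auto

lemma integrable_halfgauss_power: "integrable halfgauss (\<lambda>s. s ^ k)"
proof -
  have "integrable lborel (\<lambda>s::real. indicator {0<..} s * (exp (- s\<^sup>2 / 2) * s ^ k))"
    using integrable_mult_indicator[OF _ integrable_gauss_exp, of "{0<..}" k] by simp
  thus ?thesis by (subst integrable_halfgauss_iff) (auto simp: mult.assoc)
qed

lemma integrable_gauss_power: "integrable gauss (\<lambda>s. s ^ k)"
  using integrable_std_normal_moment[of k] by (subst integrable_gauss_iff) auto

interpretation gauss: prob_space gauss
  unfolding gauss_def by (rule prob_space_normal_density) simp

interpretation halfgauss: finite_measure halfgauss
proof
  have "integrable halfgauss (\<lambda>s. 1::real)" using integrable_halfgauss_power[of 0] by simp
  thus "emeasure halfgauss (space halfgauss) \<noteq> \<infinity>"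
    unfolding integrable_iff_bounded by (simp add: top.not_eq_extremum)
qed

interpretation gg: pair_sigma_finite gauss gauss ..
interpretation ggp: pair_prob_space gauss gauss ..
interpretation hgg: pair_sigma_finite halfgauss "gauss \<Otimes>\<^sub>M gauss" ..

text \<open>The factor \<open>s\<close> times the weight is minus the derivative of the weight. The
  boundary term \<open>k 0\<close> later produces the summand \<open>f x\<close> in the resolvent
  identity.\<close>

lemma halfgauss_by_parts:
  fixes k k' :: "real \<Rightarrow> real"
  assumes D: "\<And>s. (k has_real_derivative k' s) (at s)" and c: "continuous_on UNIV k'"
    and B: "\<And>s. \<bar>k s\<bar> \<le> B" "\<And>s. \<bar>k' s\<bar> \<le> B"
  shows "(\<integral>s. s * k s \<partial>halfgauss) = k 0 + (\<integral>s. k' s \<partial>halfgauss)"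
proof -
  have ck: "continuous_on UNIV k" using D DERIV_isCont continuous_at_imp_continuous_on by blast
  have [measurable]: "k \<in> borel_measurable borel" "k' \<in> borel_measurable borel"
    using c ck by (auto intro: borel_measurable_continuous_onI)
  have i1: "integrable halfgauss (\<lambda>s. s * k s)"
  proof (rule Bochner_Integration.integrable_bound[OF integrable_mult_right[OF integrable_halfgauss_power[of 1], of B]])
    have "\<bar>s\<bar> * \<bar>k s\<bar> \<le> \<bar>s\<bar> * \<bar>B\<bar>" for s
      using B(1)[of s] by (intro mult_left_mono) auto
    thus "AE s in halfgauss. norm (s * k s) \<le> norm (B * s ^ 1)" by (auto simp: abs_mult mult.commute)
  qed simp
  have i2: "integrable halfgauss k'"
    by (rule halfgauss.integrable_const_bound[of _ B]) (use B in auto)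
  let ?F = "\<lambda>s. exp (- s\<^sup>2 / 2) * k s"
  let ?f = "\<lambda>s. exp (- s\<^sup>2 / 2) * (k' s - s * k s)"
  have "integrable halfgauss (\<lambda>s. k' s - s * k s)" using i1 i2 by auto
  hence int: "set_integrable lborel {0<..} ?f"
    by (subst (asm) integrable_halfgauss_iff) (auto simp: set_integrable_def mult.assoc)
  have lim: "(?F \<longlongrightarrow> 0) at_top"
  proof (rule Lim_null_comparison)
    show "\<forall>\<^sub>F x in at_top. norm (?F x) \<le> B * exp (- x\<^sup>2 / 2)"
      using B by (auto simp: abs_mult mult.commute intro!: mult_left_mono)
    have "((\<lambda>x::real. exp (- x\<^sup>2 / 2)) \<longlongrightarrow> 0) at_top" by real_asymp
    thus "((\<lambda>x. B * exp (- x\<^sup>2 / 2)) \<longlongrightarrow> 0) at_top" by (rule tendsto_mult_right_zero)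
  qed
  have "(LBINT s=0..\<infinity>. ?f s) = 0 - ?F 0"
  proof (rule interval_integral_FTC_integrable[where F = ?F])
    fix x :: real
    show "(?F has_vector_derivative ?f x) (at x)"
      unfolding has_real_derivative_iff_has_vector_derivative[symmetric]
      using D by (auto intro!: derivative_eq_intros simp: algebra_simps)
    show "isCont ?f x" using c ck
      by (auto intro!: continuous_intros simp: continuous_on_eq_continuous_at)
  next
    show "set_integrable lborel (einterval 0 \<infinity>) ?f" using int by (simp add: zero_ereal_def)
    have "isCont ?F 0" using ck by (auto intro!: continuous_intros simp: continuous_on_eq_continuous_at)
    hence "(?F \<longlongrightarrow> ?F 0) (at_right 0)" unfolding isCont_def filterlim_at_split by simp
    thus "((?F \<circ> real_of_ereal) \<longlongrightarrow> ?F 0) (at_right 0)" unfolding zero_ereal_def ereal_tendsto_simps .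
    show "((?F \<circ> real_of_ereal) \<longlongrightarrow> 0) (at_left \<infinity>)" using lim by (simp add: ereal_tendsto_simps)
  qed simp
  hence "(LBINT s:{0<..}. ?f s) = - k 0" by (simp add: interval_lebesgue_integral_0_infty)
  hence "(\<integral>s. k' s - s * k s \<partial>halfgauss) = - k 0"
    by (subst integral_halfgauss) (auto simp: set_lebesgue_integral_def mult.assoc)
  thus ?thesis using i1 i2 by simp
qed

text \<open>Stein's identity: the same computation as on the half-line, but no boundary term
  survives on the whole line.\<close>

lemma gauss_by_parts:
  fixes k k' :: "real \<Rightarrow> real"
  assumes D: "\<And>s. (k has_real_derivative k' s) (at s)" and c: "continuous_on UNIV k'"
    and B: "\<And>s. \<bar>k s\<bar> \<le> B" "\<And>s. \<bar>k' s\<bar> \<le> B"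
  shows "(\<integral>s. s * k s \<partial>gauss) = (\<integral>s. k' s \<partial>gauss)"
proof -
  have ck: "continuous_on UNIV k" using D DERIV_isCont continuous_at_imp_continuous_on by blast
  have [measurable]: "k \<in> borel_measurable borel" "k' \<in> borel_measurable borel"
    using c ck by (auto intro: borel_measurable_continuous_onI)
  have i1: "integrable gauss (\<lambda>s. s * k s)"
  proof (rule Bochner_Integration.integrable_bound[OF integrable_mult_right[OF integrable_gauss_power[of 1], of B]])
    have "\<bar>s\<bar> * \<bar>k s\<bar> \<le> \<bar>s\<bar> * \<bar>B\<bar>" for s
      using B(1)[of s] by (intro mult_left_mono) auto
    thus "AE s in gauss. norm (s * k s) \<le> norm (B * s ^ 1)" by (auto simp: abs_mult mult.commute)
  qed simp
  have i2: "integrable gauss k'"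
    by (rule gauss.integrable_const_bound[of _ B]) (use B in auto)
  let ?F = "\<lambda>s. std_normal_density s * k s"
  let ?f = "\<lambda>s. std_normal_density s * (k' s - s * k s)"
  have "integrable gauss (\<lambda>s. k' s - s * k s)" using i1 i2 by auto
  hence int: "integrable lborel ?f" by (subst (asm) integrable_gauss_iff) auto
  have lim: "(?F \<longlongrightarrow> 0) F" if "((\<lambda>x::real. exp (- x\<^sup>2 / 2)) \<longlongrightarrow> 0) F" for F
  proof (rule Lim_null_comparison)
    show "\<forall>\<^sub>F x in F. norm (?F x) \<le> B / sqrt (2 * pi) * exp (- x\<^sup>2 / 2)"
    proof (intro always_eventually allI)
      fix x
      have "std_normal_density x * \<bar>k x\<bar> \<le> std_normal_density x * B"
        using B(1)[of x] by (intro mult_left_mono) auto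
      thus "norm (?F x) \<le> B / sqrt (2 * pi) * exp (- x\<^sup>2 / 2)"
        by (simp add: abs_mult std_normal_density_def mult.commute)
    qed
    show "((\<lambda>x. B / sqrt (2 * pi) * exp (- x\<^sup>2 / 2)) \<longlongrightarrow> 0) F" using that by (rule tendsto_mult_right_zero)
  qed
  have l1: "((\<lambda>x::real. exp (- x\<^sup>2 / 2)) \<longlongrightarrow> 0) at_top" by real_asymp
  have l2: "((\<lambda>x::real. exp (- x\<^sup>2 / 2)) \<longlongrightarrow> 0) at_bot" by real_asymp
  have "(LBINT s=-\<infinity>..\<infinity>. ?f s) = 0 - 0"
  proof (rule interval_integral_FTC_integrable[where F = ?F])
    fix x :: real
    define c where "c = 1 / sqrt (2 * pi)"
    have dens: "std_normal_density t = c * exp (- t\<^sup>2 / 2)" for t by (simp add: std_normal_density_def c_def)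
    show "(?F has_vector_derivative ?f x) (at x)"
      unfolding has_real_derivative_iff_has_vector_derivative[symmetric] dens
      using D by (auto intro!: derivative_eq_intros simp: algebra_simps)
    show "isCont ?f x" using c ck unfolding std_normal_density_def
      by (auto intro!: continuous_intros simp: continuous_on_eq_continuous_at)
  next
    show "set_integrable lborel (einterval (-\<infinity>) \<infinity>) ?f" using int by (simp add: set_integrable_def)
    show "((?F \<circ> real_of_ereal) \<longlongrightarrow> 0) (at_right (-\<infinity>))" using lim[OF l2] by (simp add: ereal_tendsto_simps)
    show "((?F \<circ> real_of_ereal) \<longlongrightarrow> 0) (at_left \<infinity>)" using lim[OF l1] by (simp add: ereal_tendsto_simps)
  qed simp
  hence "(\<integral>s. ?f s \<partial>lborel) = 0"
    by (simp add: interval_lebesgue_integral_def set_lebesgue_integral_def)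
  hence "(\<integral>s. k' s - s * k s \<partial>gauss) = 0"
    by (subst integral_gauss) auto
  thus ?thesis using i1 i2 by simp
qed

text \<open>A point \<open>(s, a, b)\<close> is drawn with weight \<open>exp (- s\<^sup>2 / 2)\<close> on \<open>s > 0\<close> and independent standard
  normal \<open>a, b\<close>. Weighting by \<open>s\<close> gives the average \<open>av\<close>, weighting by \<open>a\<close> or \<open>b\<close>
  (\<open>dirw e\<close> for \<open>e = 1, \<i>\<close>) its partial derivatives up to the factor \<open>d\<close>.\<close>

definition hg :: "(real \<times> real \<times> real) measure" where
  "hg = halfgauss \<Otimes>\<^sub>M (gauss \<Otimes>\<^sub>M gauss)"

definition pos :: "real \<Rightarrow> complex \<Rightarrow> real \<times> real \<times> real \<Rightarrow> complex" where
  "pos d x z = x + of_real (d * fst z * fst (snd z)) + of_real (d * fst z * snd (snd z)) * \<i>"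

definition wav :: "(real \<times> real \<times> real \<Rightarrow> real) \<Rightarrow> real \<Rightarrow> (complex \<Rightarrow> real) \<Rightarrow> complex \<Rightarrow> real" where
  "wav w d f x = (\<integral>z. w z * f (pos d x z) \<partial>hg)"

abbreviation av :: "real \<Rightarrow> (complex \<Rightarrow> real) \<Rightarrow> complex \<Rightarrow> real" where
  "av \<equiv> wav fst"

definition dirw :: "complex \<Rightarrow> real \<times> real \<times> real \<Rightarrow> real" where
  "dirw e z = (if e = 1 then fst (snd z) else snd (snd z))"

section \<open>Integrability, bounds and continuity of weighted averages\<close>

lemma sets_hg[measurable_cong]: "sets hg = sets (borel \<Otimes>\<^sub>M (borel \<Otimes>\<^sub>M borel))"
  unfolding hg_def by measurable

lemma integrable_cm: "integrable M f \<Longrightarrow> integrable M (\<lambda>x. c * f x :: real)"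
  by simp

lemma (in pair_sigma_finite) integrable_prod_mult:
  fixes f g :: "_ \<Rightarrow> real"
  assumes "integrable M1 f" "integrable M2 g"
  shows "integrable (M1 \<Otimes>\<^sub>M M2) (\<lambda>z. f (fst z) * g (snd z))"
proof (rule Fubini_integrable)
  have [measurable]: "f \<in> borel_measurable M1" "g \<in> borel_measurable M2" using assms by auto
  show "(\<lambda>z. f (fst z) * g (snd z)) \<in> borel_measurable (M1 \<Otimes>\<^sub>M M2)" by measurable
  show "integrable M1 (\<lambda>x. \<integral>y. norm (f (fst (x, y)) * g (snd (x, y))) \<partial>M2)"
    using assms by (simp add: abs_mult)
  show "AE x in M1. integrable M2 (\<lambda>y. f (fst (x, y)) * g (snd (x, y)))"
    using assms by simp
qed

lemma (in pair_sigma_finite)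
  fixes F :: "_ \<Rightarrow> real"
  assumes "integrable (M1 \<Otimes>\<^sub>M M2) F"
  shows integral_snd_pair: "(\<integral>y. (\<integral>x. F (x, y) \<partial>M1) \<partial>M2) = integral\<^sup>L (M1 \<Otimes>\<^sub>M M2) F"
    and integrable_snd_pair: "integrable M2 (\<lambda>y. \<integral>x. F (x, y) \<partial>M1)"
  using integral_snd[of "\<lambda>x y. F (x, y)"] integrable_snd[of "\<lambda>x y. F (x, y)"] assms
  by simp_all

lemma integrable_gg1: "integrable (gauss \<Otimes>\<^sub>M gauss) (\<lambda>z. fst z)"
  using gg.integrable_prod_mult[OF integrable_gauss_power[of 1] integrable_gauss_power[of 0]] by simp

lemma integrable_gg2: "integrable (gauss \<Otimes>\<^sub>M gauss) (\<lambda>z. snd z)"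
  using gg.integrable_prod_mult[OF integrable_gauss_power[of 0] integrable_gauss_power[of 1]] by simp

lemma integrable_hg_fst: "integrable hg fst"
  using hgg.integrable_prod_mult[OF integrable_halfgauss_power[of 1], of "\<lambda>_. 1"] unfolding hg_def by simp

lemma integrable_dirw: "integrable hg (dirw e)"
proof -
  have "integrable halfgauss (\<lambda>_. 1::real)" by simp
  from hgg.integrable_prod_mult[OF this integrable_gg1] hgg.integrable_prod_mult[OF this integrable_gg2]
  show ?thesis unfolding hg_def dirw_def[abs_def] by (cases "e = 1") simp_all
qed

lemma pos_measurable[measurable]: "pos d x \<in> borel_measurable hg"
  unfolding pos_def[abs_def] by measurable

lemma pos_add: "pos d (x + y) z = pos d x z + y"
  by (simp add: pos_def)

lemma cont_measurable_pos:
  "continuous_on UNIV f \<Longrightarrow> (\<lambda>z. (f (pos d x z) :: real)) \<in> borel_measurable hg"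
  by (rule measurable_compose[OF pos_measurable]) (rule borel_measurable_continuous_onI)

lemma wav_integrable:
  fixes f :: "complex \<Rightarrow> real"
  assumes w: "integrable hg w" and f: "continuous_on UNIV f" and B: "\<And>x. \<bar>f x\<bar> \<le> B"
  shows "integrable hg (\<lambda>z. w z * f (pos d x z))"
proof (rule Bochner_Integration.integrable_bound[OF integrable_cm[OF w, of B]])
  have [measurable]: "w \<in> borel_measurable hg" using w by simp
  note [measurable] = cont_measurable_pos[OF f]
  show "(\<lambda>z. w z * f (pos d x z)) \<in> borel_measurable hg" by measurable
  have "\<bar>w z\<bar> * \<bar>f y\<bar> \<le> \<bar>w z\<bar> * \<bar>B\<bar>" for z y using B[of y] by (intro mult_left_mono) auto
  thus "AE z in hg. norm (w z * f (pos d x z)) \<le> norm (B * w z)"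
    by (intro AE_I2) (simp only: real_norm_def abs_mult mult.commute[of "\<bar>B\<bar>"])
qed

lemma wav_bound:
  assumes w: "integrable hg w" and f: "continuous_on UNIV f" and B: "\<And>x. \<bar>f x\<bar> \<le> B"
  shows "\<bar>wav w d f x\<bar> \<le> B * (\<integral>z. \<bar>w z\<bar> \<partial>hg)"
proof -
  have "\<bar>wav w d f x\<bar> \<le> (\<integral>z. \<bar>w z * f (pos d x z)\<bar> \<partial>hg)"
    unfolding wav_def by (rule integral_abs_bound)
  also have "\<dots> \<le> (\<integral>z. B * \<bar>w z\<bar> \<partial>hg)"
  proof (rule integral_mono)
    show "integrable hg (\<lambda>z. \<bar>w z * f (pos d x z)\<bar>)" using wav_integrable[OF assms] by auto
    show "integrable hg (\<lambda>z. B * \<bar>w z\<bar>)" using w by auto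
    show "\<bar>w z * f (pos d x z)\<bar> \<le> B * \<bar>w z\<bar>" for z
      unfolding abs_mult by (subst mult.commute) (intro mult_right_mono B, simp)
  qed
  finally show ?thesis by simp
qed

lemma wav_tendsto:
  assumes w: "integrable hg w" and f: "\<And>n. continuous_on UNIV (f n)" "continuous_on UNIV g"
    and B: "\<And>n x. \<bar>f n x\<bar> \<le> B" and lim: "\<And>x. (\<lambda>n. f n x) \<longlonglongrightarrow> g x"
  shows "(\<lambda>n. wav w d (f n) x) \<longlonglongrightarrow> wav w d g x"
  unfolding wav_def
proof (rule integral_dominated_convergence[where w = "\<lambda>z. B * \<bar>w z\<bar>"])
  have [measurable]: "w \<in> borel_measurable hg" using w by simp
  note [measurable] = cont_measurable_pos[OF f(1)] cont_measurable_pos[OF f(2)]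
  show "(\<lambda>z. w z * g (pos d x z)) \<in> borel_measurable hg" by measurable
  show "(\<lambda>z. w z * f n (pos d x z)) \<in> borel_measurable hg" for n by measurable
  show "integrable hg (\<lambda>z. B * \<bar>w z\<bar>)" using w by auto
  show "AE z in hg. (\<lambda>n. w z * f n (pos d x z)) \<longlonglongrightarrow> w z * g (pos d x z)"
    using lim by (auto intro!: tendsto_intros)
  show "AE z in hg. norm (w z * f n (pos d x z)) \<le> B * \<bar>w z\<bar>" for n
    by (auto simp: abs_mult mult.commute[of "\<bar>w _\<bar>"] intro!: mult_right_mono B)
qed

lemma wav_shift: "wav w d f (x + y) = wav w d (\<lambda>t. f (t + y)) x"
  by (simp add: wav_def pos_add)

lemma wav_continuous:
  assumes w: "integrable hg w" and f: "continuous_on UNIV f" and B: "\<And>x. \<bar>f x\<bar> \<le> B"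
  shows "continuous_on UNIV (wav w d f)"
proof (rule continuous_at_imp_continuous_on, rule ballI)
  fix x :: complex
  show "isCont (wav w d f) x"
    unfolding isCont_def tendsto_at_iff_sequentially
  proof (intro allI impI, unfold o_def)
    fix X :: "nat \<Rightarrow> complex" assume "X \<longlonglongrightarrow> x"
    hence X: "(\<lambda>n. X n - x) \<longlonglongrightarrow> 0" using LIM_zero by blast
    have "(\<lambda>n. wav w d (\<lambda>t. f (t + (X n - x))) x) \<longlonglongrightarrow> wav w d f x"
    proof (rule wav_tendsto[OF w])
      show "continuous_on UNIV (\<lambda>t. f (t + (X n - x)))" for n
        by (rule continuous_on_compose2[OF f]) (auto intro!: continuous_intros)
      show "(\<lambda>n. f (y + (X n - x))) \<longlonglongrightarrow> f y" for y
      proof -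
        have "(\<lambda>n. y + (X n - x)) \<longlonglongrightarrow> y + 0" by (intro tendsto_intros X)
        thus ?thesis using f isCont_tendsto_compose[of y f] by (auto simp: continuous_on_eq_continuous_at)
      qed
    qed (use f B in auto)
    thus "(\<lambda>n. wav w d f (X n)) \<longlonglongrightarrow> wav w d f x"
      by (simp add: wav_shift[symmetric])
  qed
qed

section \<open>Derivatives of averages and the resolvent identity\<close>

text \<open>Stein's identity in the normal coordinate belonging to \<open>e\<close>, the other two
  coordinates fixed. The chain rule for a \<mapsto> f (y + d s a e) yields the factor d s, and this
  s is the weight \<open>fst\<close> of \<open>av\<close>.\<close>

lemma dirw_by_parts:
  assumes e: "e = 1 \<or> e = \<i>"
    and f: "continuous_on UNIV f" "continuous_on UNIV f1" and B: "\<And>x. \<bar>f x\<bar> \<le> B" "\<And>x. \<bar>f1 x\<bar> \<le> B"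
    and D: "\<And>y t. ((\<lambda>t. f (y + of_real t * e)) has_real_derivative f1 (y + of_real t * e)) (at t)"
  shows "wav (dirw e) d f x = d * av d f1 x"
proof -
  have I1: "integrable hg (\<lambda>z. dirw e z * f (pos d x z))" by (rule wav_integrable[OF integrable_dirw f(1) B(1)])
  have I2: "integrable hg (\<lambda>z. d * (fst z * f1 (pos d x z)))"
    by (intro integrable_mult_right wav_integrable[OF integrable_hg_fst f(2) B(2)])
  have ibp: "(\<integral>a. a * f (y + of_real (c * a) * e) \<partial>gauss) = (\<integral>a. c * f1 (y + of_real (c * a) * e) \<partial>gauss)"
    for y c
  proof (rule gauss_by_parts[where B = "max B (\<bar>c\<bar> * B)"])
    fix s :: real
    show "((\<lambda>a. f (y + of_real (c * a) * e)) has_real_derivative c * f1 (y + of_real (c * s) * e)) (at s)"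
      using DERIV_chain2[where f = "\<lambda>t. f (y + of_real t * e)" and g = "\<lambda>a. c * a", OF D DERIV_cmult[OF DERIV_ident, of c]]
      by (simp add: mult.commute[of c "f1 _"])
    show "\<bar>f (y + of_real (c * s) * e)\<bar> \<le> max B (\<bar>c\<bar> * B)" using B(1) by (simp add: le_max_iff_disj)
    show "\<bar>c * f1 (y + of_real (c * s) * e)\<bar> \<le> max B (\<bar>c\<bar> * B)"
      using mult_left_mono[OF B(2), of "\<bar>c\<bar>"] by (simp add: le_max_iff_disj abs_mult)
  next
    show "continuous_on UNIV (\<lambda>s. c * f1 (y + of_real (c * s) * e))"
      by (intro continuous_intros continuous_on_compose2[OF f(2)]) auto
  qed
  have G1: "integrable (gauss \<Otimes>\<^sub>M gauss) (\<lambda>z. dirw e (s, z) * f (pos d x (s, z)))"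
    and G2: "integrable (gauss \<Otimes>\<^sub>M gauss) (\<lambda>z. d * (s * f1 (pos d x (s, z))))" for s
  proof -
    have m: "(\<lambda>z. pos d x (s, z)) \<in> borel_measurable (gauss \<Otimes>\<^sub>M gauss)"
      unfolding pos_def fst_conv snd_conv by measurable
    have [measurable]: "(\<lambda>z. f (pos d x (s, z))) \<in> borel_measurable (gauss \<Otimes>\<^sub>M gauss)"
       "(\<lambda>z. f1 (pos d x (s, z))) \<in> borel_measurable (gauss \<Otimes>\<^sub>M gauss)"
      using f by (auto intro!: measurable_compose[OF m] borel_measurable_continuous_onI)
    have w: "integrable (gauss \<Otimes>\<^sub>M gauss) (\<lambda>z. dirw e (s, z))"
      using integrable_gg1 integrable_gg2 by (cases "e = 1") (simp_all add: dirw_def)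
    have [measurable]: "(\<lambda>z. dirw e (s, z)) \<in> borel_measurable (gauss \<Otimes>\<^sub>M gauss)" using w by simp
    show "integrable (gauss \<Otimes>\<^sub>M gauss) (\<lambda>z. dirw e (s, z) * f (pos d x (s, z)))"
    proof (rule Bochner_Integration.integrable_bound[OF integrable_cm[OF w, of B]])
      have "\<bar>w\<bar> * \<bar>f y\<bar> \<le> \<bar>w\<bar> * \<bar>B\<bar>" for w y using B(1)[of y] by (intro mult_left_mono) auto
      thus "AE z in gauss \<Otimes>\<^sub>M gauss. norm (dirw e (s, z) * f (pos d x (s, z))) \<le> norm (B * dirw e (s, z))"
        by (intro AE_I2) (simp only: real_norm_def abs_mult mult.commute[of "\<bar>B\<bar>"])
    qed measurable
    show "integrable (gauss \<Otimes>\<^sub>M gauss) (\<lambda>z. d * (s * f1 (pos d x (s, z))))"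
      by (intro integrable_mult_right ggp.P.integrable_const_bound[of _ B]) (use B in auto)
  qed
  have inner: "(\<integral>z. dirw e (s, z) * f (pos d x (s, z)) \<partial>(gauss \<Otimes>\<^sub>M gauss)) =
      (\<integral>z. d * (s * f1 (pos d x (s, z))) \<partial>(gauss \<Otimes>\<^sub>M gauss))" for s
  proof (cases "e = 1")
    case True
    have p: "pos d x (s, a, b) = (x + of_real (d * s * b) * \<i>) + of_real ((d * s) * a) * e" for a b
      by (simp add: pos_def True)
    have "(\<integral>b. \<integral>a. a * f (pos d x (s, a, b)) \<partial>gauss \<partial>gauss) = (\<integral>b. \<integral>a. d * (s * f1 (pos d x (s, a, b))) \<partial>gauss \<partial>gauss)"
      unfolding p ibp by (simp add: mult.assoc)
    thus ?thesis
      unfolding gg.integral_snd_pair[OF G1[of s], symmetric] gg.integral_snd_pair[OF G2[of s], symmetric]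
      by (simp add: dirw_def True)
  next
    case False
    hence ei: "e = \<i>" using e by simp
    have p: "pos d x (s, a, b) = (x + of_real (d * s * a)) + of_real ((d * s) * b) * e" for a b
      by (simp add: pos_def ei)
    have "(\<integral>a. \<integral>b. b * f (pos d x (s, a, b)) \<partial>gauss \<partial>gauss) = (\<integral>a. \<integral>b. d * (s * f1 (pos d x (s, a, b))) \<partial>gauss \<partial>gauss)"
      unfolding p ibp by (simp add: mult.assoc)
    thus ?thesis
      using gg.integral_fst'[OF G1[of s]] gg.integral_fst'[OF G2[of s]]
      by (simp add: dirw_def False)
  qed
  have "wav (dirw e) d f x = (\<integral>s. \<integral>z. dirw e (s, z) * f (pos d x (s, z)) \<partial>(gauss \<Otimes>\<^sub>M gauss) \<partial>halfgauss)"
    unfolding wav_def hg_def by (rule hgg.integral_fst'[symmetric, OF I1[unfolded hg_def]])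
  also have "\<dots> = (\<integral>s. \<integral>z. d * (s * f1 (pos d x (s, z))) \<partial>(gauss \<Otimes>\<^sub>M gauss) \<partial>halfgauss)"
    unfolding inner ..
  also have "\<dots> = (\<integral>z. d * (fst z * f1 (pos d x z)) \<partial>hg)"
    using hgg.integral_fst'[OF I2[unfolded hg_def]] unfolding hg_def by simp
  also have "\<dots> = d * av d f1 x" unfolding wav_def by simp
  finally show ?thesis .
qed

lemma pd_imp_directional:
  assumes "\<And>x. pd f (f1 x) (f2 x) x"
  shows "((\<lambda>t. f (y + of_real t * e)) has_real_derivative
      (Re e * f1 (y + of_real t * e) + Im e * f2 (y + of_real t * e))) (at t)"
proof -
  have "((\<lambda>t. y + of_real t * e) has_derivative (\<lambda>h. of_real h * e)) (at t)"
    by (auto intro!: derivative_eq_intros)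
  from has_derivative_compose[OF this assms]
  have "((\<lambda>t. f (y + of_real t * e)) has_derivative
      (\<lambda>h. Re (of_real h * e) * f1 (y + of_real t * e) + Im (of_real h * e) * f2 (y + of_real t * e))) (at t)" .
  moreover have "(\<lambda>h. Re (of_real h * e) * f1 (y + of_real t * e) + Im (of_real h * e) * f2 (y + of_real t * e))
      = (*) (Re e * f1 (y + of_real t * e) + Im e * f2 (y + of_real t * e))"
    by (simp add: fun_eq_iff algebra_simps)
  ultimately show ?thesis by (simp only: has_field_derivative_def)
qed

definition bdd :: "(complex \<Rightarrow> real) \<Rightarrow> bool" where
  "bdd f \<longleftrightarrow> continuous_on UNIV f \<and> (\<exists>B. \<forall>x. \<bar>f x\<bar> \<le> B)"

text \<open>Partial derivatives everywhere, together with continuity of one of them, give total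
  differentiability.\<close>

lemma pd_from_directional:
  assumes D: "\<And>x. ((\<lambda>t. F (x + of_real t)) has_real_derivative V1 x) (at 0)"
    "\<And>x. ((\<lambda>t. F (x + of_real t * \<i>)) has_real_derivative V2 x) (at 0)"
    and c: "continuous_on UNIV V2"
  shows "pd F (V1 x) (V2 x) x"
proof -
  have D1: "((\<lambda>t. F (Complex t y)) has_derivative (\<lambda>h. h * V1 (Complex a y))) (at a)" for a y
  proof -
    have "Complex a y + of_real t = Complex (t + a) y" for t by (simp add: complex_eq_iff)
    with D(1)[of "Complex a y"] have "((\<lambda>t. F (Complex (t + a) y)) has_real_derivative V1 (Complex a y)) (at 0)"
      by simp
    hence "((\<lambda>t. F (Complex t y)) has_real_derivative V1 (Complex a y)) (at (0 + a))"
      by (subst DERIV_shift)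
    thus ?thesis by (simp add: has_field_derivative_def mult_commute_abs)
  qed
  have D2: "((\<lambda>t. F (Complex y t)) has_derivative (\<lambda>h. h * V2 (Complex y a))) (at a)" for a y
  proof -
    have "Complex y a + of_real t * \<i> = Complex y (t + a)" for t by (simp add: complex_eq_iff)
    with D(2)[of "Complex y a"] have "((\<lambda>t. F (Complex y (t + a))) has_real_derivative V2 (Complex y a)) (at 0)"
      by simp
    hence "((\<lambda>t. F (Complex y t)) has_real_derivative V2 (Complex y a)) (at (0 + a))"
      by (subst DERIV_shift)
    thus ?thesis by (simp add: has_field_derivative_def mult_commute_abs)
  qed
  have "((\<lambda>(a, b). F (Complex a b)) has_derivative
      (\<lambda>(ta, tb). ta * V1 (Complex (Re x) (Im x)) + blinfun_mult_left (V2 (Complex (Re x) (Im x))) tb)) (at (Re x, Im x) within UNIV \<times> UNIV)"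
  proof (rule has_derivative_partialsI[where fy = "\<lambda>a b. blinfun_mult_left (V2 (Complex a b))"])
    show "continuous (at (Re x, Im x) within UNIV \<times> UNIV) (\<lambda>(a, b). blinfun_mult_left (V2 (Complex a b)))"
    proof -
      have "continuous_on UNIV (\<lambda>p::real \<times> real. V2 (Complex (fst p) (snd p)))"
        by (rule continuous_on_compose2[OF c]) (auto intro!: continuous_intros simp: Complex_eq)
      hence "continuous_on UNIV (\<lambda>p::real \<times> real. blinfun_mult_left (V2 (Complex (fst p) (snd p))))"
        by (rule bounded_linear.continuous_on[OF bounded_linear_blinfun_mult_left])
      thus ?thesis by (simp add: continuous_on_eq_continuous_at case_prod_beta')
    qed
    show "((\<lambda>a. F (Complex a (Im x))) has_derivative (\<lambda>ta. ta * V1 (Complex (Re x) (Im x)))) (at (Re x) within UNIV)"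
      using D1 by blast
    show "((\<lambda>b. F (Complex a b)) has_derivative blinfun_apply (blinfun_mult_left (V2 (Complex a b)))) (at b within UNIV)" for a b
      using D2[of a b] by simp
  qed simp_all
  hence "((\<lambda>p. F (Complex (fst p) (snd p))) has_derivative
      (\<lambda>h. fst h * V1 x + snd h * V2 x)) (at (Re x, Im x))"
    by (simp add: case_prod_beta')
  from has_derivative_compose[of "\<lambda>z. (Re z, Im z)" "\<lambda>z. (Re z, Im z)" x UNIV, OF _ this]
  show ?thesis by (simp add: bounded_linear_imp_has_derivative bounded_linear_Pair bounded_linear_Re bounded_linear_Im)
qed

lemma bdd_shift: "bdd f \<Longrightarrow> bdd (\<lambda>y. f (y + c))"
  unfolding bdd_def by (auto intro!: continuous_on_compose2[of UNIV f] continuous_intros)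

lemma wav_diff:
  assumes "integrable hg w" "bdd f" "bdd g"
  shows "wav w d (\<lambda>y. f y - g y) x = wav w d f x - wav w d g x"
proof -
  obtain B C where "\<And>x. \<bar>f x\<bar> \<le> B" "\<And>x. \<bar>g x\<bar> \<le> C" "continuous_on UNIV f" "continuous_on UNIV g"
    using assms unfolding bdd_def by blast
  thus ?thesis unfolding wav_def using wav_integrable[OF assms(1), of f B d x] wav_integrable[OF assms(1), of g C d x]
    by (simp add: right_diff_distrib)
qed

lemma wav_cmult: "wav w d (\<lambda>y. c * f y) x = c * wav w d f x"
  unfolding wav_def by (simp add: mult.left_commute)

text \<open>The gain of one derivative, for \<open>f\<close> merely continuous. The mean
  \<open>m h\<close> of \<open>f\<close> over the segment from y to y + h e is differentiable along
  \<open>e\<close>, its derivative being the difference quotient of \<open>f\<close>. Integration by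
  parts turns \<open>wav (dirw e) d (m h) x / d\<close> into the difference quotient of
  \<open>av d f\<close>, and \<open>m h\<close> tends to \<open>f\<close> as h tends to 0.\<close>

lemma av_directional:
  assumes f: "bdd f" and e: "e = 1 \<or> e = \<i>" and d: "d > 0"
  shows "((\<lambda>t. av d f (x + of_real t * e)) has_real_derivative wav (dirw e) d f x / d) (at 0)"
proof -
  obtain B where B: "\<And>x. \<bar>f x\<bar> \<le> B" and c: "continuous_on UNIV f"
    using f unfolding bdd_def by blast
  define m where "m h y = integral {0..1} (\<lambda>t. f (y + of_real (h * t) * e))" for h y
  have cm: "continuous_on UNIV (m h)" for h
  proof -
    have "continuous_on (UNIV \<times> cbox 0 1) (\<lambda>(y, t). f (y + of_real (h * t) * e))"
      unfolding case_prod_beta' by (rule continuous_on_compose2[OF c]) (auto intro!: continuous_intros)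
    from integral_continuous_on_param[OF this] show ?thesis unfolding m_def by simp
  qed
  have Bm: "\<bar>m h y\<bar> \<le> B" for h y
  proof -
    have "continuous_on {0..1} (\<lambda>t. f (y + of_real (h * t) * e))"
      by (rule continuous_on_compose2[OF c]) (auto intro!: continuous_intros)
    from integral_bound[OF _ this, of B] B show ?thesis unfolding m_def by simp
  qed
  have anti: "\<exists>G. \<forall>r. (G has_real_derivative f (y + of_real r * e)) (at r)" for y
  proof -
    have "isCont (\<lambda>r. f (y + of_real r * e)) r" for r
    proof -
      have "continuous_on UNIV (\<lambda>r. f (y + of_real r * e))"
        by (rule continuous_on_compose2[OF c]) (auto intro!: continuous_intros)
      thus ?thesis by (simp add: continuous_on_eq_continuous_at)
    qed
    thus ?thesis using einterval_antiderivative[of "-\<infinity>" "\<infinity>" "\<lambda>r. f (y + of_real r * e)"]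
      by (auto simp: has_real_derivative_iff_has_vector_derivative)
  qed
  have mG: "m h (y + of_real r * e) = (G (r + h) - G r) / h"
    if "h \<noteq> 0" "\<And>r. (G has_real_derivative f (y + of_real r * e)) (at r)" for G h y r
  proof -
    have "((\<lambda>t. f (y + of_real r * e + of_real (h * t) * e)) has_integral
        (G (r + h * 1) / h - G (r + h * 0) / h)) {0..1}"
    proof (rule fundamental_theorem_of_calculus)
      fix t :: real
      have "((\<lambda>t. G (r + h * t)) has_real_derivative f (y + of_real (r + h * t) * e) * h) (at t)"
        by (rule DERIV_chain2[OF that(2)]) (auto intro!: derivative_eq_intros)
      hence "((\<lambda>t. G (r + h * t) / h) has_real_derivative f (y + of_real (r + h * t) * e) * h / h) (at t)"
        by (rule DERIV_cdivide)
      moreover have "y + of_real (r + h * t) * e = y + of_real r * e + of_real (h * t) * e"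
        by (simp add: algebra_simps)
      ultimately have "((\<lambda>t. G (r + h * t) / h) has_real_derivative f (y + of_real r * e + of_real (h * t) * e)) (at t)"
        by (simp only: nonzero_mult_div_cancel_right[OF that(1)])
      thus "((\<lambda>t. G (r + h * t) / h) has_vector_derivative f (y + of_real r * e + of_real (h * t) * e)) (at t within {0..1})"
        unfolding has_real_derivative_iff_has_vector_derivative by (rule has_vector_derivative_at_within)
    qed simp
    from integral_unique[OF this] show ?thesis unfolding m_def by (simp add: diff_divide_distrib)
  qed
  have key: "wav (dirw e) d (m h) x / d = (av d f (x + of_real h * e) - av d f x) / h" if h: "h \<noteq> 0" for h
  proof -
    let ?f1 = "\<lambda>y. (1 / h) * (f (y + of_real h * e) - f y)"
    have c1: "continuous_on UNIV ?f1"
      by (intro continuous_intros continuous_on_compose2[OF c]) auto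
    have B1: "\<bar>?f1 y\<bar> \<le> max B (2 * B / \<bar>h\<bar>)" for y
    proof -
      have "\<bar>f (y + of_real h * e) - f y\<bar> \<le> 2 * B" using B[of y] B[of "y + of_real h * e"] by linarith
      hence "\<bar>?f1 y\<bar> \<le> 2 * B / \<bar>h\<bar>" using h by (simp add: abs_mult divide_right_mono)
      thus ?thesis by simp
    qed
    have "wav (dirw e) d (m h) x = d * av d ?f1 x"
    proof (rule dirw_by_parts[OF e cm c1 _ B1])
      show "\<bar>m h y\<bar> \<le> max B (2 * B / \<bar>h\<bar>)" for y using Bm[of h y] by (simp add: le_max_iff_disj)
      fix y t
      obtain G where G: "\<And>r. (G has_real_derivative f (y + of_real r * e)) (at r)" using anti by blast
      have *: "((\<lambda>r. G (r + h)) has_real_derivative f (y + of_real (t + h) * e)) (at t)"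
        using G[of "t + h"] by (simp only: DERIV_shift)
      have "((\<lambda>r. (G (r + h) - G r) / h) has_real_derivative
          (f (y + of_real (t + h) * e) - f (y + of_real t * e)) / h) (at t)"
        by (intro DERIV_cdivide DERIV_diff * G)
      moreover have "y + of_real (t + h) * e = y + of_real t * e + of_real h * e" by (simp add: algebra_simps)
      ultimately show "((\<lambda>t. m h (y + of_real t * e)) has_real_derivative ?f1 (y + of_real t * e)) (at t)"
        unfolding mG[OF h G] by (simp add: add.assoc)
    qed
    also have "av d ?f1 x = (1 / h) * (av d f (x + of_real h * e) - av d f x)"
      unfolding wav_cmult using wav_diff[OF integrable_hg_fst bdd_shift[OF f] f] by (simp add: wav_shift)
    finally show ?thesis using d by simp
  qed
  show ?thesis unfolding DERIV_def tendsto_at_iff_sequentially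
  proof (intro allI impI, unfold o_def)
    fix X :: "nat \<Rightarrow> real" assume X: "\<forall>i. X i \<in> UNIV - {0}" "X \<longlonglongrightarrow> 0"
    have "(\<lambda>n. wav (dirw e) d (m (X n)) x) \<longlonglongrightarrow> wav (dirw e) d f x"
    proof (rule wav_tendsto[OF integrable_dirw cm c Bm])
      fix y
      obtain G where G: "\<And>r. (G has_real_derivative f (y + of_real r * e)) (at r)" using anti by blast
      have "(\<lambda>h. (G (0 + h) - G 0) / h) \<midarrow>0\<rightarrow> f (y + of_real 0 * e)" using G[of 0] unfolding DERIV_def .
      hence "(\<lambda>n. (G (0 + X n) - G 0) / X n) \<longlonglongrightarrow> f (y + of_real 0 * e)"
        using X unfolding tendsto_at_iff_sequentially by (auto simp: o_def)
      moreover have "m (X n) y = (G (0 + X n) - G 0) / X n" for n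
        using mG[OF _ G, of "X n" 0] X(1) by simp
      ultimately show "(\<lambda>n. m (X n) y) \<longlonglongrightarrow> f y" by simp
    qed
    hence "(\<lambda>n. wav (dirw e) d (m (X n)) x / d) \<longlonglongrightarrow> wav (dirw e) d f x / d"
      using d by (intro tendsto_intros) auto
    moreover have "wav (dirw e) d (m (X n)) x / d = (av d f (x + of_real (X n) * e) - av d f x) / X n" for n
      using key X(1) by simp
    ultimately show "(\<lambda>n. (av d f (x + of_real (0 + X n) * e) - av d f (x + of_real 0 * e)) / X n)
        \<longlonglongrightarrow> wav (dirw e) d f x / d" by simp
  qed
qed

lemma wav_bdd: "integrable hg w \<Longrightarrow> bdd f \<Longrightarrow> bdd (wav w d f)"
  unfolding bdd_def using wav_continuous[of w f _ d] wav_bound[of w f _ d] by blast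

lemma av_pd:
  assumes f: "bdd f" and d: "d > 0"
  shows "pd (av d f) (wav (dirw 1) d f x / d) (wav (dirw \<i>) d f x / d) x"
proof (rule pd_from_directional)
  show "((\<lambda>t. av d f (x + of_real t)) has_real_derivative wav (dirw 1) d f x / d) (at 0)" for x
    using av_directional[OF f _ d, of 1 x] by simp
  show "((\<lambda>t. av d f (x + of_real t * \<i>)) has_real_derivative wav (dirw \<i>) d f x / d) (at 0)" for x
    using av_directional[OF f _ d, of \<i> x] by simp
  have "bdd (wav (dirw \<i>) d f)" by (intro wav_bdd integrable_dirw f)
  thus "continuous_on UNIV (\<lambda>x. wav (dirw \<i>) d f x / d)"
    using d unfolding bdd_def by (auto intro!: continuous_intros)
qed

lemma dirw_pd:
  assumes f: "bdd f" "bdd f1" "bdd f2" and D: "\<And>x. pd f (f1 x) (f2 x) x"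
  shows "wav (dirw 1) d f x = d * av d f1 x" "wav (dirw \<i>) d f x = d * av d f2 x"
proof -
  obtain B B1 B2 where B: "\<And>x. \<bar>f x\<bar> \<le> B" and B1: "\<And>x. \<bar>f1 x\<bar> \<le> B1" and B2: "\<And>x. \<bar>f2 x\<bar> \<le> B2"
    using f unfolding bdd_def by blast
  have c: "continuous_on UNIV f" "continuous_on UNIV f1" "continuous_on UNIV f2"
    using f by (simp_all add: bdd_def)
  have M: "\<bar>f x\<bar> \<le> max B (max B1 B2)" "\<bar>f1 x\<bar> \<le> max B (max B1 B2)" "\<bar>f2 x\<bar> \<le> max B (max B1 B2)" for x
    using B[of x] B1[of x] B2[of x] by (simp_all add: le_max_iff_disj)
  show "wav (dirw 1) d f x = d * av d f1 x"
    by (rule dirw_by_parts[OF _ c(1,2) M(1,2)]) (use pd_imp_directional[OF D, of _ 1] in simp_all)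
  show "wav (dirw \<i>) d f x = d * av d f2 x"
    by (rule dirw_by_parts[OF _ c(1,3) M(1,3)]) (use pd_imp_directional[OF D, of _ \<i>] in simp_all)
qed

lemma wav_add:
  assumes "integrable hg w" "bdd f" "bdd g"
  shows "wav w d (\<lambda>y. f y + g y) x = wav w d f x + wav w d g x"
proof -
  have m: "bdd (\<lambda>y. - g y)" using assms(3) unfolding bdd_def by (auto intro!: continuous_intros)
  have "wav w d (\<lambda>y. - g y) x = - wav w d g x" using wav_cmult[of w d "-1" g x] by simp
  thus ?thesis using wav_diff[OF assms(1,2) m, of d x] by simp
qed

text \<open>Integration by parts in s along the ray from x in direction d (a + b i): the radial
  derivative is d (a f1 + b f2), and the boundary term is \<open>f x\<close> because the two normal
  variables carry total mass 1.\<close>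

lemma av_identity_C1:
  assumes f: "bdd f" "bdd f1" "bdd f2" and D: "\<And>x. pd f (f1 x) (f2 x) x"
  shows "av d f x = f x + d * wav (dirw 1) d f1 x + d * wav (dirw \<i>) d f2 x"
proof -
  obtain B0 where B0: "\<And>x. \<bar>f x\<bar> \<le> B0" using f(1) by (auto simp: bdd_def)
  obtain B1 where B1: "\<And>x. \<bar>f1 x\<bar> \<le> B1" using f(2) by (auto simp: bdd_def)
  obtain B2 where B2: "\<And>x. \<bar>f2 x\<bar> \<le> B2" using f(3) by (auto simp: bdd_def)
  note B' = B0 B1 B2
  have c: "continuous_on UNIV f" "continuous_on UNIV f1" "continuous_on UNIV f2"
    using f by (simp_all add: bdd_def)
  define B where "B = max B0 (max B1 B2)"
  have B: "\<bar>f x\<bar> \<le> B" "\<bar>f1 x\<bar> \<le> B" "\<bar>f2 x\<bar> \<le> B" for x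
    using B'[of x] unfolding B_def by (simp_all add: le_max_iff_disj)
  let ?k' = "\<lambda>z. d * (dirw 1 z * f1 (pos d x z)) + d * (dirw \<i> z * f2 (pos d x z))"
  have J1: "integrable hg (\<lambda>z. dirw 1 z * f1 (pos d x z))" "integrable hg (\<lambda>z. dirw \<i> z * f2 (pos d x z))"
    by (rule wav_integrable[OF integrable_dirw c(2) B(2)], rule wav_integrable[OF integrable_dirw c(3) B(3)])
  have I1: "integrable hg (\<lambda>z. fst z * f (pos d x z))" by (rule wav_integrable[OF integrable_hg_fst c(1) B(1)])
  have I2: "integrable hg ?k'" using J1 by auto
  have s: "(\<integral>s. s * f (pos d x (s, z)) \<partial>halfgauss) = f x + (\<integral>s. ?k' (s, z) \<partial>halfgauss)" for z
  proof -
    define e where "e = of_real (d * fst z) + of_real (d * snd z) * \<i>"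
    have p: "pos d x (s, z) = x + of_real s * e" for s by (simp add: pos_def e_def algebra_simps)
    have R: "Re e = d * fst z" "Im e = d * snd z" by (simp_all add: e_def)
    have "(\<integral>s. s * f (x + of_real s * e) \<partial>halfgauss) = f (x + of_real 0 * e) +
       (\<integral>s. Re e * f1 (x + of_real s * e) + Im e * f2 (x + of_real s * e) \<partial>halfgauss)"
    proof (rule halfgauss_by_parts[where B = "B + \<bar>Re e\<bar> * B + \<bar>Im e\<bar> * B"])
      have B0: "B \<ge> 0" using B(1)[of x] by linarith
      show "((\<lambda>s. f (x + of_real s * e)) has_real_derivative
         Re e * f1 (x + of_real s * e) + Im e * f2 (x + of_real s * e)) (at s)" for s
        by (rule pd_imp_directional[OF D])
      show "continuous_on UNIV (\<lambda>s. Re e * f1 (x + of_real s * e) + Im e * f2 (x + of_real s * e))"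
        by (intro continuous_intros continuous_on_compose2[OF c(2)] continuous_on_compose2[OF c(3)]) auto
      fix s :: real
      show "\<bar>f (x + of_real s * e)\<bar> \<le> B + \<bar>Re e\<bar> * B + \<bar>Im e\<bar> * B"
        using B(1)[of "x + of_real s * e"] B0 mult_nonneg_nonneg[of "\<bar>Re e\<bar>" B] mult_nonneg_nonneg[of "\<bar>Im e\<bar>" B]
        by linarith
      have "\<bar>Re e * f1 (x + of_real s * e)\<bar> \<le> \<bar>Re e\<bar> * B" "\<bar>Im e * f2 (x + of_real s * e)\<bar> \<le> \<bar>Im e\<bar> * B"
        unfolding abs_mult using B by (auto intro: mult_left_mono)
      thus "\<bar>Re e * f1 (x + of_real s * e) + Im e * f2 (x + of_real s * e)\<bar> \<le> B + \<bar>Re e\<bar> * B + \<bar>Im e\<bar> * B"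
        using B0 by linarith
    qed
    thus ?thesis unfolding p R by (simp add: dirw_def mult.assoc)
  qed
  have "av d f x = (\<integral>z. \<integral>s. s * f (pos d x (s, z)) \<partial>halfgauss \<partial>(gauss \<Otimes>\<^sub>M gauss))"
    unfolding wav_def hg_def hgg.integral_snd_pair[OF I1[unfolded hg_def], symmetric] by simp
  also have "\<dots> = (\<integral>z. f x + (\<integral>s. ?k' (s, z) \<partial>halfgauss) \<partial>(gauss \<Otimes>\<^sub>M gauss))"
    unfolding s ..
  also have "\<dots> = f x + (\<integral>z. \<integral>s. ?k' (s, z) \<partial>halfgauss \<partial>(gauss \<Otimes>\<^sub>M gauss))"
    using hgg.integrable_snd_pair[OF I2[unfolded hg_def]]
    by (subst Bochner_Integration.integral_add) (simp_all add: ggp.P.prob_space del: integral_add Bochner_Integration.integral_add)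
  also have "(\<integral>z. \<integral>s. ?k' (s, z) \<partial>halfgauss \<partial>(gauss \<Otimes>\<^sub>M gauss)) = (\<integral>z. ?k' z \<partial>hg)"
    using hgg.integral_snd_pair[OF I2[unfolded hg_def]] by (simp only: hg_def)
  also have "\<dots> = d * wav (dirw 1) d f1 x + d * wav (dirw \<i>) d f2 x"
    unfolding wav_def using J1 by simp
  finally show ?thesis by (simp add: add.assoc)
qed

text \<open>A second integration by parts, now in the normal variables, turns
  \<open>d * wav (dirw 1) d f1 x\<close> into d^2 times the average of \<open>f11\<close>, and
  likewise in the other direction.\<close>

lemma av_identity:
  assumes f: "bdd f" "bdd f1" "bdd f2" "bdd f11" "bdd f12" "bdd f21" "bdd f22"
    and D: "\<And>x. pd f (f1 x) (f2 x) x" "\<And>x. pd f1 (f11 x) (f12 x) x" "\<And>x. pd f2 (f21 x) (f22 x) x"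
  shows "av d f x = f x + d\<^sup>2 * av d (\<lambda>x. f11 x + f22 x) x"
proof -
  have "av d f x = f x + d\<^sup>2 * (av d f11 x + av d f22 x)"
    unfolding av_identity_C1[OF f(1,2,3) D(1)] dirw_pd(1)[OF f(2,4,5) D(2)] dirw_pd(2)[OF f(3,6,7) D(3)]
    by (simp add: power2_eq_square algebra_simps)
  thus ?thesis using wav_add[OF integrable_hg_fst f(4,7)] by simp
qed

text \<open>Gives the normalization: applied to a constant, the identity says that
  \<open>fst\<close> has integral 1 under \<open>hg\<close>, without evaluating a Gaussian
  integral.\<close>

lemma av_const: "av d (\<lambda>_. c) x = c"
proof -
  have b: "bdd (\<lambda>_. k)" for k unfolding bdd_def by auto
  show ?thesis using av_identity[OF b b b b b b b pd_const pd_const pd_const, of d c x]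
    by (simp add: wav_def)
qed

section \<open>Positivity, Lipschitz bounds and periodic functions\<close>

definition hgw :: "real \<times> real \<times> real \<Rightarrow> ennreal" where
  "hgw z = ennreal (indicator {0<..} (fst z) * exp (- (fst z)\<^sup>2 / 2)) *
     (ennreal (std_normal_density (fst (snd z))) * ennreal (std_normal_density (snd (snd z))))"

lemma hgw_measurable[measurable]: "hgw \<in> borel_measurable borel"
proof -
  have [measurable]: "(fst :: real \<times> real \<times> real \<Rightarrow> real) \<in> borel \<rightarrow>\<^sub>M borel"
    "(\<lambda>z::real \<times> real \<times> real. fst (snd z)) \<in> borel \<rightarrow>\<^sub>M borel"
    "(\<lambda>z::real \<times> real \<times> real. snd (snd z)) \<in> borel \<rightarrow>\<^sub>M borel"
    by (intro borel_measurable_continuous_onI continuous_intros)+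
  show ?thesis unfolding hgw_def[abs_def] by measurable
qed

lemma hg_density: "hg = density lborel hgw"
proof -
  have sf: "sigma_finite_measure (density lborel (\<lambda>s. ennreal (std_normal_density s)))"
    using gauss.sigma_finite_measure_axioms unfolding gauss_def .
  have gg: "gauss \<Otimes>\<^sub>M gauss = density lborel (\<lambda>(x, y). ennreal (std_normal_density x) * ennreal (std_normal_density y))"
    unfolding gauss_def
    by (subst pair_measure_density) (simp_all add: lborel_prod sf sigma_finite_lborel)
  have sf2: "sigma_finite_measure (density lborel (\<lambda>(x, y). ennreal (std_normal_density x) * ennreal (std_normal_density y)))"
    unfolding gg[symmetric] by unfold_locales
  have "(\<lambda>(x::real, y::real). ennreal (std_normal_density x) * ennreal (std_normal_density y))
      \<in> borel_measurable (borel \<Otimes>\<^sub>M borel)" by measurable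
  hence m: "(\<lambda>(x::real, y::real). ennreal (std_normal_density x) * ennreal (std_normal_density y))
      \<in> borel_measurable borel" unfolding borel_prod .
  show ?thesis
    unfolding hg_def gg unfolding halfgauss_def hgw_def[abs_def]
    by (subst pair_measure_density[OF _ _ sigma_finite_lborel sf2])
       (simp_all add: m[unfolded case_prod_beta'] lborel_prod case_prod_beta')
qed

text \<open>The density \<open>hgw\<close> is positive exactly where s > 0, so on that half-space
  \<open>hg\<close> and Lebesgue measure have the same null sets.\<close>

lemma AE_hg_iff:
  "(AE z in hg. Q z) \<longleftrightarrow> (AE z in lborel. 0 < fst z \<longrightarrow> Q z)"
proof -
  have "(0 < hgw z) \<longleftrightarrow> 0 < fst z" for z
    by (auto simp: indicator_def ennreal_zero_less_mult_iff hgw_def intro: normal_density_pos)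
  thus ?thesis unfolding hg_density by (subst AE_density) simp_all
qed

lemma AE_hg_pos: "AE z in hg. 0 < fst z"
  unfolding AE_hg_iff by simp

lemma av_mono:
  assumes "bdd f" "bdd g" "\<And>x. f x \<le> g x"
  shows "av d f x \<le> av d g x"
proof -
  obtain B C where "\<And>x. \<bar>f x\<bar> \<le> B" "\<And>x. \<bar>g x\<bar> \<le> C" "continuous_on UNIV f" "continuous_on UNIV g"
    using assms unfolding bdd_def by blast
  thus ?thesis unfolding wav_def
    using wav_integrable[OF integrable_hg_fst, of f B d x] wav_integrable[OF integrable_hg_fst, of g C d x] AE_hg_pos
    by (intro integral_mono_AE) (auto intro!: mult_left_mono assms(3))
qed

text \<open>Strong maximum principle: a vanishing average forces \<open>f (pos d x z) = 0\<close>
  almost everywhere on s > 0, hence everywhere there by openness, and already with s = 1 the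
  position reaches every point of the plane.\<close>

lemma av_strict:
  assumes f: "bdd f" "\<And>x. 0 \<le> f x" and d: "d > 0" and z: "av d f x = 0"
  shows "f y = 0"
proof (rule ccontr)
  assume "f y \<noteq> 0"
  hence fy: "f y > 0" using f(2)[of y] by simp
  obtain B where B: "\<And>x. \<bar>f x\<bar> \<le> B" and c: "continuous_on UNIV f"
    using f(1) unfolding bdd_def by blast
  have "AE z in hg. fst z * f (pos d x z) = 0"
  proof (rule integral_nonneg_eq_0_iff_AE[THEN iffD1])
    show "integrable hg (\<lambda>z. fst z * f (pos d x z))" by (rule wav_integrable[OF integrable_hg_fst c B])
    show "AE z in hg. 0 \<le> fst z * f (pos d x z)"
      using AE_hg_pos by eventually_elim (simp add: f(2))
    show "(\<integral>z. fst z * f (pos d x z) \<partial>hg) = 0" using z unfolding wav_def .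
  qed
  hence ae: "AE z in lborel. 0 < fst z \<longrightarrow> f (pos d x z) = 0"
    unfolding AE_hg_iff by eventually_elim simp
  define U where "U = {z. 0 < fst z \<and> 0 < f (pos d x z)}"
  have cp: "continuous_on UNIV (pos d x)" unfolding pos_def[abs_def] by (intro continuous_intros)
  have "open U" unfolding U_def
    by (intro open_Collect_conj open_Collect_less continuous_on_const continuous_on_fst
        continuous_on_id continuous_on_compose2[OF c cp]) simp
  moreover have "AE z in lborel. z \<notin> U" using ae by eventually_elim (simp add: U_def)
  ultimately have "U \<in> null_sets lborel" by (simp add: AE_iff_null_sets)
  hence "negligible U" unfolding negligible_iff_null_sets by (rule null_sets_completionI)
  hence "U = {}" using open_not_negligible[OF \<open>open U\<close>] by (cases "U = {}") simp_all
  moreover have "pos d x (1, Re (y - x) / d, Im (y - x) / d) = y"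
    using d by (simp add: pos_def complex_eq_iff)
  hence "(1, Re (y - x) / d, Im (y - x) / d) \<in> U" using fy by (simp add: U_def)
  ultimately show False by simp
qed

text \<open>For s > 0 and fixed \<open>a\<close> the position is injective in \<open>b\<close>, so
  it meets a countable set for countably many \<open>b\<close> only, and Fubini concludes. Averages
  therefore do not see the zeros of a weight.\<close>

lemma AE_pos_notin_countable:
  assumes d: "d > 0" and C: "countable C"
  shows "AE z in hg. pos d x z \<notin> C"
proof -
  have cl[measurable]: "C \<in> sets borel" by (rule sets.countable[OF _ C]) simp
  have line: "AE b in gauss. pos d x (s, a, b) \<notin> C" if "s > 0" for s a
  proof -
    let ?g = "\<lambda>b. pos d x (s, a, b)"
    have inj: "inj_on ?g {b. ?g b \<in> C}" using d that by (auto simp: inj_on_def pos_def)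
    have "countable (?g ` {b. ?g b \<in> C})" by (rule countable_subset[OF _ C]) auto
    hence "countable {b. ?g b \<in> C}" using countable_image_inj_on[OF _ inj] by blast
    hence "{b. ?g b \<in> C} \<in> null_sets lborel" by (rule countable_imp_null_set_lborel)
    hence "AE b in lborel. b \<notin> {b. ?g b \<in> C}" by (rule AE_not_in)
    thus ?thesis unfolding gauss_def by (subst AE_density) auto
  qed
  have plane: "AE z in gauss \<Otimes>\<^sub>M gauss. pos d x (s, z) \<notin> C" if "s > 0" for s
  proof (rule gg.AE_pair_measure)
    have [measurable]: "(\<lambda>z. pos d x (s, z)) \<in> borel_measurable (gauss \<Otimes>\<^sub>M gauss)"
      unfolding pos_def fst_conv snd_conv by measurable
    show "{z \<in> space (gauss \<Otimes>\<^sub>M gauss). pos d x (s, z) \<notin> C} \<in> sets (gauss \<Otimes>\<^sub>M gauss)" by measurable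
    show "AE a in gauss. AE b in gauss. pos d x (s, a, b) \<notin> C" using line[OF that] by simp
  qed
  show ?thesis unfolding hg_def
  proof (rule hgg.AE_pair_measure)
    note [measurable] = pos_measurable[of d x, unfolded hg_def]
    show "{z \<in> space (halfgauss \<Otimes>\<^sub>M (gauss \<Otimes>\<^sub>M gauss)). pos d x z \<notin> C} \<in> sets (halfgauss \<Otimes>\<^sub>M (gauss \<Otimes>\<^sub>M gauss))"
      by measurable
    have "AE s in halfgauss. 0 < s" unfolding halfgauss_def
      by (subst AE_density) (auto simp: indicator_def)
    thus "AE s in halfgauss. AE z in gauss \<Otimes>\<^sub>M gauss. pos d x (s, z) \<notin> C"
      by (rule eventually_mono) (rule plane)
  qed
qed

lemma wav_const: "wav (dirw e) d (\<lambda>_. c) x = 0" if "e = 1 \<or> e = \<i>" for e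
proof -
  have b: "bdd (\<lambda>_. k)" for k unfolding bdd_def by auto
  show ?thesis using dirw_pd[OF b b b pd_const, of d c x] that by (auto simp: av_const)
qed

text \<open>Constant in the gradient bound for averages; the summand 1 makes it visibly
  positive.\<close>

definition hC :: real where
  "hC = (\<integral>z. \<bar>dirw 1 z\<bar> \<partial>hg) + (\<integral>z. \<bar>dirw \<i> z\<bar> \<partial>hg) + 1"

lemma hC_pos: "hC > 0"
  unfolding hC_def by (intro add_nonneg_pos add_nonneg_nonneg) auto

text \<open>The direction weights have integral 0, so the gradient of an average sees only
  \<open>f - k\<close>. With \<open>k\<close> free the bound is by the oscillation of
  \<open>f\<close> over \<open>d\<close>, on which the contraction of oscillations rests.\<close>

lemma av_lipschitz:
  assumes f: "bdd f" and M: "\<And>x. \<bar>f x - k\<bar> \<le> M" and d: "d > 0"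
  shows "\<bar>av d f x - av d f y\<bar> \<le> hC * M / d * cmod (x - y)"
proof -
  have b: "bdd (\<lambda>_. k)" unfolding bdd_def by auto
  have c: "continuous_on UNIV (\<lambda>x. f x - k)" using f unfolding bdd_def by (auto intro: continuous_intros)
  have M0: "M \<ge> 0" using M[of 0] by linarith
  have v: "\<bar>wav (dirw e) d f x\<bar> \<le> M * (\<integral>z. \<bar>dirw e z\<bar> \<partial>hg)" if "e = 1 \<or> e = \<i>" for e x
  proof -
    have "wav (dirw e) d f x = wav (dirw e) d (\<lambda>x. f x - k) x"
      using wav_diff[OF integrable_dirw f b] wav_const[OF that] by simp
    thus ?thesis using wav_bound[OF integrable_dirw c M] by simp
  qed
  have "norm (av d f x - av d f y) \<le> (hC * M / d) * norm (x - y)"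
  proof (rule differentiable_bound[where S = UNIV])
    show "(av d f has_derivative (\<lambda>h. Re h * (wav (dirw 1) d f z / d) + Im h * (wav (dirw \<i>) d f z / d)))
        (at z within UNIV)" for z by (rule av_pd[OF f d])
    fix z
    show "onorm (\<lambda>h. Re h * (wav (dirw 1) d f z / d) + Im h * (wav (dirw \<i>) d f z / d)) \<le> hC * M / d"
    proof (rule onorm_bound)
      show "0 \<le> hC * M / d" using hC_pos M0 d by simp
      fix h
      have 1: "\<bar>Re h * (wav (dirw 1) d f z / d)\<bar> \<le> cmod h * (M * (\<integral>z. \<bar>dirw 1 z\<bar> \<partial>hg) / d)"
        unfolding abs_mult using v[of 1 z] d by (intro mult_mono abs_Re_le_cmod) (auto simp: divide_right_mono)
      have 2: "\<bar>Im h * (wav (dirw \<i>) d f z / d)\<bar> \<le> cmod h * (M * (\<integral>z. \<bar>dirw \<i> z\<bar> \<partial>hg) / d)"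
        unfolding abs_mult using v[of \<i> z] d by (intro mult_mono abs_Im_le_cmod) (auto simp: divide_right_mono)
      have "norm (Re h * (wav (dirw 1) d f z / d) + Im h * (wav (dirw \<i>) d f z / d)) \<le>
        cmod h * (M * (\<integral>z. \<bar>dirw 1 z\<bar> \<partial>hg) / d) + cmod h * (M * (\<integral>z. \<bar>dirw \<i> z\<bar> \<partial>hg) / d)"
        unfolding real_norm_def using 1 2 by linarith
      also have "\<dots> = cmod h * M / d * (hC - 1)" using d by (simp add: hC_def field_simps)
      also have "\<dots> \<le> cmod h * M / d * hC" using M0 d by (intro mult_left_mono) auto
      finally show "norm (Re h * (wav (dirw 1) d f z / d) + Im h * (wav (dirw \<i>) d f z / d)) \<le> hC * M / d * norm h"
        by (simp add: mult_ac)
    qed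
  qed auto
  thus ?thesis by simp
qed

section \<open>Lattice coordinates, compactness and averages of periodic functions\<close>

locale torus =
  fixes w1 w2 :: complex
  assumes indep: "Im (cnj w1 * w2) \<noteq> 0"
begin

abbreviation "per \<equiv> doubly_periodic w1 w2"
abbreviation "Lam \<equiv> period_lattice w1 w2"
abbreviation "FD \<equiv> fund_dom w1 w2"

lemma per_int:
  assumes "\<And>x. f (x + w) = f x"
  shows "f (x + of_int n * w) = f x"
proof -
  have nat: "f (x + of_nat n * w) = f x" for n x
  proof (induction n)
    case (Suc n)
    have "f (x + of_nat (Suc n) * w) = f ((x + of_nat n * w) + w)" by (simp add: algebra_simps)
    thus ?case using assms Suc by simp
  qed simp
  show ?thesis
  proof (cases n)
    case (nonneg k) thus ?thesis using nat by simp
  next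
    case (neg k)
    have n: "of_int n * w = - (of_nat (Suc k) * w)"
      unfolding neg by (simp only: of_int_minus of_int_of_nat_eq minus_mult_left)
    show ?thesis using nat[of "x + - (of_nat (Suc k) * w)" "Suc k"] unfolding n by (simp only: add.assoc left_minus add_0_right)
  qed
qed

lemma per_Lam: assumes "per f" "l \<in> Lam" shows "f (x + l) = f x"
proof -
  obtain a b where l: "l = of_int a * w1 + of_int b * w2" using assms(2) unfolding period_lattice_def by blast
  have "f (x + l) = f ((x + of_int a * w1) + of_int b * w2)" unfolding l by (simp add: add.assoc)
  thus ?thesis using assms(1) per_int[of f w1] per_int[of f w2] unfolding doubly_periodic_def by simp
qed

text \<open>Coordinates in the basis \<open>w1\<close>, \<open>w2\<close> by Cramer's rule;
  \<open>Im (cnj a * b)\<close> is the determinant of the vectors a and b.\<close>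

definition cs :: "complex \<Rightarrow> real" where "cs x = Im (cnj w2 * x) / Im (cnj w2 * w1)"
definition ct :: "complex \<Rightarrow> real" where "ct x = Im (cnj w1 * x) / Im (cnj w1 * w2)"

lemma indep': "Im (cnj w2 * w1) \<noteq> 0" "Im (cnj w2 * w1) = - Im (cnj w1 * w2)"
  using indep by (simp_all add: algebra_simps)

lemma coords: "x = of_real (cs x) * w1 + of_real (ct x) * w2"
proof -
  let ?D = "Im (cnj w1 * w2)"
  have "of_real ?D * x = of_real (- Im (cnj w2 * x)) * w1 + of_real (Im (cnj w1 * x)) * w2"
    by (simp add: complex_eq_iff algebra_simps)
  moreover have "cs x = - Im (cnj w2 * x) / ?D" "ct x = Im (cnj w1 * x) / ?D"
    unfolding cs_def ct_def indep'(2) by (simp_all only: minus_divide_right[symmetric] minus_divide_left[symmetric])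
  ultimately have "of_real ?D * x = of_real ?D * (of_real (cs x) * w1 + of_real (ct x) * w2)"
    using indep by (simp add: distrib_left mult.assoc[symmetric] of_real_mult[symmetric] del: of_real_mult complex_cnj_mult)
  thus ?thesis using indep by (metis mult_left_cancel of_real_eq_0_iff)
qed

lemma cs_lin: "cs (of_real s * w1 + of_real t * w2) = s" and ct_lin: "ct (of_real s * w1 + of_real t * w2) = t"
proof -
  have "Im (cnj w2 * (of_real s * w1 + of_real t * w2)) = s * Im (cnj w2 * w1)"
    "Im (cnj w1 * (of_real s * w1 + of_real t * w2)) = t * Im (cnj w1 * w2)"
    by (simp_all add: algebra_simps)
  thus "cs (of_real s * w1 + of_real t * w2) = s" "ct (of_real s * w1 + of_real t * w2) = t"
    unfolding cs_def ct_def using indep indep'(1) by (simp_all del: Im_complex_of_real)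
qed

lemma FD_iff: "x \<in> FD \<longleftrightarrow> 0 \<le> cs x \<and> cs x < 1 \<and> 0 \<le> ct x \<and> ct x < 1"
proof
  assume "x \<in> FD"
  then obtain s t where "x = of_real s * w1 + of_real t * w2" "0 \<le> s" "s < 1" "0 \<le> t" "t < 1"
    unfolding fund_dom_def by blast
  thus "0 \<le> cs x \<and> cs x < 1 \<and> 0 \<le> ct x \<and> ct x < 1" by (simp add: cs_lin ct_lin)
next
  assume "0 \<le> cs x \<and> cs x < 1 \<and> 0 \<le> ct x \<and> ct x < 1"
  thus "x \<in> FD" unfolding fund_dom_def using coords by blast
qed

lemma Lam_iff: "x \<in> Lam \<longleftrightarrow> cs x \<in> \<int> \<and> ct x \<in> \<int>"
proof
  assume "x \<in> Lam"
  then obtain a b where "x = of_int a * w1 + of_int b * w2" unfolding period_lattice_def by blast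
  thus "cs x \<in> \<int> \<and> ct x \<in> \<int>" using cs_lin[of "of_int a" "of_int b"] ct_lin[of "of_int a" "of_int b"] by simp
next
  assume "cs x \<in> \<int> \<and> ct x \<in> \<int>"
  then obtain a b where "cs x = of_int a" "ct x = of_int b" by (auto elim!: Ints_cases)
  thus "x \<in> Lam" unfolding period_lattice_def using coords[of x] by auto
qed

lemma cs_diff: "cs (x - y) = cs x - cs y" and ct_diff: "ct (x - y) = ct x - ct y"
  unfolding cs_def ct_def by (simp_all add: ring_distribs diff_divide_distrib)

lemma reduce: obtains y l where "x = y + l" "y \<in> FD" "l \<in> Lam"
proof
  define l where "l = of_int \<lfloor>cs x\<rfloor> * w1 + of_int \<lfloor>ct x\<rfloor> * w2"
  have c: "cs l = of_int \<lfloor>cs x\<rfloor>" "ct l = of_int \<lfloor>ct x\<rfloor>"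
    using cs_lin[of "of_int \<lfloor>cs x\<rfloor>" "of_int \<lfloor>ct x\<rfloor>"] ct_lin[of "of_int \<lfloor>cs x\<rfloor>" "of_int \<lfloor>ct x\<rfloor>"]
    by (simp_all add: l_def)
  show "x = (x - l) + l" by simp
  show "x - l \<in> FD" unfolding FD_iff cs_diff ct_diff c by linarith
  show "l \<in> Lam" unfolding Lam_iff c by simp
qed

lemma FD_unique: "x \<in> FD \<Longrightarrow> y \<in> FD \<Longrightarrow> x - y \<in> Lam \<Longrightarrow> x = y"
proof -
  assume a: "x \<in> FD" "y \<in> FD" "x - y \<in> Lam"
  have "cs x - cs y \<in> \<int>" "ct x - ct y \<in> \<int>" using a(3) by (auto simp: Lam_iff cs_diff ct_diff)
  moreover have "\<bar>cs x - cs y\<bar> < 1" "\<bar>ct x - ct y\<bar> < 1" using a(1,2) unfolding FD_iff by linarith+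
  ultimately have "cs x = cs y" "ct x = ct y" using Ints_nonzero_abs_less1 by fastforce+
  thus "x = y" using coords by metis
qed

lemma countable_Lam: "countable Lam"
proof -
  have "Lam = (\<lambda>(a, b). of_int a * w1 + of_int b * w2) ` UNIV" unfolding period_lattice_def by auto
  thus ?thesis by simp
qed

text \<open>The closed parallelogram, a compact substitute for the half-open \<open>FD\<close>:
  extrema, Dini and Arzela-Ascoli work on it and are carried to the plane by periodicity.\<close>

definition cell :: "complex set" where
  "cell = (\<lambda>z. of_real (fst z) * w1 + of_real (snd z) * w2) ` ({0..1} \<times> {0..1})"

lemma compact_cell: "compact cell"
  unfolding cell_def by (intro compact_continuous_image continuous_intros compact_Times compact_Icc)

lemma FD_cell: "FD \<subseteq> cell"
  unfolding cell_def fund_dom_def by (force simp: image_iff)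

lemma per_reduce: assumes "per f" obtains y where "y \<in> cell" "f y = f x"
proof -
  obtain y l where "x = y + l" "y \<in> FD" "l \<in> Lam" by (rule reduce)
  thus thesis using that[of y] per_Lam[OF assms, of l y] FD_cell by auto
qed

lemma per_bdd: assumes "per f" "continuous_on UNIV f" shows "bdd f"
proof -
  have "bounded (f ` cell)"
    by (intro compact_imp_bounded compact_continuous_image compact_cell continuous_on_subset[OF assms(2)]) auto
  then obtain B where B: "\<And>y. y \<in> cell \<Longrightarrow> \<bar>f y\<bar> \<le> B" unfolding bounded_iff by auto
  have "\<bar>f x\<bar> \<le> B" for x
  proof -
    obtain y where "y \<in> cell" "f y = f x" by (rule per_reduce[OF assms(1)])
    thus ?thesis using B[of y] by simp
  qed
  thus ?thesis unfolding bdd_def using assms(2) by blast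
qed

lemma per_attains_max: assumes "per f" "continuous_on UNIV f" obtains z where "\<And>x. f x \<le> f z"
proof -
  have "cell \<noteq> {}" unfolding cell_def by auto
  then obtain z where z: "z \<in> cell" "\<And>y. y \<in> cell \<Longrightarrow> f y \<le> f z"
    using continuous_attains_sup[OF compact_cell, of f] continuous_on_subset[OF assms(2), of cell] by auto
  show thesis
  proof (rule that)
    fix x
    obtain y where "y \<in> cell" "f y = f x" by (rule per_reduce[OF assms(1)])
    thus "f x \<le> f z" using z(2)[of y] by simp
  qed
qed

lemma per_attains_min: assumes "per f" "continuous_on UNIV f" obtains z where "\<And>x. f z \<le> f x"
proof -
  have "per (\<lambda>x. - f x)" using assms(1) unfolding doubly_periodic_def by simp
  moreover have "continuous_on UNIV (\<lambda>x. - f x)" using assms(2) by (intro continuous_intros)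
  ultimately show thesis
  proof (rule per_attains_max[of "\<lambda>x. - f x"])
    fix z assume "\<And>x. - f x \<le> - f z"
    thus thesis using that[of z] by simp
  qed
qed

lemma per_wav: "per f \<Longrightarrow> per (wav w d f)"
  unfolding doubly_periodic_def wav_def by (simp add: pos_add)

lemma per_dx: "per f \<Longrightarrow> per (dx f)" and per_dy: "per f \<Longrightarrow> per (dy f)"
  and per_laplacian: "per f \<Longrightarrow> per (laplacian f)"
proof -
  assume p: "per f"
  hence e: "(\<lambda>y. f (y + w1)) = f" "(\<lambda>y. f (y + w2)) = f" by (auto simp: doubly_periodic_def)
  show "per (dx f)" "per (dy f)" "per (laplacian f)"
    unfolding doubly_periodic_def dx_shift[symmetric] dy_shift[symmetric] laplacian_shift[symmetric] e by simp_all
qed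

lemma C1_per:
  assumes "per f" "Ck_on (Suc k) UNIV f"
  shows "pd f (dx f x) (dy f x) x" "bdd f" "bdd (dx f)" "bdd (dy f)" "Ck_on k UNIV (dx f)" "Ck_on k UNIV (dy f)"
proof -
  note * = assms(2)[unfolded Ck_on_Suc_iff[OF open_UNIV]]
  show "pd f (dx f x) (dy f x) x" using * pd_frechet by blast
  show k: "Ck_on k UNIV (dx f)" "Ck_on k UNIV (dy f)" using * by auto
  show "bdd f" by (rule per_bdd[OF assms(1) Ck_on_imp_continuous[OF assms(2)]])
  show "bdd (dx f)" by (rule per_bdd[OF per_dx[OF assms(1)] Ck_on_imp_continuous[OF k(1)]])
  show "bdd (dy f)" by (rule per_bdd[OF per_dy[OF assms(1)] Ck_on_imp_continuous[OF k(2)]])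
qed

lemma av_pd_per:
  assumes "per f" "Ck_on (Suc k) UNIV f" "d > 0"
  shows "pd (av d f) (av d (dx f) x) (av d (dy f) x) x"
  using av_pd[OF C1_per(2)[OF assms(1,2)] assms(3), of x]
    dirw_pd[OF C1_per(2,3,4)[OF assms(1,2)] C1_per(1)[OF assms(1,2)], of d x] assms(3) by simp

text \<open>At level 0 the gain comes from the direction weights; above it derivatives pass under
  the average, and the induction hypothesis applies to \<open>dx f\<close> and
  \<open>dy f\<close>.\<close>

lemma av_Ck:
  assumes "per f" "Ck_on k UNIV f" "d > 0"
  shows "Ck_on (Suc k) UNIV (av d f)"
  using assms(1,2)
proof (induction k arbitrary: f)
  case 0
  have b: "bdd f" using per_bdd 0 by simp
  show ?case
  proof (rule Ck_on_SucI[OF av_pd[OF b assms(3)]])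
    have "bdd (wav (dirw e) d f)" for e by (intro wav_bdd integrable_dirw b)
    hence "continuous_on UNIV (wav (dirw e) d f)" for e by (simp add: bdd_def)
    thus "Ck_on 0 UNIV (\<lambda>x. wav (dirw 1) d f x / d)" "Ck_on 0 UNIV (\<lambda>x. wav (dirw \<i>) d f x / d)"
      using assms(3) by (auto intro!: continuous_intros)
  qed
next
  case (Suc k)
  show ?case
    by (rule Ck_on_SucI[OF av_pd_per[OF Suc.prems assms(3)]])
       (intro Suc.IH per_dx per_dy Suc.prems(1) C1_per(5,6)[OF Suc.prems])+
qed

lemma C2_per:
  assumes "per f" "Ck_on 2 UNIV f"
  shows "bdd (dx (dx f))" "bdd (dy (dx f))" "bdd (dx (dy f))" "bdd (dy (dy f))" "bdd (laplacian f)"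
proof -
  note C = C2_D[OF assms(2) open_UNIV]
  show "bdd (dx (dx f))" "bdd (dy (dx f))" "bdd (dx (dy f))" "bdd (dy (dy f))"
    by (intro per_bdd per_dx per_dy assms(1) C(6,7,8,9))+
  show "bdd (laplacian f)"
    by (intro per_bdd per_laplacian assms(1) continuous_on_laplacian[OF assms(2) open_UNIV])
qed

lemma C2_C1: "Ck_on 2 S f \<Longrightarrow> Ck_on (Suc 0) S f"
  by (rule Ck_on_le[of 2]) simp_all

lemma av_id:
  assumes "per f" "Ck_on 2 UNIV f"
  shows "av d f x = f x + d\<^sup>2 * av d (laplacian f) x"
proof -
  note C = C2_D[OF assms(2) open_UNIV]
  note C1 = C1_per[OF assms(1) C2_C1[OF assms(2)]]
  have "laplacian f = (\<lambda>x. dx (dx f) x + dy (dy f) x)" by (simp add: fun_eq_iff laplacian_def)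
  thus ?thesis
    using av_identity[OF C1(2,3,4) C2_per(1-4)[OF assms] C(1,2,3)] by simp
qed

text \<open>While \<open>av_id\<close> makes the average a left inverse of 1 - d^2 Laplace, this
  makes it a right inverse. Of the two derivatives one falls on \<open>f\<close>, the other on the
  direction weight.\<close>

lemma laplacian_av:
  assumes "per f" "Ck_on (Suc 0) UNIV f" "d > 0"
  shows "laplacian (av d f) x = (av d f x - f x) / d\<^sup>2"
proof -
  note C = C1_per[OF assms(1,2)]
  have 1: "pd (av d f) (av d (dx f) x) (av d (dy f) x) x" for x by (rule av_pd_per[OF assms])
  have "laplacian (av d f) x = wav (dirw 1) d (dx f) x / d + wav (dirw \<i>) d (dy f) x / d"
    by (rule laplacian_eqI[OF open_UNIV UNIV_I 1 av_pd[OF C(3) assms(3)] av_pd[OF C(4) assms(3)]])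
  thus ?thesis using av_identity_C1[OF C(2,3,4,1), of d x] assms(3)
    by (simp add: power2_eq_square field_simps)
qed

text \<open>Dini's theorem: the sublevel sets form an increasing open cover of the compact
  \<open>cell\<close>.\<close>

lemma dini:
  assumes F: "\<And>n. per (F n)" "\<And>n. continuous_on UNIV (F n)" "\<And>n x. F (Suc n) x \<le> F n x"
    and lim: "\<And>x. (\<lambda>n. F n x) \<longlonglongrightarrow> 0" and e: "e > 0"
  shows "\<exists>n. \<forall>x. F n x < (e::real)"
proof -
  have dec: "F n x \<le> F k x" if "k \<le> n" for n k x
    using lift_Suc_antimono_le[of "\<lambda>n. F n x" k n] F(3) that by simp
  have op: "open {x. F n x < e}" for n by (intro open_Collect_less F(2) continuous_intros)
  have "cell \<subseteq> (\<Union>n\<in>UNIV. {x. F n x < e})"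
  proof
    fix x
    from order_tendstoD(2)[OF lim[of x] e] obtain n where "F n x < e" by (auto simp: eventually_sequentially)
    thus "x \<in> (\<Union>n\<in>UNIV. {x. F n x < e})" by auto
  qed
  then obtain C where C: "finite C" "cell \<subseteq> (\<Union>n\<in>C. {x. F n x < e})"
    by (auto elim: compactE_image[OF compact_cell op])
  have *: "F (Max (insert 0 C)) x < e" if x: "x \<in> cell" for x
  proof -
    obtain n where n: "n \<in> C" "F n x < e" using x C(2) by blast
    have "n \<le> Max (insert 0 C)" using n(1) C(1) by (intro Max_ge) auto
    from dec[OF this, of x] n(2) show ?thesis by simp
  qed
  have "F (Max (insert 0 C)) x < e" for x
  proof -
    obtain y where "y \<in> cell" "F (Max (insert 0 C)) y = F (Max (insert 0 C)) x" by (rule per_reduce[OF F(1)])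
    thus ?thesis using *[of y] by simp
  qed
  thus ?thesis by blast
qed

end

section \<open>The theta function and the singular weight\<close>

text \<open>The Jacobi theta function \<open>(1 - w) \<Prod>\<^sub>n\<^sub>\<ge>\<^sub>1 (1 - q\<^sup>n w) (1 - q\<^sup>n / w)\<close> as a function of
  \<open>\<zeta>\<close>, where \<open>w = exp (2 \<pi> \<i> \<zeta>)\<close>.\<close>

definition ee :: "complex \<Rightarrow> complex" where "ee z = exp (2 * of_real pi * \<i> * z)"

definition theta_fac :: "complex \<Rightarrow> nat \<Rightarrow> complex \<Rightarrow> complex" where
  "theta_fac q n z = (1 - q ^ Suc n * ee z) * (1 - q ^ Suc n * ee (- z))"

definition theta_red :: "complex \<Rightarrow> complex \<Rightarrow> complex" where
  "theta_red q z = lim (\<lambda>N. \<Prod>n<N. theta_fac q n z)"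

definition theta :: "complex \<Rightarrow> complex \<Rightarrow> complex" where
  "theta q z = (1 - ee z) * theta_red q z"

lemma ee_add: "ee (a + b) = ee a * ee b"
  by (simp add: ee_def ring_distribs exp_add)

lemma ee_minus: "ee (- a) = inverse (ee a)"
  by (simp add: ee_def exp_minus)

lemma ee_nz[simp]: "ee a \<noteq> 0" by (simp add: ee_def)

lemma ee_eq_1: "ee z = 1 \<longleftrightarrow> (\<exists>n::int. z = of_int n)"
proof
  assume "ee z = 1"
  then obtain n :: int where "- (2 * pi * Im z) = 0" "2 * pi * Re z = of_int (2 * n) * pi"
    unfolding ee_def exp_eq_1 by auto
  hence "Im z = 0" "Re z = of_int n" by simp_all
  hence "z = of_int n" by (simp add: complex_eq_iff)
  thus "\<exists>n::int. z = of_int n" ..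
next
  assume "\<exists>n::int. z = of_int n"
  then obtain n :: int where "z = of_int n" ..
  thus "ee z = 1" unfolding ee_def exp_eq_1 by (auto intro!: exI[of _ n])
qed

lemma norm_ee: "cmod (ee z) = exp (- 2 * pi * Im z)"
  by (simp add: ee_def norm_exp_eq_Re)

lemma holomorphic_ee[holomorphic_intros]: "f holomorphic_on S \<Longrightarrow> (\<lambda>z. ee (f z)) holomorphic_on S"
  unfolding ee_def by (intro holomorphic_intros)

context
  fixes q :: complex assumes q: "cmod q < 1"
begin

lemma theta_fac_hol: "theta_fac q n holomorphic_on S"
  unfolding theta_fac_def[abs_def] by (intro holomorphic_intros)

lemma theta_fac_bound:
  "cmod (theta_fac q n z - 1) \<le> (cmod (ee z) + cmod (ee (- z)) + 1) * cmod q ^ n"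
proof -
  have p: "cmod q ^ Suc n \<le> cmod q ^ n" using q by (intro power_decreasing) auto
  have p2: "cmod q ^ Suc n * cmod q ^ Suc n \<le> cmod q ^ n * 1"
    using q p by (intro mult_mono power_le_one) auto
  have "theta_fac q n z - 1 = q ^ Suc n * q ^ Suc n - q ^ Suc n * ee z - q ^ Suc n * ee (- z)"
    by (simp add: theta_fac_def ee_minus algebra_simps)
  also have "cmod \<dots> \<le> cmod (q ^ Suc n * q ^ Suc n) + cmod (q ^ Suc n * ee z) + cmod (q ^ Suc n * ee (- z))"
    using norm_triangle_ineq4[of "q ^ Suc n * q ^ Suc n - q ^ Suc n * ee z" "q ^ Suc n * ee (- z)"]
      norm_triangle_ineq4[of "q ^ Suc n * q ^ Suc n" "q ^ Suc n * ee z"] by linarith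
  also have "\<dots> \<le> cmod q ^ n * 1 + cmod q ^ n * cmod (ee z) + cmod q ^ n * cmod (ee (- z))"
    unfolding norm_mult norm_power
    by (intro add_mono p2 mult_right_mono p) auto
  finally show ?thesis by (simp add: algebra_simps)
qed

text \<open>M-test: on a compact set \<open>ee z\<close> and \<open>ee (- z)\<close> are bounded, so
  the factors differ from 1 by at most a constant times \<open>cmod q ^ n\<close>.\<close>

lemma theta_red_uniform: "compact A \<Longrightarrow> uniform_limit A (\<lambda>N z. \<Prod>n<N. theta_fac q n z) (theta_red q) sequentially"
proof -
  assume A: "compact A"
  have c: "continuous_on A (\<lambda>z. cmod (ee z) + cmod (ee (- z)) + 1)"
    unfolding ee_def by (intro continuous_intros)
  have "bounded ((\<lambda>z. cmod (ee z) + cmod (ee (- z)) + 1) ` A)"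
    by (intro compact_imp_bounded compact_continuous_image c A)
  then obtain C where "\<And>z. z \<in> A \<Longrightarrow> norm (cmod (ee z) + cmod (ee (- z)) + 1) \<le> C"
    unfolding bounded_iff by blast
  hence C: "\<And>z. z \<in> A \<Longrightarrow> cmod (ee z) + cmod (ee (- z)) + 1 \<le> C" by fastforce
  have "uniformly_convergent_on A (\<lambda>N z. \<Prod>n<N. theta_fac q n z)"
  proof (rule uniformly_convergent_on_prod'[OF _ A])
    show "continuous_on A (theta_fac q n)" for n by (intro holomorphic_on_imp_continuous_on theta_fac_hol)
    show "uniformly_convergent_on A (\<lambda>N x. \<Sum>n<N. norm (theta_fac q n x - 1))"
    proof (rule Weierstrass_m_test'[where M = "\<lambda>n. C * cmod q ^ n"])
      show "summable (\<lambda>n. C * cmod q ^ n)" using q by (intro summable_mult summable_geometric) simp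
      show "norm (norm (theta_fac q n x - 1)) \<le> C * cmod q ^ n" if "x \<in> A" for n x
        using theta_fac_bound[of n x] C[OF that] order_trans mult_right_mono[OF C[OF that], of "cmod q ^ n"] by fastforce
    qed
  qed
  thus ?thesis unfolding uniformly_convergent_uniform_limit_iff theta_red_def .
qed

lemma theta_red_tendsto: "(\<lambda>N. \<Prod>n<N. theta_fac q n z) \<longlonglongrightarrow> theta_red q z"
  using tendsto_uniform_limitI[OF theta_red_uniform[of "{z}"], of z] by simp

lemma theta_red_hol: "theta_red q holomorphic_on UNIV"
proof (rule holomorphic_uniform_sequence[OF open_UNIV])
  show "(\<lambda>z. \<Prod>n<N. theta_fac q n z) holomorphic_on UNIV" for N
    by (intro holomorphic_intros theta_fac_hol)
  show "\<exists>d. 0 < d \<and> cball x d \<subseteq> UNIV \<and> uniform_limit (cball x d) (\<lambda>N z. \<Prod>n<N. theta_fac q n z) (theta_red q) sequentially" for x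
    by (intro exI[of _ 1]) (simp add: theta_red_uniform)
qed

text \<open>An absolutely convergent product vanishes only through one of its factors; convergence
  of the partial products alone would not exclude the limit 0.\<close>

lemma theta_red_zero: "theta_red q z = 0 \<longleftrightarrow> (\<exists>n. theta_fac q n z = 0)"
proof -
  have "summable (\<lambda>n. norm (theta_fac q n z - 1))"
  proof (rule summable_comparison_test')
    show "summable (\<lambda>n. (cmod (ee z) + cmod (ee (- z)) + 1) * cmod q ^ n)"
      using q by (intro summable_mult summable_geometric) simp
    show "norm (norm (theta_fac q n z - 1)) \<le> (cmod (ee z) + cmod (ee (- z)) + 1) * cmod q ^ n" if "n \<ge> 0" for n
      using theta_fac_bound[of n z] by simp
  qed
  hence cp: "convergent_prod (\<lambda>n. theta_fac q n z)"
    by (intro abs_convergent_prod_imp_convergent_prod summable_imp_abs_convergent_prod)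
  have l: "(\<lambda>n. \<Prod>i\<le>n. theta_fac q i z) \<longlonglongrightarrow> theta_red q z"
    using theta_red_tendsto[of z] LIMSEQ_lessThan_iff_atMost[of "\<lambda>A. prod (\<lambda>i. theta_fac q i z) A"] by simp
  show ?thesis using convergent_prod_to_zero_iff[OF cp] l LIMSEQ_unique[OF l, of 0] by metis
qed

lemma theta_hol: "theta q holomorphic_on UNIV"
  unfolding theta_def[abs_def] by (intro holomorphic_intros theta_red_hol)

lemma theta_add_1: "theta q (z + 1) = theta q z"
proof -
  have "ee 1 = 1" unfolding ee_eq_1 by (rule exI[of _ 1]) simp
  hence "ee (z + 1) = ee z" "ee (- (z + 1)) = ee (- z)" by (simp_all only: ee_add ee_minus mult_1_right)
  thus ?thesis unfolding theta_def theta_red_def theta_fac_def by simp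
qed

text \<open>The shift by \<open>t\<close> replaces w by q w and moves each of the two families of
  factors by one index. The limit leaves 1 - 1/w in place of 1 - w, and their ratio - 1/w is the
  multiplier.\<close>

lemma theta_add_tau:
  assumes t: "ee t = q"
  shows "theta q (z + t) = - theta q z / ee z"
proof -
  have q0: "q \<noteq> 0" using t ee_nz[of t] by metis
  let ?P = "\<lambda>N z. \<Prod>n<N. theta_fac q n z"
  \<comment> \<open>The boundary factors of the telescoping product are multiplied across rather
    than divided, since they may vanish; the powers of q in them disappear in the limit.\<close>
  have fin: "(1 - q * ee z) * (1 - q ^ N * ee (- z)) * ?P N (z + t) = (1 - q ^ Suc N * ee z) * (1 - ee (- z)) * ?P N z" for N
  proof (induction N)
    case (Suc N)
    have f: "theta_fac q N (z + t) = (1 - q ^ Suc (Suc N) * ee z) * (1 - q ^ N * ee (- z))"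
    proof -
      have "q ^ Suc N * ee (- (z + t)) = q ^ N * ee (- z)"
        using q0 by (simp only: ee_minus ee_add t inverse_mult_distrib) (simp add: field_simps)
      moreover have "q ^ Suc N * ee (z + t) = q ^ Suc (Suc N) * ee z"
        by (simp add: ee_add t)
      ultimately show ?thesis unfolding theta_fac_def by (simp only:)
    qed
    have "(1 - q * ee z) * (1 - q ^ Suc N * ee (- z)) * ?P (Suc N) (z + t)
       = (1 - q ^ Suc N * ee (- z)) * (1 - q ^ Suc (Suc N) * ee z) * ((1 - q * ee z) * (1 - q ^ N * ee (- z)) * ?P N (z + t))"
      unfolding prod.lessThan_Suc f by (simp only: mult_ac)
    also have "\<dots> = (1 - q ^ Suc (Suc N) * ee z) * (1 - ee (- z)) * ?P (Suc N) z"
      unfolding Suc prod.lessThan_Suc theta_fac_def[of q N z] by (simp only: mult_ac)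
    finally show ?case .
  qed simp
  have q_lim: "(\<lambda>N. q ^ N) \<longlonglongrightarrow> 0" "(\<lambda>N. q ^ Suc N) \<longlonglongrightarrow> 0" 
    using LIMSEQ_power_zero[OF q] LIMSEQ_Suc by blast+
  have "(\<lambda>N. (1 - q * ee z) * (1 - q ^ N * ee (- z)) * ?P N (z + t)) \<longlonglongrightarrow>
     (1 - q * ee z) * (1 - 0 * ee (- z)) * theta_red q (z + t)"
    by (intro tendsto_intros q_lim theta_red_tendsto)
  moreover have "(\<lambda>N. (1 - q ^ Suc N * ee z) * (1 - ee (- z)) * ?P N z) \<longlonglongrightarrow>
     (1 - 0 * ee z) * (1 - ee (- z)) * theta_red q z"
    by (intro tendsto_intros q_lim theta_red_tendsto)
  ultimately have "(1 - q * ee z) * theta_red q (z + t) = (1 - ee (- z)) * theta_red q z"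
    unfolding fin using LIMSEQ_unique by fastforce
  thus ?thesis unfolding theta_def by (simp add: ee_add t ee_minus mult.commute[of "ee z" q] field_simps)
qed

text \<open>The zeros are w = q^k for integers k: the factor 1 - w gives k = 0, the factors 1 -
  q^(n+1) w give negative k, and 1 - q^(n+1) / w positive k.\<close>

lemma theta_zero:
  assumes t: "ee t = q"
  shows "theta q z = 0 \<longleftrightarrow> (\<exists>m k::int. z = of_int m + of_int k * t)"
proof
  have pw: "q ^ n = ee (of_nat n * t)" for n
    unfolding t[symmetric] ee_def by (simp add: exp_of_nat_mult[symmetric] mult_ac)
  {
    assume "theta q z = 0"
    then consider "ee z = 1" | n where "ee (of_nat (Suc n) * t + z) = 1" | n where "ee (of_nat (Suc n) * t - z) = 1"
      unfolding theta_def mult_eq_0_iff theta_red_zero unfolding theta_fac_def mult_eq_0_iff pw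
      by (auto simp: ee_add[symmetric] simp del: of_nat_Suc)
    thus "\<exists>m k::int. z = of_int m + of_int k * t"
    proof cases
      case 1
      then obtain m :: int where "z = of_int m" unfolding ee_eq_1 by blast
      thus ?thesis by (intro exI[of _ m] exI[of _ 0]) simp
    next
      case (2 n)
      then obtain m :: int where "of_nat (Suc n) * t + z = of_int m" unfolding ee_eq_1 by blast
      thus ?thesis by (intro exI[of _ m] exI[of _ "- int (Suc n)"]) (simp add: algebra_simps eq_diff_eq)
    next
      case (3 n)
      then obtain m :: int where "of_nat (Suc n) * t - z = of_int m" unfolding ee_eq_1 by blast
      thus ?thesis by (intro exI[of _ "- m"] exI[of _ "int (Suc n)"]) (simp add: algebra_simps eq_diff_eq)
    qed
  }
  assume "\<exists>m k::int. z = of_int m + of_int k * t"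
  then obtain m k :: int where z: "z = of_int m + of_int k * t" by blast
  have em: "ee (of_int j) = 1" for j :: int unfolding ee_eq_1 by blast
  consider "k = 0" | n where "k = - int (Suc n)" | n where "k = int (Suc n)"
    by (metis int_cases3 not0_implies_Suc of_nat_0_less_iff less_numeral_extra(3))
  thus "theta q z = 0"
  proof cases
    case 1 thus ?thesis using em[of m] by (simp add: theta_def z)
  next
    case (2 n)
    have "of_nat (Suc n) * t + z = of_int m" unfolding z 2 by (simp add: algebra_simps)
    hence "q ^ Suc n * ee z = 1" unfolding pw ee_add[symmetric] by (simp only: em)
    thus ?thesis unfolding theta_def mult_eq_0_iff theta_red_zero theta_fac_def by auto
  next
    case (3 n)
    have "of_nat (Suc n) * t + - z = of_int (- m)" unfolding z 3 by (simp add: algebra_simps)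
    hence "q ^ Suc n * ee (- z) = 1" unfolding pw ee_add[symmetric] by (simp only: em)
    thus ?thesis unfolding theta_def mult_eq_0_iff theta_red_zero theta_fac_def by auto
  qed
qed

text \<open>The zero at 0 is simple, because no q^(n+1) equals 1 when |q| < 1. Hence the weight
  vanishes there to the exact order |x|^2.\<close>

lemma theta_deriv_0: "deriv (theta q) 0 \<noteq> 0"
proof -
  have "((\<lambda>z. ee z) has_field_derivative 2 * of_real pi * \<i>) (at 0)"
    unfolding ee_def by (auto intro!: derivative_eq_intros)
  hence d1: "((\<lambda>z. 1 - ee z) has_field_derivative - (2 * of_real pi * \<i>)) (at 0)"
    by (auto intro!: derivative_eq_intros)
  have d2: "(theta_red q has_field_derivative deriv (theta_red q) 0) (at 0)"
    using theta_red_hol holomorphic_derivI by blast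
  have "(theta q has_field_derivative (- (2 * of_real pi * \<i>)) * theta_red q 0) (at 0)"
    unfolding theta_def[abs_def] using DERIV_mult[OF d1 d2] by (simp add: ee_def)
  hence "deriv (theta q) 0 = - (2 * of_real pi * \<i>) * theta_red q 0" by (rule DERIV_imp_deriv)
  moreover have "theta_red q 0 \<noteq> 0"
  proof
    assume "theta_red q 0 = 0"
    then obtain n where "q ^ Suc n = 1" unfolding theta_red_zero by (auto simp: theta_fac_def ee_def)
    hence "cmod q ^ Suc n = 1" using norm_power by (metis norm_one)
    moreover have "cmod q ^ Suc n \<le> cmod q ^ 1" using q by (intro power_decreasing) auto
    ultimately show False using q by simp
  qed
  ultimately show ?thesis by simp
qed

end

section \<open>Logarithms of moduli and the doubly periodic weight\<close>

lemma Im_eq_Re: "Im v = Re (- \<i> * v)"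
  by simp

lemma holomorphic_scaled: "(\<lambda>z. - \<i> * (z / w)) holomorphic_on S"
  by (cases "w = 0") (auto intro!: holomorphic_intros)

lemma smooth_Im_linear: "Ck_on k UNIV (\<lambda>z. Im (z / w))"
  unfolding Im_eq_Re by (rule Ck_on_Re_holomorphic[OF holomorphic_scaled open_UNIV])

lemma grad_laplacian_Im_linear:
  assumes "w \<noteq> 0"
  shows "laplacian (\<lambda>z. Im (z / w)) x = 0" "grad_sq (\<lambda>z. Im (z / w)) x = 1 / (cmod w)\<^sup>2"
proof -
  note h = holomorphic_scaled[of w UNIV]
  have e: "(\<lambda>z. Im (z / w)) = (\<lambda>z. Re (- \<i> * (z / w)))" by (rule ext) (rule Im_eq_Re)
  show "laplacian (\<lambda>z. Im (z / w)) x = 0" unfolding e by (rule laplacian_Re_holomorphic[OF h]) auto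
  have d: "deriv (\<lambda>z. - \<i> * (z / w)) x = - \<i> / w"
    using assms by (intro DERIV_imp_deriv) (auto intro!: derivative_eq_intros)
  note p = pd_holomorphic(1)[OF h open_UNIV UNIV_I, of x, unfolded d]
  have "grad_sq (\<lambda>z. Im (z / w)) x = (Re (- \<i> / w))\<^sup>2 + (- Im (- \<i> / w))\<^sup>2"
    unfolding grad_sq_def e pd_dx[OF p] pd_dy[OF p] ..
  also have "\<dots> = (cmod (- \<i> / w))\<^sup>2" by (simp add: cmod_power2)
  finally show "grad_sq (\<lambda>z. Im (z / w)) x = 1 / (cmod w)\<^sup>2" by (simp add: norm_divide power_divide)
qed

lemma Ck_on_cmod_sq_holomorphic:
  assumes "f holomorphic_on S" "open S"
  shows "Ck_on k S (\<lambda>z. (cmod (f z))\<^sup>2)"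
proof -
  have "(\<lambda>z. - \<i> * f z) holomorphic_on S" using assms(1) by (intro holomorphic_on_mult holomorphic_on_const)
  from Ck_on_Re_holomorphic[OF this assms(2), of k] have "Ck_on k S (\<lambda>z. Im (f z))" by simp
  thus ?thesis unfolding cmod_power2
    by (intro Ck_on_add Ck_on_power Ck_on_Re_holomorphic assms)
qed

lemma Ck_ln_cmod_holomorphic:
  assumes "f holomorphic_on S" "open S" "\<And>z. z \<in> S \<Longrightarrow> f z \<noteq> 0"
  shows "Ck_on k S (\<lambda>z. ln ((cmod (f z))\<^sup>2))"
  by (intro Ck_on_ln Ck_on_cmod_sq_holomorphic assms(1,2)) (use assms(3) in simp)

text \<open>Near a point where f is nonzero there is a holomorphic logarithm L, and ln |f|^2 = Re (2
  L) is harmonic.\<close>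

lemma laplacian_ln_cmod_holomorphic:
  assumes "f holomorphic_on S" "open S" "z0 \<in> S" "f z0 \<noteq> 0"
  shows "laplacian (\<lambda>z. ln ((cmod (f z))\<^sup>2)) z0 = 0"
proof -
  have "continuous_on S f" using assms(1) by (rule holomorphic_on_imp_continuous_on)
  hence "open (S \<inter> f -` (- {0}))" using assms(2) by (intro continuous_open_preimage) auto
  then obtain r where r: "r > 0" "ball z0 r \<subseteq> S \<inter> f -` (- {0})"
    using assms(3,4) open_contains_ball by blast
  have hf: "f holomorphic_on ball z0 r" using assms(1) r by (auto intro: holomorphic_on_subset)
  obtain L where L: "L holomorphic_on ball z0 r" "\<And>z. z \<in> ball z0 r \<Longrightarrow> exp (L z) = f z"
    by (rule holomorphic_logarithm_exists[OF convex_ball open_ball hf, where ?z0.0 = z0]) (use r in auto)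
  have "laplacian (\<lambda>z. ln ((cmod (f z))\<^sup>2)) z0 = laplacian (\<lambda>z. Re (2 * L z)) z0"
  proof (rule laplacian_cong_open[of "ball z0 r"])
    fix z assume "z \<in> ball z0 r"
    from L(2)[OF this, symmetric] show "ln ((cmod (f z))\<^sup>2) = Re (2 * L z)"
      by (simp add: norm_exp_eq_Re ln_realpow)
  qed (use r in auto)
  also have "\<dots> = 0"
    by (rule laplacian_Re_holomorphic[of _ "ball z0 r"]) (use r L in \<open>auto intro!: holomorphic_intros\<close>)
  finally show ?thesis .
qed

text \<open>The Gaussian factor makes the squared modulus of theta doubly periodic, at the price of
  the constant Laplacian \<open>- 4 \<pi> / area\<close> of its logarithm.\<close>

lemma theta_weight_exists:
  assumes D: "Im (cnj w1 * w2) > 0"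
  shows "\<exists>Q. doubly_periodic w1 w2 Q \<and> (\<forall>k. Ck_on k UNIV Q) \<and> (\<forall>x. Q x \<ge> 0) \<and>
     (\<forall>x. Q x = 0 \<longleftrightarrow> x \<in> period_lattice w1 w2) \<and>
     (\<forall>x. x \<notin> period_lattice w1 w2 \<longrightarrow> laplacian (\<lambda>z. ln (Q z)) x = - (4 * pi / Im (cnj w1 * w2))) \<and>
     (\<exists>r>0. \<exists>w. (\<forall>k. Ck_on k (ball 0 r) w) \<and> (\<forall>x\<in>ball 0 r - {0}. Q x = (cmod x)\<^sup>2 * exp (w x)))"
proof -
  let ?D = "Im (cnj w1 * w2)"
  have w1: "w1 \<noteq> 0" using D by auto
  define \<tau> where "\<tau> = w2 / w1"
  define t where "t = Im \<tau>"
  have tD: "t * (cmod w1)\<^sup>2 = ?D"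
  proof -
    have "\<tau> * (w1 * cnj w1) = cnj w1 * w2" using w1 by (simp add: \<tau>_def)
    hence "\<tau> * of_real ((cmod w1)\<^sup>2) = cnj w1 * w2" by (simp only: complex_norm_square)
    from arg_cong[OF this, of Im] show ?thesis by (simp add: t_def)
  qed
  have t0: "t > 0" using tD D w1 by (metis zero_less_mult_pos2 zero_less_norm_iff zero_less_power)
  define q where "q = ee \<tau>"
  have q: "cmod q < 1" unfolding q_def norm_ee using t0 by (simp add: t_def)
  define G where "G z = theta q (z / w1)" for z
  \<comment> \<open>Chosen so that \<phi> (y + t) - \<phi> y = - 4 pi y, which cancels the factor
    exp (4 pi Im z) from the quasi-period. Its second derivative - 4 pi / t, times |grad Im (z /
    w1)|^2 = 1 / |w1|^2, is the constant Laplacian, as t |w1|^2 is the determinant of the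
    periods.\<close>
  define \<phi> where "\<phi> y = 2 * pi * y - 2 * pi / t * y\<^sup>2" for y
  define Q where "Q z = (cmod (G z))\<^sup>2 * exp (\<phi> (Im (z / w1)))" for z
  have hG: "G holomorphic_on UNIV"
  proof -
    have 1: "(\<lambda>z. z / w1) holomorphic_on UNIV" using w1 by (intro holomorphic_intros) auto
    have 2: "theta q holomorphic_on range (\<lambda>z. z / w1)" using theta_hol[OF q] by (rule holomorphic_on_subset) simp
    show ?thesis unfolding G_def[abs_def] using holomorphic_on_compose[OF 1 2] by (simp add: o_def)
  qed
  have C\<phi>: "Ck_on k UNIV (\<lambda>z. \<phi> (Im (z / w1)))" for k
    unfolding \<phi>_def by (intro Ck_on_diff Ck_on_cmult Ck_on_power smooth_Im_linear)
  have per: "doubly_periodic w1 w2 Q" unfolding doubly_periodic_def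
  proof (intro allI conjI)
    fix x
    show "Q (x + w1) = Q x" using w1 by (simp add: Q_def G_def add_divide_distrib theta_add_1[OF q])
    have e: "(x + w2) / w1 = x / w1 + \<tau>" by (simp add: \<tau>_def add_divide_distrib)
    have "cmod (G (x + w2)) = cmod (G x) * exp (2 * pi * Im (x / w1))"
      unfolding G_def e theta_add_tau[OF q q_def[symmetric]] by (simp add: norm_divide norm_ee exp_minus divide_simps)
    hence "(cmod (G (x + w2)))\<^sup>2 = (cmod (G x))\<^sup>2 * exp (4 * pi * Im (x / w1))"
      by (simp add: power_mult_distrib exp_double[symmetric])
    moreover have "\<phi> (Im ((x + w2) / w1)) = \<phi> (Im (x / w1)) - 4 * pi * Im (x / w1)"
      unfolding e \<phi>_def using t0 by (simp add: t_def[symmetric] field_simps power2_eq_square)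
    ultimately show "Q (x + w2) = Q x" by (simp add: Q_def exp_diff)
  qed
  have CQ: "Ck_on k UNIV Q" for k
    unfolding Q_def[abs_def] by (intro Ck_on_mult Ck_on_exp C\<phi> Ck_on_cmod_sq_holomorphic hG open_UNIV)
  have zero: "G x = 0 \<longleftrightarrow> x \<in> period_lattice w1 w2" for x
  proof -
    have "x / w1 = of_int m + of_int k * \<tau> \<longleftrightarrow> x = of_int m * w1 + of_int k * w2" for m k :: int
      using w1 by (simp add: \<tau>_def field_simps)
    thus ?thesis unfolding G_def theta_zero[OF q q_def[symmetric]] period_lattice_def by auto
  qed
  have Qz: "Q x = 0 \<longleftrightarrow> x \<in> period_lattice w1 w2" for x
    using zero by (simp add: Q_def)
  have lap: "laplacian (\<lambda>z. ln (Q z)) x = - (4 * pi / ?D)" if x: "x \<notin> period_lattice w1 w2" for x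
  proof -
    let ?S = "{z. G z \<noteq> 0}"
    have S: "open ?S" using holomorphic_on_imp_continuous_on[OF hG] by (intro open_Collect_neq) auto
    have xS: "x \<in> ?S" using x zero by simp
    have hS: "G holomorphic_on ?S" using hG by (rule holomorphic_on_subset) simp
    have "laplacian (\<lambda>z. ln (Q z)) x = laplacian (\<lambda>z. ln ((cmod (G z))\<^sup>2) + \<phi> (Im (z / w1))) x"
      by (rule laplacian_cong_open[OF S xS]) (simp add: Q_def ln_mult)
    also have "\<dots> = laplacian (\<lambda>z. ln ((cmod (G z))\<^sup>2)) x + laplacian (\<lambda>z. \<phi> (Im (z / w1))) x"
      by (rule laplacian_add[OF Ck_ln_cmod_holomorphic[OF hS S] Ck_on_subset[OF C\<phi>] S xS]) auto
    also have "laplacian (\<lambda>z. ln ((cmod (G z))\<^sup>2)) x = 0"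
      by (rule laplacian_ln_cmod_holomorphic[OF hS S xS]) (use xS in simp)
    also have "laplacian (\<lambda>z. \<phi> (Im (z / w1))) x =
        (2 * pi - 4 * pi / t * Im (x / w1)) * laplacian (\<lambda>z. Im (z / w1)) x + (- (4 * pi / t)) * grad_sq (\<lambda>z. Im (z / w1)) x"
      by (rule laplacian_compose[OF smooth_Im_linear open_UNIV UNIV_I, where \<psi>' = "\<lambda>y. 2 * pi - 4 * pi / t * y"])
         (use t0 in \<open>auto simp: \<phi>_def[abs_def] intro!: derivative_eq_intros\<close>)
    finally show ?thesis unfolding grad_laplacian_Im_linear[OF w1] tD[symmetric] by simp
  qed
  have "\<exists>r>0. \<exists>w. (\<forall>k. Ck_on k (ball 0 r) w) \<and> (\<forall>x\<in>ball 0 r - {0}. Q x = (cmod x)\<^sup>2 * exp (w x))"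
  proof -
    \<comment> \<open>The quotient of \<open>G\<close> by z with the singularity filled in; its
      value at 0 is the nonzero derivative, so ln |H|^2 is smooth near 0.\<close>
    define H where "H z = (if z = 0 then deriv G 0 else (G z - G 0) / (z - 0))" for z
    have hH: "H holomorphic_on UNIV" unfolding H_def[abs_def] by (rule pole_lemma_open[OF hG open_UNIV])
    have G0: "G 0 = 0" unfolding zero period_lattice_def by (auto intro!: exI[of _ 0])
    have "(theta q has_field_derivative deriv (theta q) 0) (at (0 / w1))"
      using holomorphic_derivI[OF theta_hol[OF q] open_UNIV UNIV_I, of 0] by simp
    moreover have "((\<lambda>z. z / w1) has_field_derivative 1 / w1) (at 0)" by (rule DERIV_cdivide) simp
    ultimately have "(G has_field_derivative deriv (theta q) 0 * (1 / w1)) (at 0)"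
      unfolding G_def[abs_def] by (rule DERIV_chain2)
    hence "H 0 = deriv (theta q) 0 * (1 / w1)" by (simp add: H_def DERIV_imp_deriv)
    hence H0: "H 0 \<noteq> 0" using theta_deriv_0[OF q] w1 by simp
    have "open {z. H z \<noteq> 0}" using holomorphic_on_imp_continuous_on[OF hH] by (intro open_Collect_neq) auto
    then obtain r where r: "r > 0" "ball 0 r \<subseteq> {z. H z \<noteq> 0}" using H0 open_contains_ball by blast
    define w where "w z = ln ((cmod (H z))\<^sup>2) + \<phi> (Im (z / w1))" for z
    have "Ck_on k (ball 0 r) w" for k unfolding w_def[abs_def]
      by (intro Ck_on_add Ck_ln_cmod_holomorphic holomorphic_on_subset[OF hH] Ck_on_subset[OF C\<phi>] open_ball)
         (use r in auto)
    moreover have "Q x = (cmod x)\<^sup>2 * exp (w x)" if "x \<in> ball 0 r - {0}" for x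
    proof -
      have "H x \<noteq> 0" using that r by auto
      hence "exp (w x) = (cmod (H x))\<^sup>2 * exp (\<phi> (Im (x / w1)))" by (simp add: w_def exp_add)
      moreover have "G x = x * H x" using that G0 by (simp add: H_def)
      ultimately show ?thesis by (simp add: Q_def norm_mult power_mult_distrib)
    qed
    ultimately show ?thesis using r(1) by blast
  qed
  moreover have "Q x \<ge> 0" for x by (simp add: Q_def)
  ultimately show ?thesis using per CQ Qz lap by blast
qed

lemma laplacian_sum:
  assumes "open S" "x \<in> S" "\<And>i. i \<in> I \<Longrightarrow> Ck_on 2 S (f i)"
  shows "laplacian (\<lambda>x. \<Sum>i\<in>I. f i x) x = (\<Sum>i\<in>I. laplacian (f i) x)"
  using assms(3)
proof (induction I rule: infinite_finite_induct)
  case (insert i I)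
  have "laplacian (\<lambda>x. f i x + (\<Sum>i\<in>I. f i x)) x = laplacian (f i) x + laplacian (\<lambda>x. \<Sum>i\<in>I. f i x) x"
    by (rule laplacian_add[OF _ _ assms(1,2)]) (use insert.prems in \<open>auto intro!: Ck_on_sum\<close>)
  thus ?case using insert by simp
qed (simp_all add: laplacian_const)

section \<open>The weight attached to points and multiplicities\<close>

context torus
begin

definition area :: real where "area = \<bar>Im (cnj w1 * w2)\<bar>"

lemma area_pos: "area > 0" using indep by (simp add: area_def)

definition thQ_spec :: "(complex \<Rightarrow> real) \<Rightarrow> bool" where
  "thQ_spec Q \<longleftrightarrow> per Q \<and> (\<forall>k. Ck_on k UNIV Q) \<and> (\<forall>x. Q x \<ge> 0) \<and> (\<forall>x. Q x = 0 \<longleftrightarrow> x \<in> Lam) \<and>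
     (\<forall>x. x \<notin> Lam \<longrightarrow> laplacian (\<lambda>z. ln (Q z)) x = - (4 * pi / area)) \<and>
     (\<exists>r>0. \<exists>w. (\<forall>k. Ck_on k (ball 0 r) w) \<and> (\<forall>x\<in>ball 0 r - {0}. Q x = (cmod x)\<^sup>2 * exp (w x)))"

definition thQ :: "complex \<Rightarrow> real" where "thQ = (SOME Q. thQ_spec Q)"

text \<open>The construction asks for positively oriented periods. Otherwise they are exchanged,
  which preserves lattice, periodicity and area.\<close>

lemma thQ_spec: "thQ_spec thQ"
proof -
  have "\<exists>Q. thQ_spec Q"
  proof (cases "Im (cnj w1 * w2) > 0")
    case True
    thus ?thesis using theta_weight_exists[OF True] unfolding thQ_spec_def area_def by simp
  next
    case False
    hence D: "Im (cnj w2 * w1) > 0" "area = Im (cnj w2 * w1)" using indep unfolding indep'(2) area_def by linarith+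
    have "period_lattice w2 w1 = Lam" unfolding period_lattice_def by (metis (no_types, opaque_lifting) add.commute)
    moreover have "doubly_periodic w2 w1 = per" unfolding doubly_periodic_def by auto
    ultimately show ?thesis using theta_weight_exists[OF D(1)] unfolding thQ_spec_def D(2) by simp
  qed
  thus ?thesis unfolding thQ_def by (rule someI_ex)
qed

lemma thQ_per: "per thQ" and thQ_Ck: "Ck_on k UNIV thQ" and thQ_nonneg: "thQ x \<ge> 0"
  and thQ_zero: "thQ x = 0 \<longleftrightarrow> x \<in> Lam"
  and thQ_lap: "x \<notin> Lam \<Longrightarrow> laplacian (\<lambda>z. ln (thQ z)) x = - (4 * pi / area)"
  and thQ_local: "\<exists>r>0. \<exists>w. (\<forall>k. Ck_on k (ball 0 r) w) \<and> (\<forall>x\<in>ball 0 r - {0}. thQ x = (cmod x)\<^sup>2 * exp (w x))"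
  using thQ_spec unfolding thQ_spec_def by blast+

lemma thQ_shift_Ck: "Ck_on k UNIV (\<lambda>x. thQ (x - c))"
  using Ck_on_shift[OF thQ_Ck, of k "- c"] by simp

text \<open>This is exp v_0, smooth even at the singular points, where v_0 tends to minus infinity;
  zero multiplicities contribute factors 1.\<close>

definition W :: "nat \<Rightarrow> (nat \<Rightarrow> complex) \<Rightarrow> (nat \<Rightarrow> nat) \<Rightarrow> complex \<Rightarrow> real" where
  "W m p n x = (\<Prod>j<m. thQ (x - p j) ^ n j)"

lemma W_Ck: "Ck_on k UNIV (W m p n)"
  unfolding W_def[abs_def] by (intro Ck_on_prod Ck_on_power thQ_shift_Ck)

lemma W_cont: "continuous_on UNIV (W m p n)"
  using W_Ck[of 0] by simp

lemma W_nonneg: "W m p n x \<ge> 0"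
  unfolding W_def by (intro prod_nonneg zero_le_power thQ_nonneg ballI)

lemma W_per: "per (W m p n)"
proof -
  have "thQ (x + w1 - c) = thQ (x - c)" "thQ (x + w2 - c) = thQ (x - c)" for x c
    using thQ_per unfolding doubly_periodic_def by (metis add_diff_eq add.commute diff_add_eq)+
  thus ?thesis unfolding doubly_periodic_def W_def by simp
qed

lemma W_zero: "W m p n x = 0 \<longleftrightarrow> (\<exists>j<m. n j > 0 \<and> x - p j \<in> Lam)"
  unfolding W_def by (auto simp: thQ_zero)

lemma W_pos: "W m p n x > 0 \<longleftrightarrow> \<not> (\<exists>j<m. n j > 0 \<and> x - p j \<in> Lam)"
  unfolding W_zero[symmetric] using W_nonneg[of m p n x] by auto

abbreviation "sing \<equiv> sing_set w1 w2"

lemma sing_iff: "x \<in> sing m p \<longleftrightarrow> (\<exists>j<m. x - p j \<in> Lam)"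
proof -
  have "(\<exists>j l. x = p j + l \<and> j < m \<and> l \<in> Lam) \<longleftrightarrow> (\<exists>j<m. x - p j \<in> Lam)"
    by (metis add_diff_cancel_left' add.commute diff_add_cancel)
  thus ?thesis unfolding sing_set_def by simp
qed

lemma W_pos_off_sing: "x \<notin> sing m p \<Longrightarrow> W m p n x > 0"
  unfolding W_pos sing_iff by blast

lemma open_off_sing: "open (- sing m p)"
proof -
  have "- sing m p = {x. W m p (\<lambda>_. 1) x > 0}" unfolding W_pos by (auto simp: sing_iff)
  thus ?thesis using W_cont by (auto intro!: open_Collect_less)
qed

lemma countable_sing: "countable (sing m p)"
proof -
  have "sing m p = (\<Union>j<m. (\<lambda>l. p j + l) ` Lam)" unfolding sing_set_def by auto
  thus ?thesis using countable_Lam by simp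
qed

lemma open_W_pos: "open {x. W m p n x > 0}"
  using W_cont by (intro open_Collect_less) auto

definition cc :: "nat \<Rightarrow> (nat \<Rightarrow> nat) \<Rightarrow> real" where
  "cc m n = 4 * pi * real (\<Sum>j<m. n j) / area"

text \<open>Each j with \<open>n j > 0\<close> contributes n_j times the constant of
  \<open>thQ_lap\<close>. For \<open>n j = 0\<close> the term is identically 0 and is treated apart,
  since \<open>ln (thQ (x - p j))\<close> may be singular inside the region.\<close>

lemma laplacian_ln_W:
  assumes x: "W m p n x > 0"
  shows "laplacian (\<lambda>x. ln (W m p n x)) x = - cc m n"
proof -
  let ?S = "{x. W m p n x > 0}"
  let ?f = "\<lambda>j x. real (n j) * ln (thQ (x - p j))"
  have nz: "thQ (y - p j) > 0" if "y \<in> ?S" "j < m" "n j > 0" for y j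
    using that W_pos[of m p n y] thQ_zero[of "y - p j"] thQ_nonneg[of "y - p j"] by fastforce
  have C: "Ck_on 2 ?S (?f j)" if "j < m" for j
  proof (cases "n j = 0")
    case False
    thus ?thesis using nz that
      by (intro Ck_on_cmult Ck_on_ln) (auto intro: Ck_on_subset[OF thQ_shift_Ck])
  qed (simp add: Ck_on_const)
  have L: "laplacian (?f j) x = real (n j) * - (4 * pi / area)" if j: "j < m" for j
  proof (cases "n j = 0")
    case True thus ?thesis by (simp add: laplacian_const)
  next
    case False
    have "Ck_on 2 ?S (\<lambda>x. ln (thQ (x - p j)))"
      using nz j False by (intro Ck_on_ln) (auto intro: Ck_on_subset[OF thQ_shift_Ck])
    hence "laplacian (?f j) x = real (n j) * laplacian (\<lambda>x. ln (thQ (x - p j))) x"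
      by (rule laplacian_cmult[OF _ open_W_pos]) (use x in simp)
    also have "laplacian (\<lambda>x. ln (thQ (x - p j))) x = - (4 * pi / area)"
      using laplacian_shift[of "\<lambda>z. ln (thQ z)" "- p j" x] thQ_lap[of "x - p j"] thQ_zero[of "x - p j"]
        nz[of x j] x j False by auto
    finally show ?thesis .
  qed
  have "laplacian (\<lambda>x. ln (W m p n x)) x = laplacian (\<lambda>x. \<Sum>j<m. ?f j x) x"
  proof (rule laplacian_cong_open[OF open_W_pos])
    fix y assume y: "y \<in> ?S"
    have "ln (W m p n y) = (\<Sum>j<m. ln (thQ (y - p j) ^ n j))"
      unfolding W_def
    proof (rule ln_prod)
      fix j assume j: "j \<in> {..<m}"
      have "thQ (y - p j) ^ n j > 0" using nz[OF y, of j] j by (cases "n j = 0") auto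
      thus "thQ (y - p j) ^ n j \<noteq> 0" by (rule less_imp_neq[THEN not_sym])
    qed simp
    also have "\<dots> = (\<Sum>j<m. ?f j y)"
    proof (rule sum.cong[OF refl])
      fix j assume j: "j \<in> {..<m}"
      show "ln (thQ (y - p j) ^ n j) = ?f j y" using nz[OF y, of j] j by (cases "n j = 0") (auto simp: ln_realpow)
    qed
    finally show "ln (W m p n y) = (\<Sum>j<m. ?f j y)" .
  qed (use x in simp)
  also have "\<dots> = (\<Sum>j<m. laplacian (?f j) x)"
    by (rule laplacian_sum[OF open_W_pos]) (use x C in auto)
  also have "\<dots> = - cc m n" using L by (simp add: cc_def sum_distrib_left[symmetric] sum_negf sum_distrib_right[symmetric] sum_divide_distrib[symmetric] mult_ac)
  finally show ?thesis .
qed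

text \<open>By \<open>FD_unique\<close> distinct points of the fundamental domain are inequivalent
  modulo the lattice, so near \<open>p j\<close> only the j-th factor vanishes and the others enter
  the exponent.\<close>

lemma W_local:
  assumes adm: "admissible_data w1 w2 m p" and j: "j < m"
  shows "\<exists>r>0. \<exists>w. (\<forall>k. Ck_on k (ball (p j) r) w) \<and> (\<forall>x\<in>ball (p j) r - {p j}.
     x \<notin> sing m p \<and> W m p n x = ((cmod (x - p j))\<^sup>2) ^ n j * exp (w x))"
proof -
  obtain r0 w0 where r0: "r0 > 0" "\<And>k. Ck_on k (ball 0 r0) w0"
    "\<And>x. x \<in> ball 0 r0 - {0} \<Longrightarrow> thQ x = (cmod x)\<^sup>2 * exp (w0 x)" using thQ_local by blast
  let ?I = "{..<m} - {j}"
  \<comment> \<open>Without the exponents \<open>n i\<close>, so that the ball also avoids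
    translates of those \<open>p i\<close> with \<open>n i = 0\<close>, as the claim about
    \<open>sing\<close> requires.\<close>
  define V where "V = {x. (\<Prod>i\<in>?I. thQ (x - p i)) \<noteq> 0}"
  have "continuous_on UNIV (\<lambda>x. \<Prod>i\<in>?I. thQ (x - p i))"
    using Ck_on_prod[of ?I 0 UNIV "\<lambda>i x. thQ (x - p i)"] thQ_shift_Ck[of 0] by simp
  hence "open V" unfolding V_def by (intro open_Collect_neq) auto
  moreover have "p j \<in> V"
  proof -
    have "p j - p i \<notin> Lam" if "i \<in> ?I" for i
    proof
      assume "p j - p i \<in> Lam"
      hence "p j = p i" using FD_unique[of "p j" "p i"] adm that j unfolding admissible_data_def by auto
      thus False using adm that j unfolding admissible_data_def inj_on_def by auto
    qed
    thus ?thesis by (simp add: V_def thQ_zero)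
  qed
  ultimately obtain r1 where r1: "r1 > 0" "ball (p j) r1 \<subseteq> V" using open_contains_ball by blast
  define r where "r = min r0 r1"
  have Vp: "thQ (x - p i) > 0" if "x \<in> ball (p j) r" "i \<in> ?I" for x i
  proof -
    have "x \<in> V" using that(1) r1(2) by (auto simp: r_def)
    hence "thQ (x - p i) \<noteq> 0" using that(2) unfolding V_def by auto
    thus ?thesis using thQ_nonneg[of "x - p i"] by simp
  qed
  define w where "w x = real (n j) * w0 (x - p j) + (\<Sum>i\<in>?I. real (n i) * ln (thQ (x - p i)))" for x
  have "Ck_on k (ball (p j) r) w" for k
    unfolding w_def[abs_def]
  proof (intro Ck_on_add Ck_on_sum Ck_on_cmult Ck_on_ln)
    have "Ck_on k {x. x + - p j \<in> ball 0 r0} (\<lambda>x. w0 (x + - p j))" by (rule Ck_on_shift[OF r0(2)])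
    from Ck_on_subset[OF this, of "ball (p j) r"] show "Ck_on k (ball (p j) r) (\<lambda>x. w0 (x - p j))"
      by (simp add: r_def subset_iff dist_norm norm_minus_commute)
    show "Ck_on k (ball (p j) r) (\<lambda>x. thQ (x - p i))" for i by (rule Ck_on_subset[OF thQ_shift_Ck]) simp
  qed (use Vp in auto)
  moreover have "x \<notin> sing m p \<and> W m p n x = ((cmod (x - p j))\<^sup>2) ^ n j * exp (w x)" if x: "x \<in> ball (p j) r - {p j}" for x
  proof
    have xj: "x - p j \<in> ball 0 r0 - {0}" using x by (auto simp: r_def dist_norm norm_minus_commute)
    have Qj: "thQ (x - p j) = (cmod (x - p j))\<^sup>2 * exp (w0 (x - p j))" by (rule r0(3)[OF xj])
    hence "thQ (x - p j) \<noteq> 0" using xj by simp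
    have "thQ (x - p i) \<noteq> 0" if "i < m" for i
    proof (cases "i = j")
      case False
      thus ?thesis using Vp[of x i] x that by simp
    qed (use \<open>thQ (x - p j) \<noteq> 0\<close> in simp)
    thus "x \<notin> sing m p" unfolding sing_iff thQ_zero by blast
    have "W m p n x = thQ (x - p j) ^ n j * (\<Prod>i\<in>?I. thQ (x - p i) ^ n i)"
      unfolding W_def using j by (subst prod.remove[of "{..<m}" j]) auto
    also have "(\<Prod>i\<in>?I. thQ (x - p i) ^ n i) = exp (\<Sum>i\<in>?I. real (n i) * ln (thQ (x - p i)))"
      unfolding exp_sum[OF finite_Diff[OF finite_lessThan]]
      by (rule prod.cong[OF refl]) (use Vp[of x] x in \<open>simp add: exp_of_nat_mult\<close>)
    also have "thQ (x - p j) ^ n j = ((cmod (x - p j))\<^sup>2) ^ n j * exp (real (n j) * w0 (x - p j))"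
      unfolding Qj by (simp add: power_mult_distrib exp_of_nat_mult)
    finally show "W m p n x = ((cmod (x - p j))\<^sup>2) ^ n j * exp (w x)" by (simp add: w_def exp_add)
  qed
  moreover have "r > 0" using r0(1) r1(1) by (simp add: r_def)
  ultimately show ?thesis by blast
qed

end

section \<open>The nonlinearity\<close>

text \<open>With \<open>v = u - e\<^sup>u\<close> and \<open>y = e\<^sup>u\<close> one has \<open>e\<^sup>v = y e\<^sup>-\<^sup>y\<close>; \<open>th\<close> recovers \<open>y \<le> 1\<close> from \<open>e\<^sup>v\<close>.
  Beyond the range \<open>e\<^sup>v \<le> 1/e\<close> the nonlinearity is continued by \<open>- 2 (v + 1)\<close>, which makes it
  continuously differentiable and lets \<open>v \<mapsto> Phi (e\<^sup>v) + 2 v\<close> be nondecreasing throughout.\<close>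

definition th :: "real \<Rightarrow> real" where
  "th s = (if s \<le> exp (-1) then (THE y. y \<le> 1 \<and> y * exp (- y) = s) else 1)"

definition Phi :: "real \<Rightarrow> real" where
  "Phi s = (if s \<le> exp (-1) then th s * (1 - th s)\<^sup>2 else - 2 * (ln s + 1))"

text \<open>With y = \<open>th s\<close> the derivative of y (1 - y)^2 is (1 - y) (1 - 3 y) and that
  of \<open>th\<close> is exp y / (1 - y); the factor 1 - y cancels. Both branches have the value -
  2 e at s = 1/e.\<close>

definition dPhi :: "real \<Rightarrow> real" where
  "dPhi s = (if s \<le> exp (-1) then exp (th s) * (1 - 3 * th s) else - 2 / s)"

lemma yexp_deriv: "((\<lambda>y. y * exp (- y)) has_real_derivative (1 - y) * exp (- y)) (at y)"
  by (auto intro!: derivative_eq_intros simp: algebra_simps)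

lemma yexp_strict: "x < y \<Longrightarrow> y \<le> 1 \<Longrightarrow> x * exp (- x) < y * exp (- y :: real)"
proof (rule DERIV_pos_imp_increasing_open[of x y "\<lambda>y. y * exp (- y)"])
  fix z assume "x < z" "z < y" "y \<le> 1"
  thus "\<exists>l. ((\<lambda>y. y * exp (- y)) has_real_derivative l) (at z) \<and> 0 < l"
    by (intro exI[of _ "(1 - z) * exp (- z)"] conjI yexp_deriv) simp
qed (auto intro!: continuous_intros)

lemma yexp_inj: "x \<le> 1 \<Longrightarrow> y \<le> 1 \<Longrightarrow> x * exp (- x) = y * exp (- y :: real) \<Longrightarrow> x = y"
  using yexp_strict[of x y] yexp_strict[of y x] by (cases x y rule: linorder_cases) auto

lemma yexp_less_iff: "x \<le> 1 \<Longrightarrow> y \<le> 1 \<Longrightarrow> x * exp (- x) < y * exp (- y :: real) \<longleftrightarrow> x < y"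
  using yexp_strict[of x y] yexp_strict[of y x] by (cases x y rule: linorder_cases) auto

lemma th_eq: assumes "y \<le> 1" shows "th (y * exp (- y)) = y"
proof -
  have "y * exp (- y) \<le> 1 * exp (- 1)" using yexp_strict[of y 1] assms by (cases "y = 1") auto
  moreover have "(THE z. z \<le> 1 \<and> z * exp (- z) = y * exp (- y)) = y"
    using assms yexp_inj by (intro the_equality) auto
  ultimately show ?thesis unfolding th_def by simp
qed

lemma th_ex: assumes "s \<le> exp (-1)" obtains y where "y \<le> 1" "s = y * exp (- y)" "th s = y"
proof -
  have "\<exists>y\<ge>min s 0. y \<le> 1 \<and> y * exp (- y) = s"
  proof (rule IVT')
    show "min s 0 * exp (- min s 0) \<le> s"
    proof (cases "s < 0")
      case True
      have "- s * 1 \<le> - s * exp (- s)" using True by (intro mult_left_mono) auto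
      thus ?thesis using True by simp
    qed simp
  qed (use assms in \<open>auto intro!: continuous_intros\<close>)
  then obtain y where "y \<le> 1" "y * exp (- y) = s" by blast
  thus thesis using that[of y] th_eq[of y] by simp
qed

lemma th_le_1: "th s \<le> 1"
proof (cases "s \<le> exp (-1)")
  case True thus ?thesis by (rule th_ex) simp
qed (simp add: th_def)

lemma th_inv: "s \<le> exp (-1) \<Longrightarrow> th s * exp (- th s) = s"
  by (erule th_ex) simp

lemma th_exp1: "th (exp (-1)) = 1"
  using th_eq[of 1] by simp

lemma th_less_iff: "s \<le> exp (-1) \<Longrightarrow> y \<le> 1 \<Longrightarrow> th s < y \<longleftrightarrow> s < y * exp (- y)"
  using yexp_less_iff[OF th_le_1, of y s] th_inv by simp

lemma less_th_iff: "s \<le> exp (-1) \<Longrightarrow> y \<le> 1 \<Longrightarrow> y < th s \<longleftrightarrow> y * exp (- y) < s"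
  using yexp_less_iff[OF _ th_le_1, of y s] th_inv by simp

lemma th_lt_1: "s < exp (-1) \<Longrightarrow> th s < 1"
  using th_less_iff[of s 1] by simp

lemma th_nonneg: "0 \<le> s \<Longrightarrow> 0 \<le> th s"
proof (cases "s \<le> exp (-1)")
  case True assume "0 \<le> s" thus ?thesis using th_less_iff[OF True, of 0] by simp
qed (simp add: th_def)

lemma th_pos: "0 < s \<Longrightarrow> 0 < th s"
proof (cases "s \<le> exp (-1)")
  case True assume "0 < s" thus ?thesis using less_th_iff[OF True, of 0] by simp
qed (simp add: th_def)

text \<open>At y = 1 the function y exp (- y) has slope 0, so continuity of the inverse is taken
  from monotonicity: \<open>th s\<close> exceeds a given y < 1 as soon as s exceeds y exp (-
  y).\<close>

lemma th_cont_1: "isCont th (exp (-1))"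
proof -
  have "\<exists>d>0. \<forall>s. \<bar>s - exp (-1)\<bar> < d \<longrightarrow> \<bar>th s - 1\<bar> < e" if e: "e > 0" for e
  proof -
    define y where "y = 1 - e / 2"
    have y: "y < 1" using e by (simp add: y_def)
    have lt: "y * exp (- y) < exp (-1)" using yexp_strict[of y 1] y by simp
    show ?thesis
    proof (intro exI[of _ "exp (-1) - y * exp (- y)"] conjI allI impI)
      fix s :: real assume s: "\<bar>s - exp (-1)\<bar> < exp (-1) - y * exp (- y)"
      show "\<bar>th s - 1\<bar> < e"
      proof (cases "s \<le> exp (-1)")
        case True
        have "y < th s" using less_th_iff[OF True, of y] y s by linarith
        thus ?thesis using th_le_1[of s] e by (simp add: y_def)
      qed (simp add: th_def e)
    qed (use lt in simp)
  qed
  thus ?thesis unfolding isCont_def th_exp1 LIM_def by (simp add: dist_real_def) (metis)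
qed

lemma th_cont_lt: assumes "s < exp (-1)" shows "isCont th s"
proof -
  obtain y where y: "y \<le> 1" "s = y * exp (- y)" "th s = y" by (rule th_ex[OF less_imp_le[OF assms]])
  have y1: "y < 1" using th_lt_1[OF assms] y by simp
  have "isCont th ((\<lambda>y. y * exp (- y)) y)"
    by (rule isCont_inverse_function2[of "y - 1" y 1 th]) (use y1 in \<open>auto intro!: continuous_intros th_eq\<close>)
  thus ?thesis using y by simp
qed

lemma th_cont: "isCont th s"
proof (cases s "exp (-1) :: real" rule: linorder_cases)
  case greater
  have "\<forall>\<^sub>F x in nhds s. th x = 1"
    using eventually_nhds_in_open[of "{exp (-1)<..}" s] greater by (auto elim!: eventually_mono simp: th_def)
  thus ?thesis using isCont_cong[of th "\<lambda>_. 1" s] by simp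
qed (use th_cont_lt th_cont_1 in auto)

lemma th_deriv:
  assumes "s < exp (-1)" shows "(th has_real_derivative exp (th s) / (1 - th s)) (at s)"
proof -
  have n: "(1 - th s) * exp (- th s) \<noteq> 0" using th_lt_1[OF assms] by simp
  have "(th has_real_derivative inverse ((1 - th s) * exp (- th s))) (at s)"
    by (rule DERIV_inverse_function[where f = "\<lambda>y. y * exp (- y)" and g = th, OF yexp_deriv n, of "s - 1" "exp (-1)"])
       (use assms th_inv th_cont in auto)
  moreover have "inverse ((1 - th s) * exp (- th s)) = exp (th s) / (1 - th s)"
    by (simp add: exp_minus divide_simps)
  ultimately show ?thesis by simp
qed

lemma Phi_deriv_lt: assumes "s < exp (-1)" shows "(Phi has_real_derivative dPhi s) (at s)"
proof -
  have t: "1 - th s \<noteq> 0" using th_lt_1[OF assms] by simp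
  have "((\<lambda>s. th s * (1 - th s)\<^sup>2) has_real_derivative dPhi s) (at s)"
  proof -
    have "((\<lambda>y. y * (1 - y)\<^sup>2) has_real_derivative (1 - th s) * (1 - 3 * th s)) (at (th s))"
      by (auto intro!: derivative_eq_intros simp: power2_eq_square algebra_simps)
    from DERIV_chain2[OF this th_deriv[OF assms]]
    have "((\<lambda>s. th s * (1 - th s)\<^sup>2) has_real_derivative
        (1 - th s) * (1 - 3 * th s) * (exp (th s) / (1 - th s))) (at s)" .
    moreover have "(1 - th s) * (1 - 3 * th s) * (exp (th s) / (1 - th s)) = dPhi s"
      using t assms by (simp add: dPhi_def)
    ultimately show ?thesis by simp
  qed
  thus ?thesis
    by (rule DERIV_cong_ev[THEN iffD1, rotated -1])
       (use eventually_nhds_in_open[of "{..<exp (-1)}" s] assms in \<open>auto elim!: eventually_mono simp: Phi_def\<close>)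
qed

lemma Phi_deriv_gt: assumes "s > exp (-1)" shows "(Phi has_real_derivative dPhi s) (at s)"
proof -
  have "s > 0" using assms exp_gt_zero[of "-1::real"] by linarith
  hence "((\<lambda>s. - 2 * (ln s + 1)) has_real_derivative dPhi s) (at s)"
    using assms by (auto intro!: derivative_eq_intros simp: dPhi_def)
  thus ?thesis
    by (rule DERIV_cong_ev[THEN iffD1, rotated -1])
       (use eventually_nhds_in_open[of "{exp (-1)<..}" s] assms in \<open>auto elim!: eventually_mono simp: Phi_def\<close>)
qed

lemma continuous_glue:
  fixes f g :: "real \<Rightarrow> real"
  assumes "continuous_on UNIV f" "continuous_on {a..} g" "f a = g a"
  shows "continuous_on UNIV (\<lambda>s. if s \<le> a then f s else g s)"
proof -
  have "continuous_on ({..a} \<union> {a..}) (\<lambda>s. if s \<le> a then f s else g s)"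
    by (rule continuous_on_If) (use assms in \<open>auto elim: continuous_on_subset\<close>)
  moreover have "{..a} \<union> {a..} = UNIV" by auto
  ultimately show ?thesis by simp
qed

lemma continuous_th: "continuous_on UNIV th"
  using th_cont continuous_at_imp_continuous_on by blast

lemma continuous_Phi: "continuous_on UNIV Phi"
  unfolding Phi_def[abs_def]
  by (rule continuous_glue) (auto intro!: continuous_intros continuous_th simp: th_exp1)

lemma continuous_dPhi: "continuous_on UNIV dPhi"
  unfolding dPhi_def[abs_def]
proof (rule continuous_glue)
  show "exp (th (exp (-1))) * (1 - 3 * th (exp (-1))) = - 2 / exp (-1::real)"
    unfolding th_exp1 by (simp add: exp_minus field_simps)
qed (auto intro!: continuous_intros continuous_th)

text \<open>At 1/e the chain rule fails because \<open>th\<close> has infinite left slope there.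
  Instead, \<open>Phi\<close> minus an antiderivative of the continuous \<open>dPhi\<close> is
  continuous with zero derivative off one point, hence constant.\<close>

lemma Phi_deriv: "(Phi has_real_derivative dPhi s) (at s)"
proof -
  obtain G where G: "\<And>r. (G has_real_derivative dPhi r) (at r)"
    using einterval_antiderivative[of "-\<infinity>" "\<infinity>" dPhi] continuous_dPhi
    by (auto simp: has_real_derivative_iff_has_vector_derivative continuous_on_eq_continuous_at)
  have cG: "continuous_on UNIV G" using G DERIV_isCont continuous_at_imp_continuous_on by blast
  have "Phi x - G x = Phi 0 - G 0" for x
  proof (rule has_derivative_zero_unique_strong_convex[of UNIV "{exp (-1)}" "\<lambda>x. Phi x - G x" 0])
    show "continuous_on UNIV (\<lambda>x. Phi x - G x)" by (intro continuous_intros continuous_Phi cG)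
    fix x :: real assume "x \<in> UNIV - {exp (-1)}"
    hence "(Phi has_real_derivative dPhi x) (at x)" using Phi_deriv_lt Phi_deriv_gt by (cases x "exp (-1) :: real" rule: linorder_cases) auto
    from DERIV_diff[OF this G] show "((\<lambda>x. Phi x - G x) has_derivative (\<lambda>h. 0)) (at x within UNIV)"
      by (simp add: has_field_derivative_def lambda_zero)
  qed auto
  hence "Phi = (\<lambda>x. G x + (Phi 0 - G 0))" by (simp add: fun_eq_iff algebra_simps)
  moreover have "((\<lambda>x. G x + (Phi 0 - G 0)) has_real_derivative dPhi s) (at s)"
    using G by (auto intro!: derivative_eq_intros)
  ultimately show ?thesis by simp
qed

text \<open>With y = \<open>th (exp x)\<close> the derivative is y (1 - 3 y) + 2 = (1 - y) (3 y +
  2), nonnegative on [0, 1]; beyond 1/e it is 0.\<close>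

lemma Phi_mono: assumes "v \<le> w" shows "Phi (exp v) + 2 * v \<le> Phi (exp w) + 2 * w"
proof (rule DERIV_nonneg_imp_nondecreasing[OF assms])
  fix x
  have "((\<lambda>x. Phi (exp x)) has_real_derivative dPhi (exp x) * exp x) (at x)"
    by (rule DERIV_chain2[OF Phi_deriv]) (rule DERIV_exp)
  hence D: "((\<lambda>x. Phi (exp x) + 2 * x) has_real_derivative dPhi (exp x) * exp x + 2) (at x)"
    by (auto intro!: derivative_eq_intros)
  have "dPhi (exp x) * exp x + 2 \<ge> 0"
  proof (cases "exp x \<le> exp (-1 :: real)")
    case True
    define y where "y = th (exp x)"
    have y: "0 \<le> y" "y \<le> 1" "exp x = y * exp (- y)"
      unfolding y_def using th_nonneg[of "exp x"] th_le_1 th_inv[OF True] by auto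
    have "dPhi (exp x) * exp x + 2 = exp y * (1 - 3 * y) * (y * exp (- y)) + 2"
      unfolding y(3)[symmetric] using True by (simp only: dPhi_def y_def if_True)
    also have "\<dots> = (1 - y) * (3 * y + 2)" by (simp add: exp_minus algebra_simps)
    also have "\<dots> \<ge> 0" using y by (intro mult_nonneg_nonneg) auto
    finally show ?thesis .
  qed (simp add: dPhi_def)
  thus "\<exists>y. ((\<lambda>x. Phi (exp x) + 2 * x) has_real_derivative y) (at x) \<and> 0 \<le> y" using D by blast
qed

section \<open>Bounds and regularity of the nonlinearity\<close>

lemma Phi_exp1: "Phi (exp (-1)) = 0"
  by (simp add: Phi_def th_exp1)

text \<open>Monotonicity compared with the point v = -1, where \<open>Phi\<close> vanishes:
  \<open>Phi\<close> lies below its own linear continuation.\<close>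

lemma Phi_le_ln: assumes "s > 0" shows "Phi s \<le> - 2 * (ln s + 1)"
proof (cases "s \<le> exp (-1)")
  case True
  hence "ln s \<le> -1" using assms by (metis ln_exp ln_mono exp_gt_zero)
  from Phi_mono[OF this] show ?thesis using assms by (simp add: Phi_exp1)
qed (simp add: Phi_def)

text \<open>The maximum of y (1 - y)^2 is taken at y = 1/3, and the difference to it factors as (y -
  1/3)^2 (4/3 - y). This is the origin of the 27 in the bound for the critical value.\<close>

lemma Phi_le: "0 \<le> s \<Longrightarrow> Phi s \<le> 4 / 27"
proof (cases "s \<le> exp (-1)")
  case True assume "0 \<le> s"
  have "0 \<le> (th s - 1 / 3)\<^sup>2 * (4 / 3 - th s)" using th_le_1[of s] by (intro mult_nonneg_nonneg) auto
  also have "\<dots> = 4 / 27 - th s * (1 - th s)\<^sup>2" by (simp add: power2_eq_square algebra_simps)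
  finally show ?thesis using True by (simp add: Phi_def)
next
  case False
  hence "ln s > -1" using exp_gt_zero[of "-1::real"] by (metis ln_exp ln_less_cancel_iff less_trans not_le)
  thus ?thesis using False by (simp add: Phi_def)
qed

text \<open>From y = exp y times s with y \<le> 1. Linear decay at 0 prevents solutions from
  drifting to minus infinity.\<close>

lemma Phi_le_linear: assumes "0 \<le> s" shows "Phi s \<le> exp 1 * s"
proof (cases "s \<le> exp (-1)")
  case True
  have "Phi s = th s * (1 - th s)\<^sup>2" using True by (simp add: Phi_def)
  also have "\<dots> \<le> th s * 1" using th_nonneg[OF assms] th_le_1[of s]
    by (intro mult_left_mono power_le_one) auto
  also have "th s = exp (th s) * (th s * exp (- th s))" by (simp add: exp_minus)
  also have "\<dots> * 1 \<le> exp 1 * s"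
    unfolding th_inv[OF True] mult_1_right using th_le_1[of s] assms by (intro mult_right_mono) auto
  finally show ?thesis .
next
  case False
  hence "ln s > -1" using exp_gt_zero[of "-1::real"] by (metis ln_exp ln_less_cancel_iff less_trans not_le)
  hence "Phi s \<le> 0" using False by (simp add: Phi_def)
  also have "0 \<le> exp 1 * s" using assms by simp
  finally show ?thesis .
qed

lemma Phi_pos: "0 < s \<Longrightarrow> s < exp (-1) \<Longrightarrow> 0 < Phi s"
  using th_pos[of s] th_lt_1[of s] by (simp add: Phi_def)

lemma Phi_nonneg: "0 \<le> s \<Longrightarrow> s \<le> exp (-1) \<Longrightarrow> 0 \<le> Phi s"
  using th_nonneg[of s] by (simp add: Phi_def)

text \<open>The threshold is the value of y exp (- y) at y = 1/3, up to which y (1 - y)^2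
  increases.\<close>

lemma Phi_increasing:
  assumes "0 \<le> s" "s \<le> r" "r \<le> exp (- (1 / 3)) / 3"
  shows "Phi s \<le> Phi r"
proof (rule DERIV_nonneg_imp_nondecreasing[OF assms(2)])
  fix x assume x: "s \<le> x" "x \<le> r"
  have b: "exp (- (1 / 3)) / 3 < exp (-1 :: real)"
    using yexp_strict[of "1/3" 1] by simp
  hence x1: "x \<le> exp (-1)" using x assms(3) by linarith
  have "th x \<le> 1 / 3" using less_th_iff[OF x1, of "1/3"] x assms(3) by simp
  thus "\<exists>y. (Phi has_real_derivative y) (at x) \<and> 0 \<le> y"
    using x1 by (intro exI[of _ "dPhi x"] conjI Phi_deriv) (simp add: dPhi_def)
qed

text \<open>The derivative of \<open>th\<close> blows up at 1/e, so strictness of solutions has to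
  be established before their smoothness.\<close>

lemma Ck_th:
  assumes "open S" "Ck_on k S f" "\<And>x. x \<in> S \<Longrightarrow> f x < exp (-1)"
  shows "Ck_on k S (\<lambda>x. th (f x))"
  using assms(2)
proof (induction k)
  case 0 thus ?case by (auto intro: continuous_on_compose2[OF continuous_th])
next
  case (Suc k)
  have IH: "Ck_on k S (\<lambda>x. th (f x))" by (rule Suc.IH[OF Ck_on_SucD[OF Suc.prems]])
  have nz: "1 - th (f x) \<noteq> 0" if "x \<in> S" for x using th_lt_1[OF assms(3)[OF that]] by simp
  note D = Suc.prems[unfolded Ck_on_Suc_iff[OF assms(1)]]
  have p: "pd (\<lambda>x. th (f x)) (exp (th (f x)) / (1 - th (f x)) * dx f x) (exp (th (f x)) / (1 - th (f x)) * dy f x) x"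
    if "x \<in> S" for x
    by (rule pd_compose[OF pd_frechet th_deriv]) (use D that assms(3) in auto)
  have "Ck_on k S (\<lambda>x. exp (th (f x)) * inverse (1 - th (f x)))"
    by (intro Ck_on_mult Ck_on_exp Ck_on_inverse Ck_on_diff Ck_on_const IH nz)
  hence c: "Ck_on k S (\<lambda>x. exp (th (f x)) / (1 - th (f x)))" by (simp add: divide_inverse)
  show ?case by (rule Ck_on_SucI[OF p Ck_on_mult[OF c] Ck_on_mult[OF c]]) (use D in simp_all)
qed

lemma C1_Phi:
  assumes "open S" "Ck_on (Suc 0) S f"
  shows "Ck_on (Suc 0) S (\<lambda>x. Phi (f x))"
proof -
  note D = assms(2)[unfolded Ck_on_Suc_iff[OF assms(1)]]
  have p: "pd (\<lambda>x. Phi (f x)) (dPhi (f x) * dx f x) (dPhi (f x) * dy f x) x" if "x \<in> S" for x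
    by (rule pd_compose[OF pd_frechet Phi_deriv]) (use D that in auto)
  have c: "Ck_on 0 S (\<lambda>x. dPhi (f x))"
    using Ck_on_imp_continuous[OF assms(2)] by (auto intro: continuous_on_compose2[OF continuous_dPhi])
  show ?thesis by (rule Ck_on_SucI[OF p Ck_on_mult Ck_on_mult]) (use c D in auto)
qed

section \<open>The reduced equation\<close>

lemma av_tendsto_countable:
  assumes d: "d > 0" and f: "\<And>n. continuous_on UNIV (f n)" "continuous_on UNIV g"
    and B: "\<And>n x. \<bar>f n x\<bar> \<le> B" and C: "countable C" and lim: "\<And>x. x \<notin> C \<Longrightarrow> (\<lambda>n. f n x) \<longlonglongrightarrow> g x"
  shows "(\<lambda>n. av d (f n) x) \<longlonglongrightarrow> av d g x"
  unfolding wav_def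
proof (rule integral_dominated_convergence[where w = "\<lambda>z. B * \<bar>fst z\<bar>"])
  have [measurable]: "fst \<in> borel_measurable hg" using integrable_hg_fst by simp
  note [measurable] = cont_measurable_pos[OF f(1)] cont_measurable_pos[OF f(2)]
  show "(\<lambda>z. fst z * g (pos d x z)) \<in> borel_measurable hg" by measurable
  show "(\<lambda>z. fst z * f n (pos d x z)) \<in> borel_measurable hg" for n by measurable
  show "integrable hg (\<lambda>z. B * \<bar>fst z\<bar>)" using integrable_hg_fst by (intro integrable_cm) auto
  show "AE z in hg. (\<lambda>n. fst z * f n (pos d x z)) \<longlonglongrightarrow> fst z * g (pos d x z)"
    using AE_pos_notin_countable[OF d C, of x]
    by (rule eventually_mono) (intro tendsto_intros lim)
  show "AE z in hg. norm (fst z * f n (pos d x z)) \<le> B * \<bar>fst z\<bar>" for n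
  proof (intro AE_I2)
    fix z
    have "\<bar>fst z\<bar> * \<bar>f n (pos d x z)\<bar> \<le> \<bar>fst z\<bar> * B" by (intro mult_left_mono B) simp
    thus "norm (fst z * f n (pos d x z)) \<le> B * \<bar>fst z\<bar>" by (simp add: abs_mult mult.commute)
  qed
qed

text \<open>Raising the parameter pays for a perturbation of the argument. For small s a larger
  argument only increases \<open>Phi\<close>; on the remaining compact range \<open>Phi\<close> has
  a positive minimum, and the loss allowed by uniform continuity is at most the gain (l2 - l1)
  \<open>Phi s\<close>. The perturbed argument may pass 1/e.\<close>

lemma Phi_perturb:
  assumes l: "0 < l1" "l1 < l2" and S: "S < exp (-1)" and Bb: "0 \<le> Bb"
  shows "\<exists>e>0. \<forall>s b. 0 \<le> s \<and> s \<le> S \<and> 0 \<le> b \<and> b \<le> Bb \<longrightarrow> l1 * Phi s \<le> l2 * Phi (s + e * b)"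
proof -
  define h where "h = exp (- (1 / 3)) / (3::real)"
  have h: "0 < h" "h < exp (-1)" unfolding h_def using yexp_strict[of "1/3" 1] by simp_all
  \<comment> \<open>The maximum with h / 2 keeps the interval on which \<open>Phi\<close> is
    minimized nonempty, still below 1/e.\<close>
  define S' where "S' = max S (h / 2)"
  have S': "S' < exp (-1)" "h / 2 \<le> S'" "S \<le> S'" using S h by (auto simp: S'_def)
  obtain z where z: "z \<in> {h/2..S'}" "\<And>y. y \<in> {h/2..S'} \<Longrightarrow> Phi z \<le> Phi y"
    using continuous_attains_inf[of "{h/2..S'}" Phi] S' continuous_on_subset[OF continuous_Phi] by auto
  have mu: "Phi z > 0" using z(1) h S' by (intro Phi_pos) auto
  \<comment> \<open>Admissible loss: \<open>l2 * k\<close> equals l2 - l1 times the minimum of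
    \<open>Phi\<close>.\<close>
  define k where "k = (l2 - l1) / l2 * Phi z"
  have k: "k > 0" unfolding k_def using l mu by simp
  have "uniformly_continuous_on {0..S' + 1} Phi"
    by (intro compact_uniformly_continuous continuous_on_subset[OF continuous_Phi]) auto
  then obtain d where d: "d > 0" "\<And>x y. x \<in> {0..S' + 1} \<Longrightarrow> y \<in> {0..S' + 1} \<Longrightarrow> dist y x < d \<Longrightarrow> dist (Phi y) (Phi x) < k"
    unfolding uniformly_continuous_on_def using k by blast
  define m where "m = min d (min (h / 2) 1)"
  have m: "m > 0" "m \<le> d" "m \<le> h / 2" "m \<le> 1" using d h by (auto simp: m_def)
  define e where "e = m / (Bb + 1)"
  have e: "e > 0" using m Bb by (simp add: e_def)
  show ?thesis
  proof (intro exI[of _ e] conjI e allI impI)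
    fix s b assume a: "0 \<le> s \<and> s \<le> S \<and> 0 \<le> b \<and> b \<le> Bb"
    have eb: "0 \<le> e * b" "e * b < m"
    proof -
      show "0 \<le> e * b" using e a by simp
      have "e * b < e * (Bb + 1)" using a e by (intro mult_strict_left_mono) auto
      thus "e * b < m" using Bb by (simp add: e_def)
    qed
    have Ps: "Phi s \<ge> 0" using a S by (intro Phi_nonneg) auto
    show "l1 * Phi s \<le> l2 * Phi (s + e * b)"
    proof (cases "s \<le> h / 2")
      case True
      have "Phi s \<le> Phi (s + e * b)"
        by (rule Phi_increasing) (use a eb m True in \<open>auto simp: h_def[symmetric]\<close>)
      hence "l2 * Phi s \<le> l2 * Phi (s + e * b)" using l by simp
      moreover have "l1 * Phi s \<le> l2 * Phi s" using l Ps by (intro mult_right_mono) auto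
      ultimately show ?thesis by linarith
    next
      case False
      have "dist (Phi (s + e * b)) (Phi s) < k"
        by (rule d(2)) (use a eb m S' in \<open>auto simp: dist_real_def\<close>)
      hence "Phi (s + e * b) \<ge> Phi s - k" by (simp add: dist_real_def)
      hence "l2 * Phi (s + e * b) \<ge> l2 * Phi s - l2 * k" using l
        by (metis mult_left_mono right_diff_distrib less_imp_le less_trans)
      moreover have "l2 * k = (l2 - l1) * Phi z" using l by (simp add: k_def)
      moreover have "(l2 - l1) * Phi z \<le> (l2 - l1) * Phi s"
        using z(2)[of s] False a S' l by (intro mult_left_mono) auto
      ultimately show ?thesis by (simp add: algebra_simps)
    qed
  qed
qed

lemma exp_minus_one_le: "exp v - 1 \<le> exp v * (v::real)"
proof -
  have "exp v * (1 + - v) \<le> exp v * exp (- v)" by (intro mult_left_mono exp_ge_add_one_self) simp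
  thus ?thesis by (simp add: exp_minus algebra_simps)
qed

text \<open>The reduced equation for an arbitrary weight \<open>P\<close> in the role of exp v_0,
  since comparing two data involves two weights at once. \<open>P_zero\<close> excludes, in the
  strictness argument, that P exp g is constantly 1/e.\<close>

locale weight = torus +
  fixes P :: "complex \<Rightarrow> real" and c :: real
  assumes P_Ck: "\<And>k. Ck_on k UNIV P" and P_per: "per P" and P_nonneg: "\<And>x. 0 \<le> P x"
    and P_countable: "countable {x. P x = 0}"
    and P_lap: "\<And>x. 0 < P x \<Longrightarrow> laplacian (\<lambda>x. ln (P x)) x = - c"
    and P_zero: "\<exists>x. P x = 0" and c_pos: "c > 0"
begin

definition Fs :: "real \<Rightarrow> (complex \<Rightarrow> real) \<Rightarrow> complex \<Rightarrow> real" where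
  "Fs lam g x = lam * Phi (P x * exp (g x)) - c"

definition rsol :: "real \<Rightarrow> (complex \<Rightarrow> real) \<Rightarrow> bool" where
  "rsol lam g \<longleftrightarrow> per g \<and> Ck_on 2 UNIV g \<and> (\<forall>x. laplacian g x = - Fs lam g x)"

lemma P_cont: "continuous_on UNIV P" using P_Ck[of 0] by simp

lemma Fs_per: "per g \<Longrightarrow> per (Fs lam g)"
  using P_per unfolding doubly_periodic_def Fs_def by simp

lemma Fs_cont: "continuous_on UNIV g \<Longrightarrow> continuous_on UNIV (Fs lam g)"
  unfolding Fs_def[abs_def]
  by (intro continuous_intros continuous_on_compose2[OF continuous_Phi] P_cont) auto

definition NN :: "real \<Rightarrow> real \<Rightarrow> (complex \<Rightarrow> real) \<Rightarrow> complex \<Rightarrow> real" where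
  "NN d lam g x = g x + d\<^sup>2 * Fs lam g x"

lemma NN_per: "per g \<Longrightarrow> per (NN d lam g)"
  using Fs_per[of g lam] unfolding doubly_periodic_def NN_def by simp

lemma NN_cont: "continuous_on UNIV g \<Longrightarrow> continuous_on UNIV (NN d lam g)"
  unfolding NN_def[abs_def] by (intro continuous_intros Fs_cont)

lemma NN_bdd: "per g \<Longrightarrow> continuous_on UNIV g \<Longrightarrow> bdd (NN d lam g)"
  by (intro per_bdd NN_per NN_cont)

lemma av_minus_laplacian:
  assumes "per g" "Ck_on 2 UNIV g"
  shows "av d (\<lambda>x. g x - d\<^sup>2 * laplacian g x) x = g x"
proof -
  have b: "bdd g" by (rule C1_per(2)[OF assms(1) C2_C1[OF assms(2)]])
  have bl: "bdd (laplacian g)" by (rule C2_per(5)[OF assms])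
  have "bdd (\<lambda>x. d\<^sup>2 * laplacian g x)"
    by (intro per_bdd continuous_intros continuous_on_laplacian[OF assms(2) open_UNIV])
       (use per_laplacian[OF assms(1)] in \<open>simp add: doubly_periodic_def\<close>)
  from wav_diff[OF integrable_hg_fst b this, of d x] show ?thesis
    unfolding wav_cmult av_id[OF assms, of d x] by simp
qed

lemma rsol_mild: assumes "rsol lam g" shows "g x = av d (NN d lam g) x"
proof -
  have a: "per g" "Ck_on 2 UNIV g" "\<And>x. laplacian g x = - Fs lam g x" using assms unfolding rsol_def by auto
  have "NN d lam g = (\<lambda>x. g x - d\<^sup>2 * laplacian g x)" by (simp add: fun_eq_iff NN_def a(3))
  thus ?thesis using av_minus_laplacian[OF a(1,2)] by simp
qed

section \<open>Maximum principle and regularity for the reduced equation\<close>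

lemma countable_zero: "countable (- {x. 0 < P x})"
proof -
  have "- {x. 0 < P x} = {x. P x = 0}" using P_nonneg by (auto simp: not_less intro: antisym)
  thus ?thesis using P_countable by simp
qed

lemma open_P_pos: "open {x. 0 < P x}"
  by (intro open_Collect_less P_cont continuous_intros)

lemma P_pos_ex: "\<exists>x. 0 < P x"
proof (rule ccontr)
  assume "\<not> ?thesis"
  hence "- {x. 0 < P x} = UNIV" by auto
  hence "countable (ball (0::complex) 1)" using countable_zero countable_subset by (metis top_greatest)
  thus False using uncountable_ball[of 1 "0::complex"] by simp
qed

text \<open>With \<open>V = ln P + g + 1\<close>, the function \<open>\<xi> = 1 - e\<^sup>V\<close> satisfies \<open>\<Delta> \<xi> \<le> 2 \<lambda> \<xi>\<close> everywhere,
  so it is positive by positivity of the averaging operator.\<close>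

lemma rsol_strict:
  assumes r: "rsol lam g" and lam: "lam > 0"
  shows "P x * exp (g x) < exp (-1)"
proof -
  have g: "per g" "Ck_on 2 UNIV g" "\<And>x. laplacian g x = - Fs lam g x" using r unfolding rsol_def by auto
  define xi where "xi x = 1 - exp 1 * (P x * exp (g x))" for x
  have C: "Ck_on 2 UNIV xi" unfolding xi_def[abs_def]
    by (intro Ck_on_diff Ck_on_const Ck_on_cmult Ck_on_mult Ck_on_exp P_Ck g)
  have per: "per xi" using g(1) P_per unfolding xi_def doubly_periodic_def by simp
  let ?S = "{x. 0 < P x}"
  have pos: "laplacian xi x \<le> 2 * lam * xi x" if x: "x \<in> ?S" for x
  proof -
    let ?V = "\<lambda>x. ln (P x) + (g x + 1)"
    have CP: "Ck_on 2 ?S (\<lambda>x. ln (P x))" by (intro Ck_on_ln Ck_on_subset[OF P_Ck]) auto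
    have Cg: "Ck_on 2 ?S g" by (rule Ck_on_subset[OF g(2)]) simp
    have Cg1: "Ck_on 2 ?S (\<lambda>x. g x + 1)" by (intro Ck_on_add Cg Ck_on_const)
    have CV: "Ck_on 2 ?S ?V" by (intro Ck_on_add CP Cg1)
    have s: "P x * exp (g x) = exp (?V x - 1)" using x by (simp add: exp_add)
    have "laplacian ?V x = - c + (laplacian g x + 0)"
      unfolding laplacian_add[OF CP Cg1 open_P_pos x] laplacian_add[OF Cg Ck_on_const open_P_pos x]
      using P_lap[of x] x by (simp add: laplacian_const)
    also have "\<dots> = - lam * Phi (P x * exp (g x))" by (simp add: g(3) Fs_def)
    finally have lapV: "laplacian ?V x = - lam * Phi (P x * exp (g x))" .
    have "Phi (P x * exp (g x)) \<le> - 2 * ?V x" using Phi_le_ln[of "exp (?V x - 1)"] s by simp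
    hence "lam * Phi (P x * exp (g x)) \<le> lam * (- 2 * ?V x)" using lam by (intro mult_left_mono) auto
    \<comment> \<open>\<open>Phi\<close> has been replaced by its linear majorant, which leaves a
      linear differential inequality for V.\<close>
    hence 1: "laplacian ?V x \<ge> 2 * lam * ?V x" unfolding lapV by (simp add: algebra_simps)
    have "laplacian xi x = laplacian (\<lambda>x. 1 - exp (?V x)) x"
      by (rule laplacian_cong_open[OF open_P_pos x]) (simp add: xi_def exp_add mult_ac)
    also have "\<dots> = 0 - laplacian (\<lambda>x. exp (?V x)) x"
      unfolding laplacian_diff[OF Ck_on_const Ck_on_exp[OF CV] open_P_pos x] laplacian_const ..
    also have "laplacian (\<lambda>x. exp (?V x)) x = exp (?V x) * laplacian ?V x + exp (?V x) * grad_sq ?V x"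
      by (rule laplacian_compose[OF CV open_P_pos x, where \<psi> = exp and \<psi>' = exp]) (rule DERIV_exp)+
    finally have e: "laplacian xi x = - (exp (?V x) * laplacian ?V x + exp (?V x) * grad_sq ?V x)" by simp
    have "exp (?V x) * (2 * lam * ?V x) \<le> exp (?V x) * laplacian ?V x" using 1 by (intro mult_left_mono) auto
    moreover have "0 \<le> exp (?V x) * grad_sq ?V x" by (simp add: grad_sq_def)
    \<comment> \<open>Convexity of exp turns the inequality for V into one for \<open>xi\<close>,
      which unlike V is smooth at the zeros of \<open>P\<close>.\<close>
    moreover have "2 * lam * (exp (?V x) - 1) \<le> exp (?V x) * (2 * lam * ?V x)"
    proof -
      have "exp (?V x) - 1 \<le> exp (?V x) * ?V x" by (rule exp_minus_one_le)
      hence "2 * lam * (exp (?V x) - 1) \<le> 2 * lam * (exp (?V x) * ?V x)" using lam by (intro mult_left_mono) auto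
      thus ?thesis by (simp only: mult_ac)
    qed
    ultimately have "laplacian xi x \<le> 2 * lam * (1 - exp (?V x))" unfolding e by (simp add: algebra_simps)
    also have "1 - exp (?V x) = xi x" using x by (simp add: xi_def exp_add mult_ac)
    finally show ?thesis .
  qed
  have all: "laplacian xi x \<le> 2 * lam * xi x" for x
    by (rule le_if_le_off_countable[OF continuous_on_laplacian[OF C open_UNIV] _ countable_zero pos])
       (intro continuous_intros Ck_on_imp_continuous[OF C])
  define d where "d = 1 / sqrt (2 * lam)"
  have d: "d > 0" "d\<^sup>2 = 1 / (2 * lam)" unfolding d_def using lam by (simp_all add: power_divide)
  let ?z = "\<lambda>x. xi x - d\<^sup>2 * laplacian xi x"
  have z0: "0 \<le> ?z x" for x using all[of x] lam unfolding d(2) by (simp add: field_simps)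
  have bz: "bdd ?z"
  proof (rule per_bdd)
    show "per ?z" using per per_laplacian[OF per] unfolding doubly_periodic_def by simp
    show "continuous_on UNIV ?z"
      by (intro continuous_intros Ck_on_imp_continuous[OF C] continuous_on_laplacian[OF C open_UNIV])
  qed
  have eq: "av d ?z x = xi x" for x by (rule av_minus_laplacian[OF per C])
  have b0: "bdd (\<lambda>_. 0)" unfolding bdd_def by auto
  have ge: "xi x \<ge> 0" using av_mono[OF b0 bz z0, of d x] unfolding eq av_const .
  \<comment> \<open>A zero of \<open>xi\<close> would force \<open>xi\<close> to vanish identically
    by the strong maximum principle, but \<open>xi\<close> is 1 at the zeros of
    \<open>P\<close>.\<close>
  have "xi x \<noteq> 0"
  proof
    assume x0: "xi x = 0"
    have "?z y = 0" for y by (rule av_strict[OF bz z0 d(1) eq[of x, unfolded x0]])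
    hence "av d ?z y = av d (\<lambda>_. 0) y" for y unfolding wav_def by simp
    hence "xi y = 0" for y unfolding eq av_const .
    moreover obtain y where "P y = 0" using P_zero by blast
    hence "xi y = 1" by (simp add: xi_def)
    ultimately show False by simp
  qed
  hence "exp 1 * (P x * exp (g x)) < 1" using ge by (simp add: xi_def)
  thus ?thesis by (simp add: exp_minus field_simps)
qed

lemma Fs_Ck:
  assumes "Ck_on k UNIV g" "\<And>x. P x * exp (g x) < exp (-1)"
  shows "Ck_on k UNIV (Fs lam g)"
proof -
  have C: "Ck_on k UNIV (\<lambda>x. th (P x * exp (g x)))"
    by (intro Ck_th Ck_on_mult Ck_on_exp P_Ck assms open_UNIV)
  have "Fs lam g = (\<lambda>x. lam * (th (P x * exp (g x)) * (1 - th (P x * exp (g x)))\<^sup>2) - c)"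
    using assms(2) by (simp add: fun_eq_iff Fs_def Phi_def less_imp_le)
  thus ?thesis by (simp only:) (intro Ck_on_diff Ck_on_cmult Ck_on_mult Ck_on_power Ck_on_const C)
qed

text \<open>Bootstrap: strictness makes the right-hand side as smooth as g, and the average adds one
  derivative.\<close>

lemma rsol_smooth:
  assumes r: "rsol lam g" and lam: "lam > 0"
  shows "Ck_on k UNIV g"
proof (induction k)
  case 0
  show ?case using r unfolding rsol_def by (auto intro: Ck_on_imp_continuous)
next
  case (Suc k)
  have "Ck_on k UNIV (NN 1 lam g)" unfolding NN_def[abs_def]
    by (intro Ck_on_add Ck_on_cmult Suc Fs_Ck rsol_strict[OF r lam])
  moreover have "per (NN 1 lam g)" using r by (intro NN_per) (simp add: rsol_def)
  ultimately have "Ck_on (Suc k) UNIV (av 1 (NN 1 lam g))" by (intro av_Ck) auto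
  moreover have "av 1 (NN 1 lam g) = g" using rsol_mild[OF r, of _ 1] by (simp add: fun_eq_iff)
  ultimately show ?case by simp
qed

text \<open>Two gains of a derivative: continuity of \<open>NN\<close> makes g C^1; then
  \<open>NN\<close> is C^1, as \<open>Phi\<close> is C^1 across 1/e, and g is C^2. Strictness
  presupposes \<open>rsol\<close>, so smoothness of \<open>th\<close> cannot be invoked at this
  stage.\<close>

lemma mild_rsol:
  assumes g: "per g" "continuous_on UNIV g" and d: "d > 0" and m: "\<And>x. g x = av d (NN d lam g) x"
  shows "rsol lam g"
proof -
  have e: "g = av d (NN d lam g)" using m by (simp add: fun_eq_iff)
  have p: "per (NN d lam g)" by (rule NN_per[OF g(1)])
  have "Ck_on 0 UNIV (NN d lam g)" using NN_cont[OF g(2)] by simp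
  from av_Ck[OF p this d] have g1: "Ck_on (Suc 0) UNIV g" using e by simp
  have s1: "Ck_on (Suc 0) UNIV (\<lambda>x. P x * exp (g x))" by (intro Ck_on_mult Ck_on_exp P_Ck g1)
  have N1: "Ck_on (Suc 0) UNIV (NN d lam g)" unfolding NN_def[abs_def] Fs_def[abs_def]
    by (intro Ck_on_add Ck_on_cmult Ck_on_diff Ck_on_const g1 C1_Phi[OF open_UNIV s1])
  from av_Ck[OF p this d] have "Ck_on (Suc (Suc 0)) UNIV g" using e by simp
  hence g2: "Ck_on 2 UNIV g" by (simp only: numeral_2_eq_2)
  have "laplacian g x = - Fs lam g x" for x
  proof -
    have "laplacian (av d (NN d lam g)) x = (av d (NN d lam g) x - NN d lam g x) / d\<^sup>2"
      by (rule laplacian_av[OF p N1 d])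
    hence "laplacian g x = (g x - NN d lam g x) / d\<^sup>2" using e by simp
    thus ?thesis using d by (simp add: NN_def)
  qed
  thus ?thesis unfolding rsol_def using g(1) g2 by blast
qed

text \<open>If \<open>Fs\<close> were negative, the maximum of g, being an average of g +
  \<open>Fs\<close>, would lie strictly below itself.\<close>

lemma rsol_ex_ge:
  assumes r: "rsol lam g" shows "\<exists>x. lam * Phi (P x * exp (g x)) \<ge> c"
proof (rule ccontr)
  assume "\<not> ?thesis"
  hence neg: "Fs lam g x < 0" for x by (simp add: Fs_def not_le)
  have g: "per g" "continuous_on UNIV g" using r unfolding rsol_def by (auto intro: Ck_on_imp_continuous)
  obtain z where z: "\<And>x. Fs lam g x \<le> Fs lam g z" by (rule per_attains_max[OF Fs_per[OF g(1)] Fs_cont[OF g(2)]]) blast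
  obtain y where y: "\<And>x. g x \<le> g y" by (rule per_attains_max[OF g]) blast
  have b: "bdd (\<lambda>_. g y + Fs lam g z)" unfolding bdd_def by auto
  have "NN 1 lam g x \<le> g y + Fs lam g z" for x using y[of x] z[of x] by (simp add: NN_def)
  from av_mono[OF NN_bdd[OF g] b this, of 1 y] have "g y \<le> g y + Fs lam g z"
    unfolding av_const using rsol_mild[OF r, of y 1] by simp
  thus False using neg[of z] by simp
qed

lemma rsol_lower_bound:
  assumes r: "rsol lam g" and lam: "lam > 0" shows "27 * c / 4 \<le> lam"
proof -
  obtain x where x: "lam * Phi (P x * exp (g x)) \<ge> c" using rsol_ex_ge[OF r] by blast
  have "lam * Phi (P x * exp (g x)) \<le> lam * (4 / 27)"
    using lam P_nonneg[of x] by (intro mult_left_mono Phi_le) auto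
  thus ?thesis using x by simp
qed

section \<open>Monotone iteration and existence for large parameters\<close>

lemma NN_half:
  assumes lam: "lam > 0" and d: "d\<^sup>2 = 1 / (2 * lam)"
  shows "NN d lam g x = (Phi (P x * exp (g x)) + 2 * g x) / 2 - c / (2 * lam)"
  unfolding NN_def Fs_def d using lam by (simp add: field_simps)

lemma NN_mono:
  assumes lam: "lam > 0" and d: "d\<^sup>2 = 1 / (2 * lam)" and le: "g x \<le> h x"
  shows "NN d lam g x \<le> NN d lam h x"
proof -
  have "Phi (P x * exp (g x)) + 2 * g x \<le> Phi (P x * exp (h x)) + 2 * h x"
  proof (cases "P x = 0")
    case False
    hence p: "P x > 0" using P_nonneg[of x] by simp
    have e: "P x * exp t = exp (ln (P x) + t)" for t using p by (simp add: exp_add)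
    show ?thesis using Phi_mono[of "ln (P x) + g x" "ln (P x) + h x"] le unfolding e by simp
  qed (use le in simp)
  thus ?thesis unfolding NN_half[OF lam d] by simp
qed

lemma NN_le:
  assumes lam: "lam > 0" and d: "d\<^sup>2 = 1 / (2 * lam)"
  shows "NN d lam g x \<le> g x + 1"
proof -
  have "Phi (P x * exp (g x)) \<le> 4 / 27" by (intro Phi_le mult_nonneg_nonneg P_nonneg) simp
  moreover have "c / (2 * lam) \<ge> 0" using lam c_pos by simp
  ultimately show ?thesis unfolding NN_half[OF lam d] by argo
qed

text \<open>Where ln P + g > -1 the slope -2 of \<open>Phi\<close> cancels the term 2 g exactly, so
  the bound is free of g. It reflects the barrier v = -1, that is, u = 0.\<close>

lemma NN_le_weight:
  assumes lam: "lam > 0" and d: "d\<^sup>2 = 1 / (2 * lam)" and P: "P x > 0"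
  shows "NN d lam g x \<le> - ln (P x)"
proof -
  have e: "P x * exp (g x) = exp (ln (P x) + g x)" using P by (simp add: exp_add)
  have c: "c / (2 * lam) \<ge> 0" using lam c_pos by simp
  show ?thesis
  proof (cases "ln (P x) + g x \<le> -1")
    case True
    have "Phi (P x * exp (g x)) \<le> 4 / 27" by (intro Phi_le mult_nonneg_nonneg P_nonneg) simp
    thus ?thesis unfolding NN_half[OF lam d] using c True by argo
  next
    case False
    hence "Phi (P x * exp (g x)) = - 2 * (ln (P x) + g x + 1)" unfolding e by (simp add: Phi_def)
    thus ?thesis unfolding NN_half[OF lam d] using c by argo
  qed
qed

text \<open>The functions 1 / (1 + k P) decrease to the indicator of the zero set of
  \<open>P\<close>, which averages do not see; so their averages decrease to 0, uniformly by Dini.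
  The value 1/4 is what the upper bound of the iteration consumes.\<close>

lemma concentration:
  assumes d: "d > 0"
  shows "\<exists>k::nat. \<forall>x. av d (\<lambda>x. 1 / (1 + real k * P x)) x < 1 / 4"
proof -
  let ?f = "\<lambda>k x. 1 / (1 + real k * P x)"
  have pos: "1 + real k * P x > 0" for k x using P_nonneg[of x] by (intro add_pos_nonneg) auto
  have c: "continuous_on UNIV (?f k)" for k
    by (intro continuous_intros P_cont ballI) (use pos in \<open>auto simp: less_imp_neq[THEN not_sym]\<close>)
  have p: "per (?f k)" for k using P_per unfolding doubly_periodic_def by simp
  have b: "bdd (?f k)" for k by (rule per_bdd[OF p c])
  have B: "\<bar>?f k x\<bar> \<le> 1" for k x
    using pos[of k x] P_nonneg[of x] by (simp add: divide_le_eq)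
  show ?thesis
  proof (rule dini[of "\<lambda>k. av d (?f k)"])
    show "per (av d (?f k))" for k by (rule per_wav[OF p])
    show "continuous_on UNIV (av d (?f k))" for k using wav_bdd[OF integrable_hg_fst b] unfolding bdd_def by blast
    show "av d (?f (Suc k)) x \<le> av d (?f k) x" for k x
    proof (rule av_mono[OF b b])
      show "?f (Suc k) y \<le> ?f k y" for y
        using pos[of k y] P_nonneg[of y] by (intro divide_left_mono mult_pos_pos pos add_left_mono mult_right_mono) auto
    qed
    show "(\<lambda>k. av d (?f k) x) \<longlonglongrightarrow> 0" for x
    proof -
      have "(\<lambda>k. av d (?f k) x) \<longlonglongrightarrow> av d (\<lambda>_. 0) x"
      proof (rule av_tendsto_countable[OF d c _ B P_countable])
        fix y assume "y \<notin> {x. P x = 0}"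
        hence "P y > 0" using P_nonneg[of y] by simp
        thus "(\<lambda>k. ?f k y) \<longlonglongrightarrow> 0" by real_asymp
      qed simp
      thus ?thesis unfolding av_const .
    qed
  qed simp
qed

lemma lipschitz_continuous:
  fixes g :: "complex \<Rightarrow> real"
  assumes "\<And>x y. \<bar>g x - g y\<bar> \<le> L * cmod (x - y)"
  shows "continuous_on UNIV g"
proof -
  have "L \<ge> 0" using assms[of 1 0] by (simp add: order_trans[OF abs_ge_zero])
  hence "L-lipschitz_on UNIV g" using assms by (intro lipschitz_onI) (auto simp: dist_norm)
  thus ?thesis by (rule lipschitz_on_continuous_on)
qed

text \<open>Dominated convergence in the mild equation; the common Lipschitz bound for averages
  makes the limit continuous. Two sequences are allowed because in the iteration \<open>hs n\<close>
  is \<open>gs (Suc n)\<close>, while in the closedness argument they coincide.\<close>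

lemma mild_limit:
  assumes d: "d > 0" and gs: "\<And>n. per (gs n)" "\<And>n. continuous_on UNIV (gs n)"
    and hs: "\<And>n. per (hs n)" "\<And>n. continuous_on UNIV (hs n)"
    and B: "\<And>n x. \<bar>gs n x\<bar> \<le> B" and lams: "lams \<longlonglongrightarrow> lam" "\<And>n. \<bar>lams n\<bar> \<le> Bl"
    and it: "\<And>n x. hs n x = av d (NN d (lams n) (gs n)) x"
    and lim: "\<And>x. (\<lambda>n. gs n x) \<longlonglongrightarrow> g x" "\<And>x. (\<lambda>n. hs n x) \<longlonglongrightarrow> g x"
  shows "rsol lam g"
proof -
  obtain z where z: "\<And>x. P x \<le> P z" by (rule per_attains_max[OF P_per P_cont]) blast
  have "bounded (Phi ` {0..P z * exp B})"
    by (intro compact_imp_bounded compact_continuous_image continuous_on_subset[OF continuous_Phi]) auto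
  then obtain BP where "\<forall>s\<in>{0..P z * exp B}. \<bar>Phi s\<bar> \<le> BP"
    unfolding bounded_iff by auto
  hence BP: "\<bar>Phi s\<bar> \<le> BP" if "0 \<le> s" "s \<le> P z * exp B" for s using that by simp
  have Bl0: "Bl \<ge> 0" using lams(2)[of 0] by linarith
  have BP0: "BP \<ge> 0" using BP[of 0] P_nonneg[of z] by fastforce
  define C where "C = B + d\<^sup>2 * (Bl * BP + c)"
  have NB: "\<bar>NN d (lams n) (gs n) x\<bar> \<le> C" for n x
  proof -
    have "P x * exp (gs n x) \<le> P z * exp B"
      using z[of x] B[of n x] P_nonneg[of x] P_nonneg[of z] by (intro mult_mono) auto
    hence "\<bar>Phi (P x * exp (gs n x))\<bar> \<le> BP" using P_nonneg[of x] by (intro BP) auto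
    hence "\<bar>lams n * Phi (P x * exp (gs n x))\<bar> \<le> Bl * BP"
      unfolding abs_mult using lams(2)[of n] Bl0 by (intro mult_mono) auto
    hence "\<bar>Fs (lams n) (gs n) x\<bar> \<le> Bl * BP + c" unfolding Fs_def using c_pos by linarith
    hence "\<bar>d\<^sup>2 * Fs (lams n) (gs n) x\<bar> \<le> d\<^sup>2 * (Bl * BP + c)"
      unfolding abs_mult by (intro mult_mono) auto
    thus ?thesis unfolding NN_def C_def using B[of n x] by linarith
  qed
  have Lip: "\<bar>hs n x - hs n y\<bar> \<le> hC * C / d * cmod (x - y)" for n x y
    unfolding it by (rule av_lipschitz[OF NN_bdd[OF gs] _ d, where k = 0]) (use NB in simp)
  have "\<bar>g x - g y\<bar> \<le> hC * C / d * cmod (x - y)" for x y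
    by (rule LIMSEQ_le_const2[of "\<lambda>n. \<bar>hs n x - hs n y\<bar>"]) (use Lip in \<open>auto intro!: tendsto_intros lim\<close>)
  hence cg: "continuous_on UNIV g" by (rule lipschitz_continuous)
  have pg: "per g" unfolding doubly_periodic_def
  proof (intro allI conjI)
    fix x
    have "(\<lambda>n. gs n (x + w1)) = (\<lambda>n. gs n x)" "(\<lambda>n. gs n (x + w2)) = (\<lambda>n. gs n x)"
      using gs(1) unfolding doubly_periodic_def by simp_all
    thus "g (x + w1) = g x" "g (x + w2) = g x" using lim(1) LIMSEQ_unique by metis+
  qed
  have m: "g x = av d (NN d lam g) x" for x
  proof -
    have "(\<lambda>n. av d (NN d (lams n) (gs n)) x) \<longlonglongrightarrow> av d (NN d lam g) x"
    proof (rule wav_tendsto[OF integrable_hg_fst NN_cont[OF gs(2)] NN_cont[OF cg] NB])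
      fix y
      have "(\<lambda>n. Phi (P y * exp (gs n y))) \<longlonglongrightarrow> Phi (P y * exp (g y))"
        by (rule continuous_on_tendsto_compose[OF continuous_Phi]) (auto intro!: tendsto_intros lim)
      thus "(\<lambda>n. NN d (lams n) (gs n) y) \<longlonglongrightarrow> NN d lam g y"
        unfolding NN_def Fs_def by (intro tendsto_intros lim lams)
    qed
    thus ?thesis using LIMSEQ_unique[OF lim(2)[of x, unfolded it]] by simp
  qed
  show ?thesis by (rule mild_rsol[OF pg cg d m])
qed

text \<open>Monotone iteration upwards from a subsolution. The iterates stay bounded near the zeros of
  \<open>P\<close> because these are seen by the averaging operator with small weight only.\<close>

lemma subsolution_rsol:
  assumes lam: "lam > 0" and g0: "per g0" "Ck_on 2 UNIV g0"
    and sub: "\<And>x. - laplacian g0 x \<le> Fs lam g0 x"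
  shows "\<exists>g. rsol lam g"
proof -
  define d where "d = 1 / sqrt (2 * lam)"
  have d: "d > 0" "d\<^sup>2 = 1 / (2 * lam)" unfolding d_def using lam by (simp_all add: power_divide)
  define gs where "gs = rec_nat g0 (\<lambda>_ g. av d (NN d lam g))"
  have gs: "gs 0 = g0" "gs (Suc n) = av d (NN d lam (gs n))" for n by (simp_all add: gs_def)
  have c0: "continuous_on UNIV g0" by (rule Ck_on_imp_continuous[OF g0(2)])
  have pc: "per (gs n) \<and> continuous_on UNIV (gs n)" for n
  proof (induction n)
    case (Suc n)
    have "bdd (NN d lam (gs n))" using Suc by (intro NN_bdd) auto
    from wav_bdd[OF integrable_hg_fst this] show ?case
      using Suc by (auto simp: gs bdd_def intro!: per_wav NN_per)
  qed (use g0 c0 gs in simp)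
  hence p: "per (gs n)" and c: "continuous_on UNIV (gs n)" for n by simp_all
  have bN: "bdd (NN d lam (gs n))" for n by (rule NN_bdd[OF p c])
  have mono: "gs n x \<le> gs (Suc n) x" for n x
  proof (induction n arbitrary: x)
    case 0
    have b: "bdd (\<lambda>x. g0 x - d\<^sup>2 * laplacian g0 x)"
    proof (rule per_bdd)
      show "per (\<lambda>x. g0 x - d\<^sup>2 * laplacian g0 x)" using g0(1) per_laplacian[OF g0(1)] unfolding doubly_periodic_def by simp
      show "continuous_on UNIV (\<lambda>x. g0 x - d\<^sup>2 * laplacian g0 x)"
        by (intro continuous_intros c0 continuous_on_laplacian[OF g0(2) open_UNIV])
    qed
    \<comment> \<open>The subsolution inequality reads (1 - d^2 Laplace) g0 \<le> \<open>NN\<close>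
      of g0, and averaging preserves it.\<close>
    have "g0 x - d\<^sup>2 * laplacian g0 x \<le> NN d lam g0 x" for x
      using mult_left_mono[OF sub[of x], of "d\<^sup>2"] by (simp add: NN_def)
    from av_mono[OF b _ this, of d x] show ?case
      using bN[of 0] unfolding av_minus_laplacian[OF g0] by (simp add: gs)
  next
    case (Suc n)
    show ?case unfolding gs(2)[of "Suc n"] by (subst gs(2)) (intro av_mono bN NN_mono[OF lam d(2)] Suc)
  qed
  have incr: "incseq (\<lambda>n. gs n x)" for x using mono by (intro incseq_SucI)
  obtain k :: nat where k: "\<And>x. av d (\<lambda>x. 1 / (1 + real k * P x)) x < 1 / 4" using concentration[OF d(1)] by blast
  define b where "b = ln (real k + 1)"
  have b0: "b \<ge> 0" by (simp add: b_def)
  obtain z where z: "\<And>x. g0 x \<le> g0 z" by (rule per_attains_max[OF g0(1) c0]) blast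
  \<comment> \<open>M \<ge> 2 b + 1 is exactly what makes b + 2 (M + 1) / 4 \<le> M in the induction
    step.\<close>
  define M where "M = max (2 * b + 1) (g0 z)"
  have M: "M \<ge> 2 * b + 1" "M \<ge> 0" "\<And>x. g0 x \<le> M" using b0 z by (auto simp: M_def le_max_iff_disj)
  let ?chi = "\<lambda>x. 1 / (1 + real k * P x)"
  have pos: "1 + real k * P x > 0" for x using P_nonneg[of x] by (intro add_pos_nonneg) auto
  have up: "gs n x \<le> M" for n x
  proof (induction n arbitrary: x)
    case 0 show ?case using M by (simp add: gs)
  next
    case (Suc n)
    \<comment> \<open>Majorant of \<open>NN\<close>: where k P > 1 one has - ln P \<le> ln (k + 1) =
      b; elsewhere \<open>?chi\<close> is at least 1/2, and the second term covers the crude bound M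
      + 1.\<close>
    let ?u = "\<lambda>x. b + (2 * (M + 1)) * ?chi x"
    have bu: "bdd (\<lambda>x. (2 * (M + 1)) * ?chi x)" "bdd (\<lambda>x. b)"
      using pos P_per by (auto intro!: per_bdd continuous_intros P_cont simp: doubly_periodic_def less_imp_neq[THEN not_sym])
    have bu': "bdd ?u" using bu unfolding bdd_def
      using pos P_per by (intro bdd_def[THEN iffD1] per_bdd continuous_intros P_cont ballI)
        (auto simp: doubly_periodic_def less_imp_neq[THEN not_sym])
    have le: "NN d lam (gs n) y \<le> ?u y" for y
    proof (cases "real k * P y > 1")
      case True
      hence Py: "P y > 0" using P_nonneg[of y] by (cases "P y = 0") auto
      have "1 \<le> (real k + 1) * P y" using True Py by (simp add: algebra_simps)
      hence "0 \<le> ln ((real k + 1) * P y)" by (rule ln_ge_zero)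
      hence "- ln (P y) \<le> b" using Py by (simp add: b_def ln_mult)
      moreover have "0 \<le> (2 * (M + 1)) * ?chi y" using M(2) pos[of y] by (intro mult_nonneg_nonneg) auto
      ultimately show ?thesis using NN_le_weight[OF lam d(2) Py, of "gs n"] by linarith
    next
      case False
      hence "1 / 2 \<le> ?chi y" using pos[of y] by (simp add: field_simps)
      hence "2 * (M + 1) * (1 / 2) \<le> 2 * (M + 1) * ?chi y" using M(2) by (intro mult_left_mono) auto
      hence "M + 1 \<le> 2 * (M + 1) * ?chi y" by (simp only: mult.commute[of 2] mult.assoc) simp
      thus ?thesis using NN_le[OF lam d(2), of "gs n" y] Suc[of y] b0 by linarith
    qed
    have "gs (Suc n) x \<le> av d ?u x" unfolding gs(2) by (rule av_mono[OF bN bu' le])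
    also have "\<dots> = b + 2 * (M + 1) * av d ?chi x"
      unfolding wav_add[OF integrable_hg_fst bu(2,1)] wav_cmult av_const ..
    also have "\<dots> \<le> b + 2 * (M + 1) * (1 / 4)"
      using k[of x] M(2) by (intro add_left_mono mult_left_mono) auto
    also have "\<dots> \<le> M" using M(1) by (simp add: field_simps)
    finally show ?case .
  qed
  obtain y where y: "\<And>x. g0 y \<le> g0 x" by (rule per_attains_min[OF g0(1) c0]) blast
  have low: "g0 y \<le> gs n x" for n x using incseqD[OF incr[of x], of 0 n] y[of x] by (simp add: gs)
  define g where "g x = lim (\<lambda>n. gs n x)" for x
  have lim: "(\<lambda>n. gs n x) \<longlonglongrightarrow> g x" for x
  proof -
    have "norm (gs n x) \<le> \<bar>M\<bar> + \<bar>g0 y\<bar>" for n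
      using up[of n x] low[of n x] unfolding real_norm_def by linarith
    hence "Bseq (\<lambda>n. gs n x)" by (rule BseqI')
    hence "convergent (\<lambda>n. gs n x)" using incr[of x] by (intro Bseq_monoseq_convergent) (auto simp: monoseq_iff)
    thus ?thesis unfolding g_def by (simp add: convergent_LIMSEQ_iff)
  qed
  have "rsol lam g"
  proof (rule mild_limit[OF d(1) p c p c, where B = "\<bar>M\<bar> + \<bar>g0 y\<bar>" and lams = "\<lambda>_. lam" and Bl = "\<bar>lam\<bar>"])
    show "\<bar>gs n x\<bar> \<le> \<bar>M\<bar> + \<bar>g0 y\<bar>" for n x using up[of n x] low[of n x] by linarith
    show "gs (Suc n) x = av d (NN d lam (gs n)) x" for n x by (simp add: gs)
    show "(\<lambda>n. gs n x) \<longlonglongrightarrow> g x" for x by (rule lim)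
    show "(\<lambda>n. gs (Suc n) x) \<longlonglongrightarrow> g x" for x using lim by (rule LIMSEQ_Suc)
  qed auto
  thus ?thesis by blast
qed

text \<open>An explicit subsolution for large lam. With r = (1 - Laplace)^(-1) P one has - Laplace
  (B r) = B (P - r), which is negative enough where \<open>P\<close> is small. Elsewhere P exp g
  stays in a compact range on which \<open>Phi\<close> is bounded below, and a large lam
  suffices.\<close>

lemma rsol_exists: "\<exists>lam>0. \<exists>g. rsol lam g"
proof -
  have P1: "Ck_on (Suc 0) UNIV P" by (rule P_Ck)
  have bP: "bdd P" by (rule per_bdd[OF P_per P_cont])
  define r where "r = av 1 P"
  have rp: "per r" unfolding r_def by (rule per_wav[OF P_per])
  have r2: "Ck_on 2 UNIV r" unfolding r_def numeral_2_eq_2 by (rule av_Ck[OF P_per P1]) simp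
  have rc: "continuous_on UNIV r" by (rule Ck_on_imp_continuous[OF r2])
  have rlap: "laplacian r x = r x - P x" for x unfolding r_def using laplacian_av[OF P_per P1, of 1 x] by simp
  have rpos: "r x > 0" for x
  proof -
    have b0: "bdd (\<lambda>_. 0)" unfolding bdd_def by auto
    have "r x \<ge> 0" using av_mono[OF b0 bP P_nonneg, of 1 x] unfolding av_const r_def .
    moreover have "r x \<noteq> 0"
    proof
      assume "r x = 0"
      hence "P y = 0" for y unfolding r_def using av_strict[OF bP P_nonneg, of 1 x y] by simp
      thus False using P_pos_ex by (simp add: less_le)
    qed
    ultimately show ?thesis by simp
  qed
  obtain z0 where z0: "\<And>x. r z0 \<le> r x" by (rule per_attains_min[OF rp rc]) blast
  obtain z1 where z1: "\<And>x. r x \<le> r z1" by (rule per_attains_max[OF rp rc]) blast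
  obtain z2 where z2: "\<And>x. P x \<le> P z2" by (rule per_attains_max[OF P_per P_cont]) blast
  have Pm: "P z2 > 0" using P_pos_ex z2 by (meson less_le_trans)
  \<comment> \<open>Makes B (P - r) \<le> - c wherever P \<le> r z0 / 2.\<close>
  define B where "B = 2 * c / r z0"
  have B: "B > 0" "B * r z0 = 2 * c" unfolding B_def using c_pos rpos[of z0] by simp_all
  \<comment> \<open>Lowers g so far that P exp g \<le> exp (-2), safely below 1/e.\<close>
  define M where "M = B * r z1 + ln (P z2) + 2"
  define g where "g x = B * r x - M" for x
  have gp: "per g" using rp unfolding g_def doubly_periodic_def by simp
  have g2: "Ck_on 2 UNIV g" unfolding g_def[abs_def] by (intro Ck_on_diff Ck_on_cmult Ck_on_const r2)
  have glap: "laplacian g x = B * (r x - P x)" for x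
    unfolding g_def[abs_def] laplacian_diff[OF Ck_on_cmult[OF r2] Ck_on_const open_UNIV UNIV_I]
      laplacian_cmult[OF r2 open_UNIV UNIV_I] laplacian_const rlap by simp
  have s_le: "P x * exp (g x) \<le> exp (-2)" for x
  proof -
    have "g x \<le> - ln (P z2) - 2" using z1[of x] B(1) by (simp add: g_def M_def)
    hence "P x * exp (g x) \<le> P z2 * exp (- ln (P z2) - 2)"
      using z2[of x] P_nonneg[of x] P_nonneg[of z2] by (intro mult_mono) auto
    also have "\<dots> = exp (-2)" using Pm by (simp add: exp_diff exp_minus field_simps)
    finally show ?thesis .
  qed
  have e21: "exp (-2) < exp (-1 :: real)" by simp
  have Phi0: "Phi (P x * exp (g x)) \<ge> 0" for x
    by (rule Phi_nonneg[OF _ order_trans[OF s_le less_imp_le[OF e21]]]) (simp add: P_nonneg)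
  \<comment> \<open>Lower bound for P exp g where P > r z0 / 2, as g \<ge> - M; the minimum with exp
    (-2) keeps the interval below nonempty.\<close>
  define a where "a = min (r z0 / 2 * exp (- M)) (exp (-2))"
  have a: "a > 0" "a \<le> exp (-2)" using rpos[of z0] by (simp_all add: a_def)
  obtain y where y: "y \<in> {a..exp (-2)}" "\<And>s. s \<in> {a..exp (-2)} \<Longrightarrow> Phi y \<le> Phi s"
    using continuous_attains_inf[of "{a..exp (-2)}" Phi] a continuous_on_subset[OF continuous_Phi] by auto
  have "0 < y" "y < exp (-1)" using y(1) a(1) le_less_trans[OF _ e21, of y] by auto
  hence eta: "Phi y > 0" by (rule Phi_pos)
  define lam where "lam = (B * P z2 + c) / Phi y"
  have lam: "lam > 0" "lam * Phi y = B * P z2 + c"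
    unfolding lam_def using eta B c_pos Pm by (auto intro!: divide_pos_pos add_pos_pos)
  have "- laplacian g x \<le> Fs lam g x" for x
  proof (cases "P x \<le> r z0 / 2")
    case True
    have "P x - r x \<le> - r z0 / 2" using True z0[of x] by simp
    hence "B * (P x - r x) \<le> B * (- r z0 / 2)" using B(1) by (intro mult_left_mono) auto
    also have "\<dots> = - c" using B(2) by simp
    also have "\<dots> \<le> Fs lam g x" using Phi0[of x] lam(1) by (simp add: Fs_def)
    finally show ?thesis unfolding glap by (simp add: algebra_simps)
  next
    case False
    have "a \<le> r z0 / 2 * exp (- M)" by (simp add: a_def)
    also have "\<dots> \<le> P x * exp (g x)"
      using False rpos[of z0] rpos[of x] B(1) by (intro mult_mono) (auto simp: g_def)
    finally have "Phi y \<le> Phi (P x * exp (g x))" using s_le[of x] by (intro y(2)) auto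
    hence "lam * Phi y \<le> lam * Phi (P x * exp (g x))" using lam(1) by (intro mult_left_mono) auto
    hence "B * P z2 \<le> Fs lam g x" unfolding Fs_def lam(2) by simp
    moreover have "B * (P x - r x) \<le> B * P z2" using z2[of x] rpos[of x] B(1) by (intro mult_left_mono) auto
    ultimately show ?thesis unfolding glap by (simp add: algebra_simps)
  qed
  from subsolution_rsol[OF lam(1) gp g2 this] show ?thesis using lam(1) by blast
qed

section \<open>A priori bounds and closedness\<close>

lemma Fs_bound:
  assumes r: "rsol lam g" and lam: "lam > 0" "lam \<le> b"
  shows "\<bar>Fs lam g x\<bar> \<le> b * (4 / 27) + c"
proof -
  have s: "0 \<le> P x * exp (g x)" using P_nonneg[of x] by simp
  have "0 \<le> Phi (P x * exp (g x))" "Phi (P x * exp (g x)) \<le> 4 / 27"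
    using Phi_nonneg[OF s] Phi_le[OF s] rsol_strict[OF r lam(1), of x] by auto
  hence "0 \<le> lam * Phi (P x * exp (g x))" "lam * Phi (P x * exp (g x)) \<le> b * (4 / 27)"
    using lam mult_mono[of lam b "Phi (P x * exp (g x))" "4 / 27"] by simp_all
  thus ?thesis using c_pos unfolding Fs_def by linarith
qed

text \<open>The Lipschitz bound for the averaging operator contracts oscillations once \<open>d\<close> is
  large compared with the diameter of the cell.\<close>

lemma rsol_osc:
  assumes r: "rsol lam g" and lam: "lam > 0" "lam \<le> b"
    and D: "Dm > 0" "\<And>x y. x \<in> cell \<Longrightarrow> y \<in> cell \<Longrightarrow> cmod (x - y) \<le> Dm"
  shows "\<bar>g x - g y\<bar> \<le> (2 * Dm * hC)\<^sup>2 * (b * (4 / 27) + c)"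
proof -
  \<comment> \<open>With this \<open>d\<close> the Lipschitz factor hC Dm / d across one cell is
    1/2, so the oscillation is at most (osc + K) / 2.\<close>
  define d where "d = 2 * Dm * hC"
  have d: "d > 0" unfolding d_def using D(1) hC_pos by simp
  define K where "K = d\<^sup>2 * (b * (4 / 27) + c)"
  have g: "per g" "continuous_on UNIV g" using r unfolding rsol_def by (auto intro: Ck_on_imp_continuous)
  obtain z1 where z1: "\<And>x. g x \<le> g z1" by (rule per_attains_max[OF g]) blast
  obtain z2 where z2: "\<And>x. g z2 \<le> g x" by (rule per_attains_min[OF g]) blast
  obtain y1 where y1: "y1 \<in> cell" "g y1 = g z1" by (rule per_reduce[OF g(1)])
  obtain y2 where y2: "y2 \<in> cell" "g y2 = g z2" by (rule per_reduce[OF g(1)])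
  define osc where "osc = g z1 - g z2"
  have "\<bar>NN d lam g x - g z2\<bar> \<le> osc + K" for x
  proof -
    have "\<bar>d\<^sup>2 * Fs lam g x\<bar> \<le> K" unfolding K_def abs_mult
      using Fs_bound[OF r lam, of x] by (intro mult_mono) auto
    thus ?thesis using z1[of x] z2[of x] unfolding NN_def osc_def by linarith
  qed
  from av_lipschitz[OF NN_bdd[OF g] this d, of y1 y2]
  have "\<bar>g y1 - g y2\<bar> \<le> hC * (osc + K) / d * cmod (y1 - y2)"
    using rsol_mild[OF r, of _ d] by simp
  also have "\<dots> \<le> hC * (osc + K) / d * Dm"
  proof (intro mult_left_mono D(2) y1(1) y2(1))
    have "osc \<ge> 0" using z1[of z2] by (simp add: osc_def)
    moreover have "K \<ge> 0" unfolding K_def using lam c_pos by (intro mult_nonneg_nonneg add_nonneg_nonneg) auto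
    ultimately show "0 \<le> hC * (osc + K) / d" using hC_pos d by (intro divide_nonneg_pos mult_nonneg_nonneg) auto
  qed
  also have "\<dots> = (osc + K) / 2" unfolding d_def using D(1) hC_pos by (simp add: field_simps)
  finally have "\<bar>osc\<bar> \<le> (osc + K) / 2" unfolding y1(2) y2(2) osc_def[symmetric] .
  hence "osc \<le> K" by (simp add: abs_le_iff)
  thus ?thesis using z1[of x] z1[of y] z2[of x] z2[of y] unfolding osc_def K_def d_def by linarith
qed

text \<open>The oscillation bound leaves an additive constant open. Strictness at the maximum of
  \<open>P\<close> bounds g from above; from below, a point with lam \<open>Phi\<close> \<ge> c
  does, since \<open>Phi_le_linear\<close> keeps exp g away from 0 there. The Lipschitz constant is
  that of an average with d = 1.\<close>

lemma rsol_bounds: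
  assumes b: "b > 0"
  shows "\<exists>B L. \<forall>lam g. 0 < lam \<and> lam \<le> b \<and> rsol lam g \<longrightarrow>
    (\<forall>x. \<bar>g x\<bar> \<le> B) \<and> (\<forall>x y. \<bar>g x - g y\<bar> \<le> L * cmod (x - y))"
proof -
  have "bounded cell" by (rule compact_imp_bounded[OF compact_cell])
  then obtain R where R: "\<And>x. x \<in> cell \<Longrightarrow> cmod x \<le> R" unfolding bounded_iff by blast
  define Dm where "Dm = 2 * \<bar>R\<bar> + 1"
  have D: "Dm > 0" "\<And>x y. x \<in> cell \<Longrightarrow> y \<in> cell \<Longrightarrow> cmod (x - y) \<le> Dm"
  proof -
    show "Dm > 0" by (simp add: Dm_def)
    fix x y assume "x \<in> cell" "y \<in> cell"
    thus "cmod (x - y) \<le> Dm" using R[of x] R[of y] norm_triangle_ineq4[of x y] unfolding Dm_def by linarith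
  qed
  define K where "K = (2 * Dm * hC)\<^sup>2 * (b * (4 / 27) + c)"
  obtain z where z: "\<And>x. P x \<le> P z" by (rule per_attains_max[OF P_per P_cont]) blast
  have Pz: "P z > 0" using P_pos_ex z by (meson less_le_trans)
  define A where "A = \<bar>1 + ln (P z)\<bar> + \<bar>ln (c / (b * exp 1 * P z))\<bar> + K"
  define L where "L = hC * (A + (b * (4 / 27) + c))"
  have main: "\<bar>g x\<bar> \<le> A" if h: "0 < lam" "lam \<le> b" "rsol lam g" for lam g x
  proof -
    have osc: "\<bar>g x - g y\<bar> \<le> K" for x y unfolding K_def by (rule rsol_osc[OF h(3,1,2) D])
    have "P z * exp (g z) < exp (-1)" by (rule rsol_strict[OF h(3,1)])
    hence "ln (P z * exp (g z)) < -1" using Pz by (metis exp_gt_zero ln_exp ln_less_cancel_iff mult_pos_pos)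
    hence up: "g z < - (1 + ln (P z))" using Pz by (simp add: ln_mult)
    obtain y where y: "lam * Phi (P y * exp (g y)) \<ge> c" using rsol_ex_ge[OF h(3)] by blast
    have "c \<le> b * (exp 1 * (P z * exp (g y)))"
    proof -
      have "Phi (P y * exp (g y)) \<le> exp 1 * (P y * exp (g y))" by (intro Phi_le_linear mult_nonneg_nonneg P_nonneg) simp
      also have "\<dots> \<le> exp 1 * (P z * exp (g y))" using z[of y] by (intro mult_left_mono mult_right_mono) auto
      finally have "lam * Phi (P y * exp (g y)) \<le> lam * (exp 1 * (P z * exp (g y)))"
        using h(1) by (intro mult_left_mono) auto
      also have "\<dots> \<le> b * (exp 1 * (P z * exp (g y)))"
        using h(2) Pz by (intro mult_right_mono) auto
      finally have "lam * Phi (P y * exp (g y)) \<le> b * (exp 1 * (P z * exp (g y)))" .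
      thus ?thesis using y by linarith
    qed
    hence "c / (b * exp 1 * P z) \<le> exp (g y)" using b Pz by (simp add: divide_le_eq mult_ac)
    hence "ln (c / (b * exp 1 * P z)) \<le> ln (exp (g y))" using c_pos b Pz by (intro ln_mono) auto
    hence lo: "ln (c / (b * exp 1 * P z)) \<le> g y" by simp
    show ?thesis using up lo osc[of x z] osc[of x y] unfolding A_def by linarith
  qed
  moreover have "\<bar>g x - g y\<bar> \<le> L * cmod (x - y)" if h: "0 < lam" "lam \<le> b" "rsol lam g" for lam g x y
  proof -
    have g: "per g" "continuous_on UNIV g" using h(3) unfolding rsol_def by (auto intro: Ck_on_imp_continuous)
    have "\<bar>NN 1 lam g x - 0\<bar> \<le> A + (b * (4 / 27) + c)" for x
      using main[OF h, of x] Fs_bound[OF h(3,1,2), of x] unfolding NN_def by simp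
    from av_lipschitz[OF NN_bdd[OF g] this, of 1 x y] show ?thesis
      using rsol_mild[OF h(3), of _ 1] by (simp add: L_def)
  qed
  ultimately show ?thesis by blast
qed

lemma rsol_closed:
  assumes lams: "lams \<longlonglongrightarrow> lam" "\<And>n. 0 < lams n" "\<And>n. lams n \<le> b" and r: "\<And>n. rsol (lams n) (gs n)"
  shows "\<exists>g. rsol lam g"
proof -
  have b: "b > 0" using lams(2,3)[of 0] by linarith
  obtain B L where BL: "\<forall>lam g. 0 < lam \<and> lam \<le> b \<and> rsol lam g \<longrightarrow>
    (\<forall>x. \<bar>g x\<bar> \<le> B) \<and> (\<forall>x y. \<bar>g x - g y\<bar> \<le> L * cmod (x - y))"
    using rsol_bounds[OF b] by blast
  have Bd: "\<bar>gs n x\<bar> \<le> B" and Lip: "\<bar>gs n x - gs n y\<bar> \<le> L * cmod (x - y)" for n x y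
    using BL lams(2,3) r by blast+
  have g: "per (gs n)" "continuous_on UNIV (gs n)" for n using r[of n] unfolding rsol_def by (auto intro: Ck_on_imp_continuous)
  obtain h k where k: "strict_mono (k :: nat \<Rightarrow> nat)"
    and h: "\<And>e. 0 < e \<Longrightarrow> \<exists>N. \<forall>n x. n \<ge> N \<and> x \<in> cell \<longrightarrow> norm (gs (k n) x - h x) < e"
  proof (rule Arzela_Ascoli[OF compact_cell, of gs B])
    show "norm (gs n x) \<le> B" for n x using Bd by simp
    fix x e :: real and x' :: complex
    assume "0 < e"
    show "\<exists>d>0. \<forall>n y. y \<in> cell \<and> norm (x' - y) < d \<longrightarrow> norm (gs n x' - gs n y) < e"
    proof (intro exI[of _ "e / (\<bar>L\<bar> + 1)"] conjI allI impI)
      show "0 < e / (\<bar>L\<bar> + 1)" using \<open>0 < e\<close> by simp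
      fix n y assume a: "y \<in> cell \<and> norm (x' - y) < e / (\<bar>L\<bar> + 1)"
      have "\<bar>gs n x' - gs n y\<bar> \<le> L * cmod (x' - y)" by (rule Lip)
      also have "\<dots> \<le> (\<bar>L\<bar> + 1) * cmod (x' - y)" by (intro mult_right_mono) auto
      also have "\<dots> < e" using a by (simp add: pos_less_divide_eq mult.commute)
      finally show "norm (gs n x' - gs n y) < e" by simp
    qed
  qed blast
  \<comment> \<open>Arzela-Ascoli speaks of the cell only; other points are reduced modulo the
    lattice.\<close>
  have conv: "\<exists>l. (\<lambda>n. gs (k n) x) \<longlonglongrightarrow> l" for x
  proof -
    obtain y m where y: "x = y + m" "y \<in> FD" "m \<in> Lam" by (rule reduce)
    have "(\<lambda>n. gs (k n) y) \<longlonglongrightarrow> h y"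
      unfolding LIMSEQ_iff using h FD_cell y(2) by blast
    thus ?thesis unfolding y(1) per_Lam[OF g(1) y(3)] by blast
  qed
  define G where "G x = lim (\<lambda>n. gs (k n) x)" for x
  have limG: "(\<lambda>n. gs (k n) x) \<longlonglongrightarrow> G x" for x
    unfolding G_def using conv[of x] by (simp add: convergent_def[symmetric] convergent_LIMSEQ_iff)
  have "rsol lam G"
  proof (rule mild_limit[of 1 "\<lambda>n. gs (k n)" "\<lambda>n. gs (k n)" B "\<lambda>n. lams (k n)" lam b])
    show "(\<lambda>n. lams (k n)) \<longlonglongrightarrow> lam" using LIMSEQ_subseq_LIMSEQ[OF lams(1) k] by (simp add: o_def)
    show "\<bar>lams (k n)\<bar> \<le> b" for n using lams(2,3)[of "k n"] by simp
    show "gs (k n) x = av 1 (NN 1 (lams (k n)) (gs (k n))) x" for n x by (rule rsol_mild[OF r])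
  qed (use g Bd limG in auto)
  thus ?thesis by blast
qed

end

text \<open>The subsolution is g' + ln (D + e), a regularization of g' + ln D. Its Laplacian loses
  at most c' - c against that of g', which is the difference of the constants, and its weight P exp
  g0 exceeds P' exp g' by e P exp g', an error absorbed by the increase from lam' to lam.\<close>

lemma rsol_compare:
  assumes W: "weight w1 w2 P c" and W': "weight w1 w2 P' c'"
    and D: "\<And>k. Ck_on k UNIV D" "doubly_periodic w1 w2 D" "\<And>x. 0 \<le> D x" "countable {x. D x = 0}"
      "\<And>x. 0 < D x \<Longrightarrow> laplacian (\<lambda>x. ln (D x)) x = - (c' - c)"
    and PD: "\<And>x. P' x = P x * D x" and cc: "c \<le> c'"
    and lam: "0 < lam'" "lam' < lam" and r: "weight.rsol w1 w2 P' c' lam' g'"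
  shows "\<exists>g. weight.rsol w1 w2 P c lam g"
proof -
  interpret W: weight w1 w2 P c by (rule W)
  interpret W': weight w1 w2 P' c' by (rule W')
  have g': "W.per g'" "Ck_on 2 UNIV g'" "\<And>x. laplacian g' x = - W'.Fs lam' g' x"
    using r unfolding W'.rsol_def by auto
  have cg': "continuous_on UNIV g'" by (rule Ck_on_imp_continuous[OF g'(2)])
  have cont: "continuous_on UNIV (\<lambda>x. P' x * exp (g' x))" "continuous_on UNIV (\<lambda>x. P x * exp (g' x))"
    by (intro continuous_intros cg' W'.P_cont W.P_cont)+
  have per: "W.per (\<lambda>x. P' x * exp (g' x))" "W.per (\<lambda>x. P x * exp (g' x))"
    using g'(1) W.P_per W'.P_per unfolding doubly_periodic_def by simp_all
  obtain z where z: "\<And>x. P' x * exp (g' x) \<le> P' z * exp (g' z)"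
    by (rule W.per_attains_max[OF per(1) cont(1)]) blast
  obtain y where y: "\<And>x. P x * exp (g' x) \<le> P y * exp (g' y)"
    by (rule W.per_attains_max[OF per(2) cont(2)]) blast
  obtain e where e: "e > 0" "\<And>s b. 0 \<le> s \<Longrightarrow> s \<le> P' z * exp (g' z) \<Longrightarrow> 0 \<le> b \<Longrightarrow> b \<le> P y * exp (g' y)
      \<Longrightarrow> lam' * Phi s \<le> lam * Phi (s + e * b)"
    using Phi_perturb[OF lam W'.rsol_strict[OF r lam(1), of z], of "P y * exp (g' y)"] W.P_nonneg[of y] by auto
  let ?l = "\<lambda>x. ln (D x + e)"
  have De: "D x + e > 0" for x using D(3)[of x] e(1) by linarith
  have Cl: "Ck_on 2 UNIV ?l" by (intro Ck_on_ln Ck_on_add D(1) Ck_on_const De)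
  let ?S = "{x. 0 < D x}"
  have S: "open ?S" using Ck_on_imp_continuous[OF D(1)[of 0]] by (intro open_Collect_less) auto
  have lapl: "laplacian ?l x \<ge> - (c' - c)" if x: "x \<in> ?S" for x
  proof -
    have CD: "Ck_on 2 ?S (\<lambda>x. ln (D x))" by (intro Ck_on_ln Ck_on_subset[OF D(1)]) auto
    have pos: "exp t + e > 0" for t using e(1) by (simp add: add_pos_pos)
    \<comment> \<open>In terms of T = ln D this is ln (exp T + e), convex with slope between 0 and
      1: the gradient term is nonnegative, and the slope only weakens the constant - (c' -
      c).\<close>
    have "laplacian ?l x = laplacian (\<lambda>x. ln (exp (ln (D x)) + e)) x"
      by (rule laplacian_cong_open[OF S x]) simp
    also have "\<dots> = exp (ln (D x)) / (exp (ln (D x)) + e) * laplacian (\<lambda>x. ln (D x)) x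
        + exp (ln (D x)) * e / (exp (ln (D x)) + e)\<^sup>2 * grad_sq (\<lambda>x. ln (D x)) x"
    proof (rule laplacian_compose[OF CD S x, where \<psi> = "\<lambda>t. ln (exp t + e)" and \<psi>' = "\<lambda>t. exp t / (exp t + e)"])
      show "((\<lambda>t. ln (exp t + e)) has_real_derivative exp (ln (D x)) / (exp (ln (D x)) + e)) (at (ln (D x)))" for x
        using pos[of "ln (D x)"] by (auto intro!: derivative_eq_intros)
      show "((\<lambda>t. exp t / (exp t + e)) has_real_derivative exp (ln (D x)) * e / (exp (ln (D x)) + e)\<^sup>2) (at (ln (D x)))"
        using pos[of "ln (D x)"] by (auto intro!: derivative_eq_intros simp: power2_eq_square algebra_simps)
    qed
    also have "\<dots> = D x / (D x + e) * (- (c' - c)) + D x * e / (D x + e)\<^sup>2 * grad_sq (\<lambda>x. ln (D x)) x"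
      using x D(5)[of x] by simp
    also have "\<dots> \<ge> - (c' - c)"
    proof -
      have "D x / (D x + e) * (c' - c) \<le> 1 * (c' - c)"
        using cc D(3)[of x] e(1) De[of x] by (intro mult_right_mono) auto
      moreover have "0 \<le> D x * e / (D x + e)\<^sup>2 * grad_sq (\<lambda>x. ln (D x)) x"
        using D(3)[of x] e(1) by (intro mult_nonneg_nonneg divide_nonneg_nonneg) (auto simp: grad_sq_def)
      moreover have "- v \<le> a * (- v) + b" if "a * v \<le> 1 * v" "0 \<le> b" for a b v :: real
        using that by simp
      ultimately show ?thesis by blast
    qed
    finally show ?thesis .
  qed
  have cS: "countable (- ?S)"
  proof -
    have "- ?S = {x. D x = 0}" using D(3) by (auto simp: not_less intro: antisym)
    thus ?thesis using D(4) by simp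
  qed
  have lapl': "- (c' - c) \<le> laplacian ?l x" for x
    by (rule le_if_le_off_countable[OF _ continuous_on_laplacian[OF Cl open_UNIV] cS lapl]) auto
  define g0 where "g0 x = g' x + ?l x" for x
  have p0: "W.per g0" using g'(1) D(2) unfolding g0_def doubly_periodic_def by simp
  have C0: "Ck_on 2 UNIV g0" unfolding g0_def[abs_def] by (intro Ck_on_add g'(2) Cl)
  have "- laplacian g0 x \<le> W.Fs lam g0 x" for x
  proof -
    have "P x * exp (g0 x) = P' x * exp (g' x) + e * (P x * exp (g' x))"
      using De[of x] by (simp add: g0_def exp_add PD algebra_simps)
    moreover have "lam' * Phi (P' x * exp (g' x)) \<le> lam * Phi (P' x * exp (g' x) + e * (P x * exp (g' x)))"
      using z[of x] y[of x] W.P_nonneg[of x] W'.P_nonneg[of x] by (intro e(2)) auto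
    moreover have "laplacian g0 x = - W'.Fs lam' g' x + laplacian ?l x"
      unfolding g0_def[abs_def] laplacian_add[OF g'(2) Cl open_UNIV UNIV_I] g'(3) ..
    ultimately show ?thesis using lapl'[of x] unfolding W.Fs_def W'.Fs_def by simp
  qed
  with lam show ?thesis by (intro W.subsolution_rsol[OF _ p0 C0]) auto
qed

section \<open>Integration over the fundamental domain\<close>

lemma measurable_Complex[measurable (raw)]:
  assumes "f \<in> borel_measurable M" "g \<in> borel_measurable M"
  shows "(\<lambda>x. Complex (f x) (g x)) \<in> borel_measurable M"
  using assms unfolding Complex_eq by measurable

text \<open>Lebesgue measure is determined by its values on boxes, which here are products of
  intervals; this makes Fubini available in real and imaginary part.\<close>

lemma lborel_complex: "(lborel :: complex measure) = distr (lborel \<Otimes>\<^sub>M lborel) borel (\<lambda>(x, y). Complex x y)"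
proof (rule lborel_eqI)
  fix l u :: complex assume lu: "\<And>b. b \<in> Basis \<Longrightarrow> l \<bullet> b \<le> u \<bullet> b"
  hence le: "Re l \<le> Re u" "Im l \<le> Im u" using lu[of 1] lu[of \<i>] by (simp_all add: Basis_complex_def)
  have [measurable]: "(\<lambda>(x, y). Complex x y) \<in> borel_measurable (lborel \<Otimes>\<^sub>M lborel)"
    unfolding case_prod_beta by measurable
  have "(\<lambda>(x, y). Complex x y) -` box l u \<inter> space (lborel \<Otimes>\<^sub>M lborel) = {Re l<..<Re u} \<times> {Im l<..<Im u}"
    by (auto simp: box_def Basis_complex_def space_pair_measure)
  hence "emeasure (distr (lborel \<Otimes>\<^sub>M lborel) borel (\<lambda>(x, y). Complex x y)) (box l u)
      = emeasure (lborel \<Otimes>\<^sub>M lborel) ({Re l<..<Re u} \<times> {Im l<..<Im u})"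
    by (subst emeasure_distr) auto
  also have "\<dots> = ennreal (Re u - Re l) * ennreal (Im u - Im l)"
    using le by (subst lborel.emeasure_pair_measure_Times) auto
  also have "\<dots> = (\<Prod>b\<in>Basis. (u - l) \<bullet> b)"
    using le by (simp add: Basis_complex_def ennreal_mult)
  finally show "emeasure (distr (lborel \<Otimes>\<^sub>M lborel) borel (\<lambda>(x, y). Complex x y)) (box l u) = (\<Prod>b\<in>Basis. (u - l) \<bullet> b)" .
qed simp

lemma nn_integral_complex:
  assumes [measurable]: "h \<in> borel_measurable borel"
  shows "(\<integral>\<^sup>+z. h z \<partial>lborel) = (\<integral>\<^sup>+y. \<integral>\<^sup>+x. h (Complex x y) \<partial>lborel \<partial>lborel)"
proof -
  have m[measurable]: "(\<lambda>(x, y). Complex x y) \<in> borel_measurable (lborel \<Otimes>\<^sub>M lborel)"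
    unfolding case_prod_beta by measurable
  have "(\<integral>\<^sup>+z. h z \<partial>lborel) = (\<integral>\<^sup>+p. h (case p of (x, y) \<Rightarrow> Complex x y) \<partial>(lborel \<Otimes>\<^sub>M lborel))"
    by (subst lborel_complex) (rule nn_integral_distr; measurable)
  also have "\<dots> = (\<integral>\<^sup>+y. \<integral>\<^sup>+x. h (Complex x y) \<partial>lborel \<partial>lborel)"
    by (subst lborel_pair.nn_integral_snd[symmetric]) (simp_all, measurable)
  finally show ?thesis .
qed

text \<open>Two one-dimensional affine substitutions: at fixed height t the abscissa is traded for
  a, then, after Fubini and at fixed a, t is traded for b. The factors e and \<open>Im w2\<close>
  multiply to the determinant.\<close>

lemma nn_integral_lattice_aux:
  assumes h[measurable]: "h \<in> borel_measurable borel" and y2: "Im w2 \<noteq> 0" and D: "Im (cnj w1 * w2) \<noteq> 0"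
  shows "(\<integral>\<^sup>+z. h z \<partial>lborel) =
    ennreal \<bar>Im (cnj w1 * w2)\<bar> * (\<integral>\<^sup>+a. \<integral>\<^sup>+b. h (of_real a * w1 + of_real b * w2) \<partial>lborel \<partial>lborel)"
proof -
  define e where "e = Re w1 - Im w1 * Re w2 / Im w2"
  have eD: "\<bar>e\<bar> * \<bar>Im w2\<bar> = \<bar>Im (cnj w1 * w2)\<bar>"
  proof -
    have "e * Im w2 = Im (cnj w1 * w2)" using y2 by (simp add: e_def left_diff_distrib)
    thus ?thesis by (simp only: abs_mult[symmetric])
  qed
  have e0: "e \<noteq> 0" using eD D by auto
  define f where "f a t = h (Complex (a * Re w1 + (t - a * Im w1) * Re w2 / Im w2) t)" for a t
  have [measurable]: "(\<lambda>(t, a). f a t) \<in> borel_measurable (borel \<Otimes>\<^sub>M borel)"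
    unfolding f_def case_prod_beta by measurable
  have [measurable]: "f a \<in> borel_measurable borel" for a unfolding f_def by measurable
  have 1: "(\<integral>\<^sup>+x. h (Complex x t) \<partial>lborel) = ennreal \<bar>e\<bar> * (\<integral>\<^sup>+a. f a t \<partial>lborel)" for t
  proof -
    have "(\<integral>\<^sup>+x. h (Complex x t) \<partial>lborel) = ennreal \<bar>e\<bar> * (\<integral>\<^sup>+a. h (Complex (t * Re w2 / Im w2 + e * a) t) \<partial>lborel)"
      by (rule nn_integral_real_affine[OF _ e0]) measurable
    also have "(\<lambda>a. h (Complex (t * Re w2 / Im w2 + e * a) t)) = (\<lambda>a. f a t)"
    proof
      fix a
      have "t * Re w2 / Im w2 + e * a = a * Re w1 + (t - a * Im w1) * Re w2 / Im w2"
        using y2 by (simp add: e_def field_simps)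
      thus "h (Complex (t * Re w2 / Im w2 + e * a) t) = f a t" by (simp add: f_def)
    qed
    finally show ?thesis .
  qed
  have 2: "(\<integral>\<^sup>+t. f a t \<partial>lborel) = ennreal \<bar>Im w2\<bar> * (\<integral>\<^sup>+b. h (of_real a * w1 + of_real b * w2) \<partial>lborel)" for a
  proof -
    have "(\<integral>\<^sup>+t. f a t \<partial>lborel) = ennreal \<bar>Im w2\<bar> * (\<integral>\<^sup>+b. f a (a * Im w1 + Im w2 * b) \<partial>lborel)"
      by (rule nn_integral_real_affine[OF _ y2]) measurable
    also have "(\<lambda>b. f a (a * Im w1 + Im w2 * b)) = (\<lambda>b. h (of_real a * w1 + of_real b * w2))"
    proof
      fix b
      have "Complex (a * Re w1 + (a * Im w1 + Im w2 * b - a * Im w1) * Re w2 / Im w2) (a * Im w1 + Im w2 * b)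
          = of_real a * w1 + of_real b * w2"
        using y2 by (simp add: complex_eq_iff)
      thus "f a (a * Im w1 + Im w2 * b) = h (of_real a * w1 + of_real b * w2)" by (simp add: f_def)
    qed
    finally show ?thesis .
  qed
  have "(\<integral>\<^sup>+z. h z \<partial>lborel) = (\<integral>\<^sup>+t. ennreal \<bar>e\<bar> * (\<integral>\<^sup>+a. f a t \<partial>lborel) \<partial>lborel)"
    unfolding nn_integral_complex[OF h] 1 ..
  also have "\<dots> = ennreal \<bar>e\<bar> * (\<integral>\<^sup>+t. \<integral>\<^sup>+a. f a t \<partial>lborel \<partial>lborel)"
    by (rule nn_integral_cmult) measurable
  also have "(\<integral>\<^sup>+t. \<integral>\<^sup>+a. f a t \<partial>lborel \<partial>lborel) = (\<integral>\<^sup>+a. \<integral>\<^sup>+t. f a t \<partial>lborel \<partial>lborel)"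
    by (rule lborel_pair.Fubini'[symmetric]) measurable
  also have "\<dots> = ennreal \<bar>Im w2\<bar> * (\<integral>\<^sup>+a. \<integral>\<^sup>+b. h (of_real a * w1 + of_real b * w2) \<partial>lborel \<partial>lborel)"
    unfolding 2 by (rule nn_integral_cmult) measurable
  finally show ?thesis unfolding eD[symmetric] by (simp add: ennreal_mult mult.assoc)
qed

lemma nn_integral_lattice:
  assumes h[measurable]: "h \<in> borel_measurable borel" and D: "Im (cnj w1 * w2) \<noteq> 0"
  shows "(\<integral>\<^sup>+z. h z \<partial>lborel) =
    ennreal \<bar>Im (cnj w1 * w2)\<bar> * (\<integral>\<^sup>+a. \<integral>\<^sup>+b. h (of_real a * w1 + of_real b * w2) \<partial>lborel \<partial>lborel)"
proof (cases "Im w2 = 0")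
  case False thus ?thesis by (rule nn_integral_lattice_aux[OF h _ D])
next
  case True
  hence y1: "Im w1 \<noteq> 0" and D': "Im (cnj w2 * w1) \<noteq> 0" using D by auto
  have e: "\<bar>Im (cnj w2 * w1)\<bar> = \<bar>Im (cnj w1 * w2)\<bar>" using True by (simp add: mult.commute)
  have "(\<integral>\<^sup>+a. \<integral>\<^sup>+b. h (of_real a * w2 + of_real b * w1) \<partial>lborel \<partial>lborel) =
      (\<integral>\<^sup>+b. \<integral>\<^sup>+a. h (of_real a * w2 + of_real b * w1) \<partial>lborel \<partial>lborel)"
    by (rule lborel_pair.Fubini'[symmetric]) measurable
  also have "\<dots> = (\<integral>\<^sup>+a. \<integral>\<^sup>+b. h (of_real a * w1 + of_real b * w2) \<partial>lborel \<partial>lborel)"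
    by (simp only: add.commute)
  finally show ?thesis using nn_integral_lattice_aux[OF h y1 D'] unfolding e by simp
qed

section \<open>Integrals of periodic derivatives over the fundamental domain\<close>

context torus
begin

definition Tm :: "real \<times> real \<Rightarrow> complex" where
  "Tm z = of_real (fst z) * w1 + of_real (snd z) * w2"

lemma lborel_Tm: "(lborel :: complex measure) = density (distr (lborel \<Otimes>\<^sub>M lborel) borel Tm) (\<lambda>_. ennreal area)"
proof (rule measure_eqI)
  fix A :: "complex set" assume "A \<in> sets lborel"
  hence [measurable]: "A \<in> sets borel" by simp
  have m[measurable]: "Tm \<in> borel_measurable (lborel \<Otimes>\<^sub>M lborel)"
    unfolding Tm_def[abs_def] by measurable
  have "emeasure (density (distr (lborel \<Otimes>\<^sub>M lborel) borel Tm) (\<lambda>_. ennreal area)) A =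
      (\<integral>\<^sup>+z. ennreal area * indicator A z \<partial>distr (lborel \<Otimes>\<^sub>M lborel) borel Tm)"
    by (rule emeasure_density) auto
  also have "\<dots> = ennreal area * (\<integral>\<^sup>+z. indicator A (Tm z) \<partial>(lborel \<Otimes>\<^sub>M lborel))"
    by (subst nn_integral_distr) (auto simp: nn_integral_cmult)
  also have "(\<integral>\<^sup>+z. indicator A (Tm z) \<partial>(lborel \<Otimes>\<^sub>M lborel)) = (\<integral>\<^sup>+a. \<integral>\<^sup>+b. indicator A (Tm (a, b)) \<partial>lborel \<partial>lborel)"
    by (rule lborel.nn_integral_fst[symmetric]) measurable
  also have "ennreal area * \<dots> = (\<integral>\<^sup>+z. indicator A z \<partial>lborel)"
    unfolding Tm_def fst_conv snd_conv area_def by (rule nn_integral_lattice[OF _ indep, symmetric]) simp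
  finally show "emeasure lborel A = emeasure (density (distr (lborel \<Otimes>\<^sub>M lborel) borel Tm) (\<lambda>_. ennreal area)) A"
    by simp
qed simp

lemma Tm_FD: "Tm (a, b) \<in> FD \<longleftrightarrow> a \<in> {0..<1} \<and> b \<in> {0..<1}"
  unfolding Tm_def fst_conv snd_conv FD_iff cs_lin ct_lin by auto

lemma FD_borel: "FD \<in> sets borel"
proof -
  have [measurable]: "cs \<in> borel_measurable borel" "ct \<in> borel_measurable borel"
    unfolding cs_def[abs_def] ct_def[abs_def] by measurable
  have "FD = {x \<in> space borel. 0 \<le> cs x \<and> cs x < 1 \<and> 0 \<le> ct x \<and> ct x < 1}" using FD_iff by auto
  also have "\<dots> \<in> sets borel" by measurable
  finally show ?thesis .
qed

text \<open>Both orders of integration serve: a derivative along \<open>w1\<close> is integrated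
  first in a, one along \<open>w2\<close> first in b.\<close>

lemma FD_integral:
  fixes f :: "complex \<Rightarrow> real"
  assumes f: "bdd f"
  shows "(f has_integral (area * (\<integral>a. indicator {0..<1} a * (\<integral>b. indicator {0..<1} b * f (Tm (a, b)) \<partial>lborel) \<partial>lborel))) FD"
    and "(f has_integral (area * (\<integral>b. indicator {0..<1} b * (\<integral>a. indicator {0..<1} a * f (Tm (a, b)) \<partial>lborel) \<partial>lborel))) FD"
proof -
  obtain B where B: "\<And>x. \<bar>f x\<bar> \<le> B" and c: "continuous_on UNIV f" using f unfolding bdd_def by blast
  have [measurable]: "f \<in> borel_measurable borel" using c by (rule borel_measurable_continuous_onI)
  have m[measurable]: "Tm \<in> borel_measurable (lborel \<Otimes>\<^sub>M lborel)"
    unfolding Tm_def[abs_def] by measurable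
  note [measurable] = FD_borel
  let ?h = "\<lambda>z::real \<times> real. indicator ({0..<1} \<times> {0..<1}) z * f (Tm z)"
  have h: "?h z = indicator FD (Tm z) * f (Tm z)" for z
    using Tm_FD[of "fst z" "snd z"] by (auto simp: indicator_def mem_Times_iff)
  have fin: "emeasure (lborel \<Otimes>\<^sub>M lborel) ({0..<1::real} \<times> {0..<1::real}) < \<infinity>"
    by (subst lborel.emeasure_pair_measure_Times) auto
  have i: "integrable (lborel \<Otimes>\<^sub>M lborel) ?h"
  proof (rule Bochner_Integration.integrable_bound)
    show "integrable (lborel \<Otimes>\<^sub>M lborel) (\<lambda>z. B * indicator ({0..<1::real} \<times> {0..<1::real}) z :: real)"
      by (intro integrable_cm integrable_real_indicator fin) simp
    show "?h \<in> borel_measurable (lborel \<Otimes>\<^sub>M lborel)" by measurable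
    show "AE z in lborel \<Otimes>\<^sub>M lborel. norm (?h z) \<le> norm (B * indicator ({0..<1::real} \<times> {0..<1::real}) z :: real)"
    proof (intro AE_I2)
      fix z show "norm (?h z) \<le> norm (B * indicator ({0..<1::real} \<times> {0..<1::real}) z :: real)"
        using B[of "Tm z"] by (cases "z \<in> {0..<1} \<times> {0..<1}") auto
    qed
  qed
  have a0: "area \<ge> 0" using area_pos by simp
  have I: "integrable lborel (\<lambda>x. indicator FD x * f x)"
    unfolding lborel_Tm using i a0 by (subst integrable_density) (auto simp: integrable_distr_eq h[symmetric])
  have E: "(\<integral>x. indicator FD x * f x \<partial>lborel) = area * (\<integral>z. ?h z \<partial>(lborel \<Otimes>\<^sub>M lborel))"
    unfolding lborel_Tm using a0 by (subst integral_density) (auto simp: integral_distr h)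
  have hi: "(f has_integral (area * (\<integral>z. ?h z \<partial>(lborel \<Otimes>\<^sub>M lborel)))) FD"
  proof -
    have "(\<lambda>x. indicator FD x * f x) = (\<lambda>x. if x \<in> FD then f x else 0)" by (auto simp: indicator_def)
    thus ?thesis using has_integral_integral_lborel[OF I]
      unfolding E by (simp only: has_integral_restrict_UNIV)
  qed
  have "(\<integral>z. ?h z \<partial>(lborel \<Otimes>\<^sub>M lborel)) = (\<integral>a. \<integral>b. ?h (a, b) \<partial>lborel \<partial>lborel)"
    by (rule lborel_pair.integral_fst'[OF i, symmetric])
  also have "\<dots> = (\<integral>a. indicator {0..<1} a * (\<integral>b. indicator {0..<1} b * f (Tm (a, b)) \<partial>lborel) \<partial>lborel)"
    by (simp add: indicator_times mult.assoc)
  finally show "(f has_integral (area * (\<integral>a. indicator {0..<1} a * (\<integral>b. indicator {0..<1} b * f (Tm (a, b)) \<partial>lborel) \<partial>lborel))) FD"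
    using hi by simp
  have "(\<integral>z. ?h z \<partial>(lborel \<Otimes>\<^sub>M lborel)) = (\<integral>b. \<integral>a. ?h (a, b) \<partial>lborel \<partial>lborel)"
    by (rule lborel_pair.integral_snd_pair[OF i, symmetric])
  also have "\<dots> = (\<integral>b. indicator {0..<1} b * (\<integral>a. indicator {0..<1} a * f (Tm (a, b)) \<partial>lborel) \<partial>lborel)"
    by (simp add: indicator_times mult.assoc mult.left_commute)
  finally show "(f has_integral (area * (\<integral>b. indicator {0..<1} b * (\<integral>a. indicator {0..<1} a * f (Tm (a, b)) \<partial>lborel) \<partial>lborel))) FD"
    using hi by simp
qed

lemma FD_one: "((\<lambda>_. 1::real) has_integral area) FD"
proof -
  have b: "bdd (\<lambda>_. 1)" unfolding bdd_def by auto
  have i: "(\<integral>a. indicator {0..<1::real} a \<partial>lborel) = (1::real)" by simp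
  show ?thesis using FD_integral(1)[OF b] by (simp add: i)
qed

lemma measure_FD: "measure lebesgue FD = area"
proof -
  have "(\<lambda>_. 1::real) integrable_on FD" "integral FD (\<lambda>_. 1::real) = area"
    using FD_one by (auto simp: has_integral_iff)
  thus ?thesis using lmeasure_integral[of FD] lmeasurable_iff_integrable_on[of FD] by simp
qed

lemma integral_derivative_period:
  assumes D: "\<And>t. (F has_real_derivative f t) (at t)" and c: "continuous_on UNIV f" and p: "F 1 = F 0"
  shows "(\<integral>t. indicator {0..<1} t * f t \<partial>lborel) = (0::real)"
proof -
  have [measurable]: "f \<in> borel_measurable borel" using c by (rule borel_measurable_continuous_onI)
  have "(\<integral>t. indicator {0..<1} t * f t \<partial>lborel) = (\<integral>t. f t * indicator {0..1} t \<partial>lborel)"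
  proof (rule integral_cong_AE)
    show "AE t in lborel. indicator {0..<1} t * f t = f t * indicator {0..1} t"
      using AE_lborel_singleton[of 1] by (rule eventually_mono) (auto simp: indicator_def)
  qed measurable
  also have "\<dots> = F 1 - F 0"
    by (rule integral_FTC_Icc_real) (use D c in \<open>auto simp: continuous_on_eq_continuous_at\<close>)
  finally show ?thesis using p by simp
qed

text \<open>Integrating along \<open>w\<close> first leaves the difference of equal boundary values
  on every line.\<close>

lemma directional_integral_zero:
  assumes k: "per k" "Ck_on (Suc 0) UNIV k" and w: "w = w1 \<or> w = w2"
  shows "((\<lambda>x. Re w * dx k x + Im w * dy k x) has_integral 0) FD"
proof -
  note C = C1_per[OF k]
  let ?f = "\<lambda>x. Re w * dx k x + Im w * dy k x"
  have cf: "continuous_on UNIV ?f" using C(3,4) unfolding bdd_def by (auto intro!: continuous_intros)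
  have b: "bdd ?f"
    by (rule per_bdd[OF _ cf]) (use per_dx[OF k(1)] per_dy[OF k(1)] in \<open>simp add: doubly_periodic_def\<close>)
  have D: "((\<lambda>t. k (y + of_real t * w)) has_real_derivative ?f (y + of_real t * w)) (at t)" for y t
    by (rule pd_imp_directional[OF C(1)])
  have z: "(\<integral>t. indicator {0..<1} t * ?f (y + of_real t * w) \<partial>lborel) = 0" for y
  proof (rule integral_derivative_period[OF D])
    show "continuous_on UNIV (\<lambda>t. ?f (y + of_real t * w))"
      by (rule continuous_on_compose2[OF cf]) (auto intro!: continuous_intros)
    show "k (y + of_real 1 * w) = k (y + of_real 0 * w)"
      using w k(1) unfolding doubly_periodic_def by auto
  qed
  show ?thesis
  proof (cases "w = w1")
    case True
    have "Tm (a, b) = of_real b * w2 + of_real a * w" for a b by (simp add: Tm_def True add.commute)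
    thus ?thesis using FD_integral(2)[OF b] by (simp only: z) simp
  next
    case False
    hence "Tm (a, b) = of_real a * w1 + of_real b * w" for a b using w by (simp add: Tm_def)
    thus ?thesis using FD_integral(1)[OF b] by (simp only: z) simp
  qed
qed

lemma laplacian_integral_zero:
  assumes g: "per g" "Ck_on 2 UNIV g"
  shows "(laplacian g has_integral 0) FD"
proof -
  have S: "Ck_on (Suc (Suc 0)) UNIV g" using g(2) by (simp only: numeral_2_eq_2)
  note C = C1_per(5,6)[OF g(1) S]
  let ?D = "Im (cnj w1 * w2)"
  have i: "((\<lambda>x. c * (Re w * dx k x + Im w * dy k x)) has_integral c * 0) FD"
    if "w = w1 \<or> w = w2" "k = dx g \<or> k = dy g" for c w k
    using that C per_dx[OF g(1)] per_dy[OF g(1)] by (intro has_integral_mult_right directional_integral_zero) auto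
  \<comment> \<open>The coefficients invert the matrix of periods: they express the two coordinate
    derivatives through those along \<open>w1\<close> and \<open>w2\<close>, applied to
    \<open>dx g\<close> and \<open>dy g\<close>.\<close>
  have "((\<lambda>x. (Im w2 / ?D) * (Re w1 * dx (dx g) x + Im w1 * dy (dx g) x)
      + (- Im w1 / ?D) * (Re w2 * dx (dx g) x + Im w2 * dy (dx g) x)
      + (- Re w2 / ?D) * (Re w1 * dx (dy g) x + Im w1 * dy (dy g) x)
      + (Re w1 / ?D) * (Re w2 * dx (dy g) x + Im w2 * dy (dy g) x)) has_integral
      (Im w2 / ?D) * 0 + (- Im w1 / ?D) * 0 + (- Re w2 / ?D) * 0 + (Re w1 / ?D) * 0) FD"
    by (intro has_integral_add i) auto
  moreover have "(Im w2 / ?D) * (Re w1 * a + Im w1 * b) + (- Im w1 / ?D) * (Re w2 * a + Im w2 * b)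
      + (- Re w2 / ?D) * (Re w1 * c + Im w1 * d) + (Re w1 / ?D) * (Re w2 * c + Im w2 * d) = a + d" for a b c d
    using indep by (simp add: divide_simps) (simp add: algebra_simps)
  ultimately show ?thesis unfolding laplacian_def[abs_def] by simp
qed

end

section \<open>Solutions and the critical value\<close>

context torus
begin

lemma zero_Lam: "0 \<in> Lam"
  unfolding period_lattice_def by (auto intro!: exI[of _ 0])

lemma cc_pos: "(\<Sum>j<m. n j) > 0 \<Longrightarrow> cc m n > 0"
proof -
  assume "(\<Sum>j<m. n j) > 0"
  hence "0 < real (\<Sum>j<m. n j)" by (simp only: of_nat_0_less_iff)
  thus ?thesis unfolding cc_def using area_pos by (intro divide_pos_pos mult_pos_pos) auto
qed

lemma weight_W:
  assumes N: "(\<Sum>j<m. n j) > 0"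
  shows "weight w1 w2 (W m p n) (cc m n)"
proof
  show "Ck_on k UNIV (W m p n)" for k by (rule W_Ck)
  show "per (W m p n)" by (rule W_per)
  show "0 \<le> W m p n x" for x by (rule W_nonneg)
  show "countable {x. W m p n x = 0}"
  proof (rule countable_subset[OF _ countable_sing])
    show "{x. W m p n x = 0} \<subseteq> sing m p" by (auto simp: W_zero sing_iff)
  qed
  show "laplacian (\<lambda>x. ln (W m p n x)) x = - cc m n" if "0 < W m p n x" for x
    by (rule laplacian_ln_W[OF that])
  obtain j where "j < m" "n j > 0" using N by (metis lessThan_iff not_gr_zero sum.neutral)
  hence "W m p n (p j) = 0" unfolding W_zero using zero_Lam by auto
  thus "\<exists>x. W m p n x = 0" by blast
  show "cc m n > 0" by (rule cc_pos[OF N])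
qed

section \<open>Passage between solutions and the reduced equation\<close>

lemma Ck_cmod_sq_shift: "Ck_on k S (\<lambda>x. (cmod (x - a))\<^sup>2)"
  by (rule Ck_on_subset[OF Ck_on_cmod_sq_holomorphic[of "\<lambda>x. x - a" UNIV]]) (auto intro!: holomorphic_intros)

text \<open>Both sides describe the limit by the same predicate, so convergence need not be
  known.\<close>

lemma Lim_shift:
  fixes f :: "complex \<Rightarrow> real"
  assumes "\<And>y. f (y + l) = f y"
  shows "Lim (at (x + l)) f = Lim (at x) f"
proof -
  have "f (x + l + h) = f (x + h)" for h using assms[of "x + h"] by (simp add: algebra_simps)
  hence "(f \<longlongrightarrow> L) (at (x + l)) \<longleftrightarrow> (f \<longlongrightarrow> L) (at x)" for L
    using LIM_offset_zero_iff[of "x + l" f L] LIM_offset_zero_iff[of x f L] by simp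
  thus ?thesis unfolding t2_space_class.Lim_def by simp
qed

text \<open>The function \<open>u - e\<^sup>u - ln W\<close> has removable singularities; its continuous extension is
  the solution of the reduced equation.\<close>

lemma solution_to_rsol:
  assumes adm: "admissible_data w1 w2 m p" and N: "(\<Sum>j<m. n j) > 0"
    and sol: "is_negative_solution w1 w2 lam m p n u"
  shows "\<exists>g. weight.rsol w1 w2 (W m p n) (cc m n) lam g \<and>
    (\<forall>x. x \<notin> sing m p \<longrightarrow> Phi (W m p n x * exp (g x)) = exp (u x) * (exp (u x) - 1)\<^sup>2)"
proof -
  interpret W: weight w1 w2 "W m p n" "cc m n" by (rule weight_W[OF N])
  have u: "per u" "\<And>k. Ck_on k (- sing m p) u"
    "\<And>x. x \<notin> sing m p \<Longrightarrow> (1 - exp (u x)) * laplacian u x - exp (u x) * grad_sq u x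
           = - lam * exp (u x) * (exp (u x) - 1)\<^sup>2"
    "\<And>j. j < m \<Longrightarrow> \<exists>r>0. \<exists>f. smooth_on (ball (p j) r) f \<and>
         (\<forall>x\<in>ball (p j) r - {p j}. u x = real (n j) * ln ((cmod (x - p j))\<^sup>2) + f x)"
    "\<And>x. x \<notin> sing m p \<Longrightarrow> u x < 0"
    using sol unfolding is_negative_solution_def is_solution_def smooth_on_def by blast+
  let ?S = "- sing m p"
  have Wp: "W m p n x > 0" if "x \<in> ?S" for x using W_pos_off_sing that by simp
  define G where "G x = u x - exp (u x) - ln (W m p n x)" for x
  \<comment> \<open>The limit ignores the value of \<open>G\<close> at the point itself, which is
    arbitrary at singularities; using it everywhere makes g periodic at once.\<close>
  define g where "g x = Lim (at x) G" for x
  have CW: "Ck_on k ?S (\<lambda>x. ln (W m p n x))" for k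
    by (rule Ck_on_ln[OF Ck_on_subset[OF W_Ck]]) (use Wp in auto)
  have CE: "Ck_on k ?S (\<lambda>x. u x - exp (u x))" for k by (intro Ck_on_diff Ck_on_exp u(2))
  have CG: "Ck_on k ?S G" for k unfolding G_def[abs_def] by (intro Ck_on_diff CE CW)
  have gG: "g x = G x" if "x \<in> ?S" for x
  proof -
    have "isCont G x" using Ck_on_imp_continuous[OF CG[of 0]] open_off_sing that
      by (simp add: continuous_on_eq_continuous_at)
    thus ?thesis unfolding g_def isCont_def by (intro tendsto_Lim) auto
  qed
  have perG: "G (x + w1) = G x" "G (x + w2) = G x" for x
    using u(1) W_per[of m p n] unfolding G_def doubly_periodic_def by simp_all
  have pg: "per g" unfolding doubly_periodic_def g_def
    using Lim_shift[of G w1] Lim_shift[of G w2] perG by simp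
  have loc: "\<exists>r>0. \<exists>h. (\<forall>k. Ck_on k (ball (p j) r) h) \<and> (\<forall>x\<in>ball (p j) r. g x = h x)" if j: "j < m" for j
  proof -
    obtain r1 f where f: "r1 > 0" "\<And>k. Ck_on k (ball (p j) r1) f"
      "\<And>x. x \<in> ball (p j) r1 - {p j} \<Longrightarrow> u x = real (n j) * ln ((cmod (x - p j))\<^sup>2) + f x"
      using u(4)[OF j] unfolding smooth_on_def by blast
    obtain r2 w where w: "r2 > 0" "\<And>k. Ck_on k (ball (p j) r2) w"
      "\<And>x. x \<in> ball (p j) r2 - {p j} \<Longrightarrow> x \<notin> sing m p \<and> W m p n x = ((cmod (x - p j))\<^sup>2) ^ n j * exp (w x)"
      using W_local[OF adm j] by blast
    define r where "r = min r1 r2"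
    have r: "r > 0" "ball (p j) r \<subseteq> ball (p j) r1" "ball (p j) r \<subseteq> ball (p j) r2"
      using f(1) w(1) by (auto simp: r_def)
    \<comment> \<open>What remains of u - exp u - ln W when the logarithms cancel; near
      \<open>p j\<close>, exp u is |x - p_j|^(2 n_j) exp f, which extends smoothly.\<close>
    define h where "h x = f x - ((cmod (x - p j))\<^sup>2) ^ n j * exp (f x) - w x" for x
    have Ch: "Ck_on k (ball (p j) r) h" for k unfolding h_def[abs_def]
      by (intro Ck_on_diff Ck_on_mult Ck_on_exp Ck_on_power Ck_cmod_sq_shift
          Ck_on_subset[OF f(2) r(2)] Ck_on_subset[OF w(2) r(3)])
    have Gh: "G x = h x" if x: "x \<in> ball (p j) r - {p j}" for x
    proof -
      have x1: "x \<in> ball (p j) r1 - {p j}" and x2: "x \<in> ball (p j) r2 - {p j}" using x r by auto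
      have pos: "(cmod (x - p j))\<^sup>2 > 0" using x by simp
      have eu: "exp (u x) = ((cmod (x - p j))\<^sup>2) ^ n j * exp (f x)"
        unfolding f(3)[OF x1] using pos by (simp add: exp_add exp_of_nat_mult)
      have "ln (W m p n x) = real (n j) * ln ((cmod (x - p j))\<^sup>2) + w x"
        using w(3)[OF x2] pos by (simp add: ln_mult ln_realpow)
      thus ?thesis unfolding G_def h_def eu using f(3)[OF x1] by simp
    qed
    have "g x = h x" if x: "x \<in> ball (p j) r" for x
    proof (cases "x = p j")
      case True
      have "isCont h (p j)" using Ck_on_imp_continuous[OF Ch[of 0]] r(1)
        by (simp add: continuous_on_eq_continuous_at)
      hence "(h \<longlongrightarrow> h (p j)) (at (p j))" unfolding isCont_def .
      moreover have "\<forall>\<^sub>F y in at (p j). h y = G y"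
        unfolding eventually_at using r(1) Gh by (intro exI[of _ r]) (auto simp: dist_commute)
      ultimately have "(G \<longlongrightarrow> h (p j)) (at (p j))" by (rule Lim_transform_eventually)
      thus ?thesis unfolding g_def True by (intro tendsto_Lim) auto
    next
      case False
      hence "x \<in> ball (p j) r - {p j}" using x by simp
      thus ?thesis using gG[of x] Gh[of x] w(3)[of x] r(3) by auto
    qed
    thus ?thesis using r(1) Ch by blast
  qed
  have Cg: "Ck_on k UNIV g" for k
  proof (rule Ck_on_local[OF open_UNIV])
    fix x
    show "\<exists>T. open T \<and> x \<in> T \<and> Ck_on k T g"
    proof (cases "x \<in> ?S")
      case True
      thus ?thesis using Ck_on_cong[OF CG open_off_sing gG[symmetric]] open_off_sing by blast
    next
      case False
      then obtain j where j: "j < m" and l: "x - p j \<in> Lam" unfolding sing_iff Compl_iff by blast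
      obtain r h where h: "r > 0" "\<And>k. Ck_on k (ball (p j) r) h" "\<And>x. x \<in> ball (p j) r \<Longrightarrow> g x = h x"
        using loc[OF j] by blast
      \<comment> \<open>Every singular point is a lattice translate of some \<open>p j\<close>, so
        the chart at \<open>p j\<close> is moved to x by periodicity.\<close>
      let ?l = "x - p j"
      have b: "{y. y + - ?l \<in> ball (p j) r} = ball x r" by (auto simp: dist_norm algebra_simps)
      have "Ck_on k (ball x r) (\<lambda>y. h (y + - ?l))" using Ck_on_shift[OF h(2), of k "- ?l"] unfolding b .
      moreover have "h (y + - ?l) = g y" if "y \<in> ball x r" for y
      proof -
        have "g y = g ((y + - ?l) + ?l)" by simp
        also have "\<dots> = g (y + - ?l)" by (rule per_Lam[OF pg l])
        also have "\<dots> = h (y + - ?l)" by (rule h(3)) (use that b in blast)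
        finally show ?thesis ..
      qed
      ultimately have "Ck_on k (ball x r) g" by (rule Ck_on_cong[OF _ open_ball])
      thus ?thesis using h(1) by (intro exI[of _ "ball x r"]) auto
    qed
  qed
  have s: "W m p n x * exp (g x) = exp (u x) * exp (- exp (u x))" if "x \<in> ?S" for x
  proof -
    have "exp (G x) = exp (u x) * exp (- exp (u x)) * inverse (W m p n x)"
      unfolding G_def using Wp[OF that] by (simp add: exp_diff exp_minus divide_inverse)
    thus ?thesis unfolding gG[OF that] using Wp[OF that] by simp
  qed
  have Ps: "Phi (W m p n x * exp (g x)) = exp (u x) * (exp (u x) - 1)\<^sup>2" if "x \<in> ?S" for x
  proof -
    have y: "exp (u x) \<le> 1" using u(5)[of x] that by simp
    have "exp (u x) * exp (- exp (u x)) \<le> 1 * exp (-1)"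
      using yexp_strict[of "exp (u x)" 1] y by (cases "exp (u x) = 1") auto
    thus ?thesis unfolding s[OF that] Phi_def th_eq[OF y] by (simp add: power2_commute)
  qed
  have lapS: "laplacian g x = - W.Fs lam g x" if x: "x \<in> ?S" for x
  proof -
    have "laplacian g x = laplacian G x" by (rule laplacian_cong_open[OF open_off_sing x gG])
    also have "\<dots> = laplacian (\<lambda>x. u x - exp (u x)) x - laplacian (\<lambda>x. ln (W m p n x)) x"
      unfolding G_def[abs_def] by (rule laplacian_diff[OF CE CW open_off_sing x])
    also have "laplacian (\<lambda>x. ln (W m p n x)) x = - cc m n" by (rule laplacian_ln_W[OF Wp[OF x]])
    also have "laplacian (\<lambda>x. u x - exp (u x)) x = (1 - exp (u x)) * laplacian u x + (- exp (u x)) * grad_sq u x"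
      by (rule laplacian_compose[OF u(2) open_off_sing x, where \<psi> = "\<lambda>t. t - exp t" and \<psi>' = "\<lambda>t. 1 - exp t"])
         (auto intro!: derivative_eq_intros)
    also have "\<dots> = - lam * exp (u x) * (exp (u x) - 1)\<^sup>2" using u(3)[of x] x by simp
    finally show ?thesis unfolding W.Fs_def Ps[OF x] by simp
  qed
  have c1: "continuous_on UNIV (laplacian g)" by (rule continuous_on_laplacian[OF Cg open_UNIV])
  have c2: "continuous_on UNIV (\<lambda>x. - W.Fs lam g x)"
    by (intro continuous_intros W.Fs_cont Ck_on_imp_continuous[OF Cg[of 0]])
  have cS: "countable (- ?S)" using countable_sing by simp
  have "laplacian g x = - W.Fs lam g x" for x
    using le_if_le_off_countable[OF c1 c2 cS, of x] le_if_le_off_countable[OF c2 c1 cS, of x] lapS by (intro antisym) auto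
  hence "W.rsol lam g" unfolding W.rsol_def using pg Cg by blast
  thus ?thesis using Ps by blast
qed

text \<open>Inverts v = u - exp u: from exp v = W exp g the value E = \<open>th (exp v)\<close> is
  exp u, and u = v + E. Strictness yields both E < 1, hence u < 0, and smoothness of E.\<close>

lemma rsol_to_solution:
  assumes adm: "admissible_data w1 w2 m p" and N: "(\<Sum>j<m. n j) > 0" and lam: "lam > 0"
    and r: "weight.rsol w1 w2 (W m p n) (cc m n) lam g"
  shows "\<exists>u. is_negative_solution w1 w2 lam m p n u"
proof -
  interpret W: weight w1 w2 "W m p n" "cc m n" by (rule weight_W[OF N])
  have Cg: "Ck_on k UNIV g" for k by (rule W.rsol_smooth[OF r lam])
  have g: "per g" "\<And>x. laplacian g x = - W.Fs lam g x" using r unfolding W.rsol_def by auto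
  define s where "s x = W m p n x * exp (g x)" for x
  have slt: "s x < exp (-1)" for x unfolding s_def by (rule W.rsol_strict[OF r lam])
  define E where "E x = th (s x)" for x
  have CE: "Ck_on k UNIV E" for k unfolding E_def[abs_def] s_def
    by (intro Ck_th open_UNIV Ck_on_mult W_Ck Ck_on_exp Cg slt[unfolded s_def])
  have E1: "E x < 1" for x unfolding E_def by (rule th_lt_1[OF slt])
  have Es: "E x * exp (- E x) = s x" for x unfolding E_def by (rule th_inv[OF less_imp_le[OF slt]])
  define u where "u x = ln (W m p n x) + (g x + E x)" for x
  let ?S = "- sing m p"
  have Wp: "W m p n x > 0" if "x \<in> ?S" for x using W_pos_off_sing that by simp
  have eu: "exp (u x) = E x" if "x \<in> ?S" for x
  proof -
    have "exp (u x) = s x * exp (E x)" using Wp[OF that] by (simp add: u_def s_def exp_add)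
    also have "\<dots> = E x" unfolding Es[of x, symmetric] by (simp add: exp_minus)
    finally show ?thesis .
  qed
  have CW: "Ck_on k ?S (\<lambda>x. ln (W m p n x))" for k
    by (rule Ck_on_ln[OF Ck_on_subset[OF W_Ck]]) (use Wp in auto)
  have CgS: "Ck_on k ?S g" for k by (rule Ck_on_subset[OF Cg]) simp
  have Cu: "Ck_on k ?S u" for k unfolding u_def[abs_def]
    by (intro Ck_on_add CW CgS Ck_on_subset[OF CE]) simp
  have per: "per u"
    using g(1) W_per[of m p n] unfolding doubly_periodic_def u_def E_def s_def by simp
  have eqn: "(1 - exp (u x)) * laplacian u x - exp (u x) * grad_sq u x = - lam * exp (u x) * (exp (u x) - 1)\<^sup>2"
    if x: "x \<in> ?S" for x
  proof -
    have "(1 - exp (u x)) * laplacian u x + (- exp (u x)) * grad_sq u x = laplacian (\<lambda>x. u x - exp (u x)) x"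
      by (rule laplacian_compose[OF Cu open_off_sing x, where \<psi> = "\<lambda>t. t - exp t" and \<psi>' = "\<lambda>t. 1 - exp t", symmetric])
         (auto intro!: derivative_eq_intros)
    also have "\<dots> = laplacian (\<lambda>x. ln (W m p n x) + g x) x"
      by (rule laplacian_cong_open[OF open_off_sing x]) (simp add: eu, simp add: u_def)
    also have "\<dots> = - cc m n + - W.Fs lam g x"
      unfolding laplacian_add[OF CW CgS open_off_sing x] laplacian_ln_W[OF Wp[OF x]] g(2) ..
    also have "\<dots> = - (lam * Phi (s x))" by (simp add: W.Fs_def s_def)
    also have "Phi (s x) = E x * (1 - E x)\<^sup>2" unfolding Phi_def E_def using slt[of x] by simp
    finally show ?thesis unfolding eu[OF x] by (simp add: power2_commute mult.assoc)
  qed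
  have loc: "\<exists>r>0. \<exists>f. smooth_on (ball (p j) r) f \<and>
         (\<forall>x\<in>ball (p j) r - {p j}. u x = real (n j) * ln ((cmod (x - p j))\<^sup>2) + f x)" if j: "j < m" for j
  proof -
    obtain r w where w: "r > 0" "\<And>k. Ck_on k (ball (p j) r) w"
      "\<And>x. x \<in> ball (p j) r - {p j} \<Longrightarrow> x \<notin> sing m p \<and> W m p n x = ((cmod (x - p j))\<^sup>2) ^ n j * exp (w x)"
      using W_local[OF adm j] by blast
    have "smooth_on (ball (p j) r) (\<lambda>x. w x + (g x + E x))" unfolding smooth_on_def
      by (intro allI Ck_on_add w(2) Ck_on_subset[OF Cg] Ck_on_subset[OF CE]) auto
    moreover have "u x = real (n j) * ln ((cmod (x - p j))\<^sup>2) + (w x + (g x + E x))" if x: "x \<in> ball (p j) r - {p j}" for x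
    proof -
      have pos: "(cmod (x - p j))\<^sup>2 > 0" using x by simp
      have "ln (W m p n x) = real (n j) * ln ((cmod (x - p j))\<^sup>2) + w x"
        using w(3)[OF x] pos by (simp add: ln_mult ln_realpow)
      thus ?thesis by (simp add: u_def)
    qed
    ultimately show ?thesis using w(1) by blast
  qed
  have neg: "u x < 0" if "x \<in> ?S" for x
  proof -
    have "exp (u x) < exp 0" using eu[OF that] E1[of x] by simp
    thus ?thesis by (simp only: exp_less_cancel_iff)
  qed
  have "is_negative_solution w1 w2 lam m p n u"
    unfolding is_negative_solution_def is_solution_def smooth_on_def
    using per Cu eqn loc[unfolded smooth_on_def] neg by simp
  thus ?thesis by blast
qed

text \<open>The constant \<open>cc m n\<close> times the area is 4 pi N. The singular set, on which
  u takes arbitrary values, is countable and hence negligible.\<close>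

lemma solution_integral:
  assumes adm: "admissible_data w1 w2 m p" and N: "(\<Sum>j<m. n j) > 0"
    and sol: "is_negative_solution w1 w2 lam m p n u"
  shows "lam * integral FD (\<lambda>x. exp (u x) * (exp (u x) - 1)\<^sup>2) = 4 * pi * real (\<Sum>j<m. n j)"
proof -
  interpret W: weight w1 w2 "W m p n" "cc m n" by (rule weight_W[OF N])
  obtain g where g: "W.rsol lam g"
    "\<And>x. x \<notin> sing m p \<Longrightarrow> Phi (W m p n x * exp (g x)) = exp (u x) * (exp (u x) - 1)\<^sup>2"
    using solution_to_rsol[OF adm N sol] by blast
  have rg: "per g" "Ck_on 2 UNIV g" "\<And>x. laplacian g x = - W.Fs lam g x" using g(1) unfolding W.rsol_def by auto
  have c: "((\<lambda>_. cc m n * 1) has_integral cc m n * area) FD"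
    by (rule has_integral_mult_right[OF FD_one])
  have "((\<lambda>x. cc m n * 1 - laplacian g x) has_integral cc m n * area - 0) FD"
    by (rule has_integral_diff[OF c laplacian_integral_zero[OF rg(1,2)]])
  hence i: "((\<lambda>x. lam * Phi (W m p n x * exp (g x))) has_integral cc m n * area) FD"
    by (simp add: rg(3) W.Fs_def)
  have "((\<lambda>x. lam * (exp (u x) * (exp (u x) - 1)\<^sup>2)) has_integral cc m n * area) FD"
  proof (rule has_integral_spike[OF _ _ i])
    show "negligible (sing m p)" 
      unfolding negligible_iff_null_sets
      by (rule null_sets_completionI[OF countable_imp_null_set_lborel[OF countable_sing]])
    show "lam * (exp (u x) * (exp (u x) - 1)\<^sup>2) = lam * Phi (W m p n x * exp (g x))" if "x \<in> FD - sing m p" for x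
      using g(2) that by simp
  qed
  from integral_unique[OF this] show ?thesis
    using area_pos by (simp add: cc_def)
qed

section \<open>The set of solvable parameters and its infimum\<close>

definition solvable :: "nat \<Rightarrow> (nat \<Rightarrow> complex) \<Rightarrow> (nat \<Rightarrow> nat) \<Rightarrow> real set" where
  "solvable m p n = {lam. 0 < lam \<and> (\<exists>u. is_negative_solution w1 w2 lam m p n u)}"

lemma solvable_iff:
  assumes "admissible_data w1 w2 m p" "(\<Sum>j<m. n j) > 0"
  shows "lam \<in> solvable m p n \<longleftrightarrow> 0 < lam \<and> (\<exists>g. weight.rsol w1 w2 (W m p n) (cc m n) lam g)"
  unfolding solvable_def using solution_to_rsol[OF assms] rsol_to_solution[OF assms] by blast

lemma W_split:
  assumes "\<forall>j<m. n j \<le> n' j"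
  shows "W m p n' x = W m p n x * W m p (\<lambda>j. n' j - n j) x"
  unfolding W_def prod.distrib[symmetric]
  by (rule prod.cong[OF refl]) (use assms in \<open>simp add: power_add[symmetric]\<close>)

lemma cc_split:
  assumes "\<forall>j<m. n j \<le> n' j"
  shows "cc m (\<lambda>j. n' j - n j) = cc m n' - cc m n"
proof -
  have "(\<Sum>j<m. n' j) = (\<Sum>j<m. n j) + (\<Sum>j<m. n' j - n j)"
    unfolding sum.distrib[symmetric] by (rule sum.cong[OF refl]) (use assms in simp)
  thus ?thesis unfolding cc_def by (simp add: distrib_left add_divide_distrib)
qed

text \<open>Serves twice: with equal multiplicities it shows that the solvable parameters form an
  up-set, with different ones it compares critical values. The weight of \<open>n' - n\<close> is
  the factor D of \<open>rsol_compare\<close>.\<close>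

lemma solvable_compare:
  assumes adm: "admissible_data w1 w2 m p" and N: "(\<Sum>j<m. n j) > 0" and le: "\<forall>j<m. n j \<le> n' j"
    and l: "lam' \<in> solvable m p n'" "lam' < lam"
  shows "lam \<in> solvable m p n"
proof -
  have "(\<Sum>j<m. n j) \<le> (\<Sum>j<m. n' j)" by (rule sum_mono) (use le in simp)
  hence N': "(\<Sum>j<m. n' j) > 0" using N by linarith
  let ?d = "\<lambda>j. n' j - n j"
  obtain g' where g': "0 < lam'" "weight.rsol w1 w2 (W m p n') (cc m n') lam' g'"
    using l(1) unfolding solvable_iff[OF adm N'] by blast
  have "\<exists>g. weight.rsol w1 w2 (W m p n) (cc m n) lam g"
  proof (rule rsol_compare[OF weight_W[OF N] weight_W[OF N'] W_Ck W_per W_nonneg _ _ W_split[OF le] _ g'(1) l(2) g'(2)])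
    show "countable {x. W m p ?d x = 0}"
    proof (rule countable_subset[OF _ countable_sing])
      show "{x. W m p ?d x = 0} \<subseteq> sing m p" by (auto simp: W_zero sing_iff)
    qed
    show "laplacian (\<lambda>x. ln (W m p ?d x)) x = - (cc m n' - cc m n)" if "0 < W m p ?d x" for x
      unfolding laplacian_ln_W[OF that] cc_split[OF le] ..
    have "0 \<le> cc m ?d" unfolding cc_def
      by (intro divide_nonneg_pos mult_nonneg_nonneg of_nat_0_le_iff area_pos) auto
    thus "cc m n \<le> cc m n'" unfolding cc_split[OF le] by simp
  qed
  thus ?thesis using solvable_iff[OF adm N] g'(1) l(2) by auto
qed

definition lam_crit :: "nat \<Rightarrow> (nat \<Rightarrow> complex) \<Rightarrow> (nat \<Rightarrow> nat) \<Rightarrow> real" where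
  "lam_crit m p n = Inf (solvable m p n)"

lemma solvable_bound:
  assumes "admissible_data w1 w2 m p" "(\<Sum>j<m. n j) > 0" "lam \<in> solvable m p n"
  shows "27 * cc m n / 4 \<le> lam"
  using assms(3) unfolding solvable_iff[OF assms(1,2)]
  using weight.rsol_lower_bound[OF weight_W[OF assms(2)]] by blast

lemma solvable_nonempty:
  assumes "admissible_data w1 w2 m p" "(\<Sum>j<m. n j) > 0" shows "solvable m p n \<noteq> {}"
  using weight.rsol_exists[OF weight_W[OF assms(2), of p]] solvable_iff[OF assms] by blast

lemma solvable_bdd_below:
  assumes "admissible_data w1 w2 m p" "(\<Sum>j<m. n j) > 0" shows "bdd_below (solvable m p n)"
  using solvable_bound[OF assms] by (rule bdd_belowI)

lemma lam_crit_bound: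
  assumes "admissible_data w1 w2 m p" "(\<Sum>j<m. n j) > 0"
  shows "27 * pi * real (\<Sum>j<m. n j) / measure lebesgue FD \<le> lam_crit m p n"
proof -
  have "27 * cc m n / 4 \<le> lam_crit m p n"
    unfolding lam_crit_def by (rule cInf_greatest[OF solvable_nonempty[OF assms] solvable_bound[OF assms]])
  thus ?thesis unfolding cc_def measure_FD by simp
qed

text \<open>Above the infimum the up-set property applies; the infimum itself is attained by
  closedness along a sequence decreasing to it, and the lower bound 27 c / 4 keeps it
  positive.\<close>

lemma lam_crit_solvable:
  assumes "admissible_data w1 w2 m p" "(\<Sum>j<m. n j) > 0"
  shows "lam \<in> solvable m p n \<longleftrightarrow> lam_crit m p n \<le> lam"
proof
  show "lam_crit m p n \<le> lam" if "lam \<in> solvable m p n"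
    unfolding lam_crit_def by (rule cInf_lower[OF that solvable_bdd_below[OF assms]])
next
  assume le: "lam_crit m p n \<le> lam"
  let ?l = "lam_crit m p n"
  have above: "x \<in> solvable m p n" if x: "?l < x" for x
  proof -
    obtain y where "y \<in> solvable m p n" "y < x"
      using cInf_lessD[OF solvable_nonempty[OF assms] x[unfolded lam_crit_def]] by blast
    thus ?thesis using solvable_compare[OF assms, of n y x] by simp
  qed
  have "27 * cc m n / 4 \<le> ?l"
    unfolding lam_crit_def by (rule cInf_greatest[OF solvable_nonempty[OF assms] solvable_bound[OF assms]])
  hence l0: "?l > 0" using cc_pos[OF assms(2)] by linarith
  show "lam \<in> solvable m p n"
  proof (cases "?l < lam")
    case False
    hence e: "lam = ?l" using le by simp
    define ls where "ls k = ?l + 1 / real (Suc k)" for k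
    have "\<exists>g. weight.rsol w1 w2 (W m p n) (cc m n) (ls k) g" for k
      using above[of "ls k"] unfolding solvable_iff[OF assms] by (simp add: ls_def)
    then obtain gs where gs: "\<And>k. weight.rsol w1 w2 (W m p n) (cc m n) (ls k) (gs k)" by metis
    have "ls \<longlonglongrightarrow> ?l + 0" unfolding ls_def[abs_def] by (intro tendsto_intros LIMSEQ_inverse_real_of_nat[unfolded inverse_eq_divide])
    hence "\<exists>g. weight.rsol w1 w2 (W m p n) (cc m n) ?l g"
      by (intro weight.rsol_closed[OF weight_W[OF assms(2)], of ls _ "?l + 1" p gs] gs)
         (use l0 in \<open>auto simp: ls_def add_pos_pos\<close>)
    thus ?thesis unfolding e solvable_iff[OF assms] using l0 by blast
  qed (rule above)
qed

text \<open>The comparison costs a strict increase of lam, so it is applied at the critical value of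
  \<open>n'\<close> plus e, for every e > 0.\<close>

lemma lam_crit_mono:
  assumes adm: "admissible_data w1 w2 m p" and N: "(\<Sum>j<m. n j) > 0" and le: "\<forall>j<m. n j \<le> n' j"
  shows "lam_crit m p n \<le> lam_crit m p n'"
proof (rule field_le_epsilon)
  fix e :: real assume e: "e > 0"
  have "(\<Sum>j<m. n j) \<le> (\<Sum>j<m. n' j)" by (rule sum_mono) (use le in simp)
  hence N': "(\<Sum>j<m. n' j) > 0" using N by linarith
  have "lam_crit m p n' \<in> solvable m p n'" unfolding lam_crit_solvable[OF adm N'] ..
  from solvable_compare[OF adm N le this, of "lam_crit m p n' + e"]
  show "lam_crit m p n \<le> lam_crit m p n' + e" using e lam_crit_solvable[OF adm N] by simp
qed

end

text \<open>One witness serves all clauses; the clause for multiplicities with positive sum fixes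
  its meaning for the data with zeros that the monotonicity clause compares.\<close>

theorem theorem3p1:
  fixes w1 w2 :: complex
  assumes indep: "Im (cnj w1 * w2) \<noteq> 0"
  shows "\<exists>lam_c :: nat \<Rightarrow> (nat \<Rightarrow> complex) \<Rightarrow> (nat \<Rightarrow> nat) \<Rightarrow> real.
     (\<forall>m p n. admissible_data w1 w2 m p \<and> (\<forall>j<m. n j > 0) \<and> m > 0 \<longrightarrow>
        lam_c m p n \<ge> 27 * pi * real (\<Sum>j<m. n j) / measure lebesgue (fund_dom w1 w2)
      \<and> (\<forall>lam>0. (\<exists>u. is_negative_solution w1 w2 lam m p n u) \<longleftrightarrow> lam \<ge> lam_c m p n)
      \<and> (\<forall>lam>0. \<forall>u. is_negative_solution w1 w2 lam m p n u \<longrightarrow>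
           lam * integral (fund_dom w1 w2) (\<lambda>x. exp (u x) * (exp (u x) - 1)\<^sup>2)
             = 4 * pi * real (\<Sum>j<m. n j)))
   \<and> (\<forall>m p n. admissible_data w1 w2 m p \<and> (\<Sum>j<m. n j) > 0 \<longrightarrow>
        (\<forall>lam>0. (\<exists>u. is_negative_solution w1 w2 lam m p n u) \<longleftrightarrow> lam \<ge> lam_c m p n))
   \<and> (\<forall>m p n n'. admissible_data w1 w2 m p \<and> (\<Sum>j<m. n j) > 0 \<and> (\<forall>j<m. n j \<le> n' j) \<longrightarrow>
        lam_c m p n \<le> lam_c m p n')"
proof -
  interpret torus w1 w2 by unfold_locales (rule indep)
  have iff: "(\<exists>u. is_negative_solution w1 w2 lam m p n u) \<longleftrightarrow> lam \<ge> lam_crit m p n"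
    if "admissible_data w1 w2 m p" "(\<Sum>j<m. n j) > 0" "lam > 0" for m p n lam
    using lam_crit_solvable[OF that(1,2), of lam] that(3) unfolding solvable_def by simp
  have pos: "(\<Sum>j<m. n j) > 0" if "\<forall>j<m. n j > 0" "m > 0" for m and n :: "nat \<Rightarrow> nat"
    using that by (intro sum_pos) auto
  show ?thesis
  proof (intro exI[of _ lam_crit] conjI allI impI; (elim conjE)?)
    fix m p and n :: "nat \<Rightarrow> nat" assume a: "admissible_data w1 w2 m p" "\<forall>j<m. n j > 0" "m > (0::nat)"
    note N = pos[OF a(2,3)]
    show "lam_crit m p n \<ge> 27 * pi * real (\<Sum>j<m. n j) / measure lebesgue (fund_dom w1 w2)"
      by (rule lam_crit_bound[OF a(1) N])
    show "(\<exists>u. is_negative_solution w1 w2 lam m p n u) \<longleftrightarrow> lam \<ge> lam_crit m p n" if "lam > 0" for lam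
      by (rule iff[OF a(1) N that])
    show "lam * integral (fund_dom w1 w2) (\<lambda>x. exp (u x) * (exp (u x) - 1)\<^sup>2) = 4 * pi * real (\<Sum>j<m. n j)"
      if "is_negative_solution w1 w2 lam m p n u" for lam u
      by (rule solution_integral[OF a(1) N that])
  next
    fix m p and n :: "nat \<Rightarrow> nat" and lam :: real
    assume a: "admissible_data w1 w2 m p" "(\<Sum>j<m. n j) > 0" "lam > 0"
    show "(\<exists>u. is_negative_solution w1 w2 lam m p n u) \<longleftrightarrow> lam \<ge> lam_crit m p n" by (rule iff[OF a])
  next
    fix m p and n n' :: "nat \<Rightarrow> nat"
    assume a: "admissible_data w1 w2 m p" "(\<Sum>j<m. n j) > 0" "\<forall>j<m. n j \<le> n' j"
    show "lam_crit m p n \<le> lam_crit m p n'" by (rule lam_crit_mono[OF a])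
  qed
qed

end
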